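(* Let $\alpha,\beta,\gamma$ be nonzero complex numbers, and put $x_{\alpha\beta}=\alpha e+\beta fk$, $x_{\alpha\gamma}=\alpha e+\gamma(k-1)$, $x_{\beta\gamma}=\beta fk+\gamma(k-1)$ in $\mathcal{U}$. (1) The right invariant subalgebra of $\mathcal{A}$ corresponding to $x_{\alpha\beta}$ is spanned by $\sum_{i\in I_\ell}x_i m^{(\ell)}_{ij}\sigma^s$, $\ell\in\mathbb{Z}_+$, $j\in I_\ell$, $s=0,1$, where (for the given $\ell,s$) $x_{-\ell}=1$; $x_{-\ell+2r+1}=0$ for $0\le r\le\ell-1$; and $x_{-\ell+2r}=(-\alpha\beta^{-1})^r\dfrac{\prod_{j=0}^{r-1}b_{-\ell+2j}}{\prod_{j=1}^{r}c_{-\ell+2j}}$ for $1\le r\le\ell$. (2) The right invariant subalgebra of $\mathcal{A}$ corresponding to $x_{\alpha\gamma}$ (resp. $x_{\beta\gamma}$) is spanned by $\sum_{i\in I_\ell}x_i m^{(\ell)}_{ij}\sigma^s$, $j\in I_\ell$, where $\ell\in\mathbb{Z}_+$ and $s\in\{0,1\}$ satisfy $\ell+s\in2\mathbb{Z}_+$, and where (for the given $\ell,s$): for $x_{\alpha\gamma}$, $x_i=0$ if $-\ell\le i\le-1$, $x_0=1$, and $x_i=(-\alpha\gamma^{-1})^i\dfrac{\prod_{j=0}^{i-1}b_j}{\prod_{j=1}^{i}a_j}$ if $1\le i\le\ell$; resp. for $x_{\beta\gamma}$, $x_0=1$, $x_i=0$ if $1\le i\le\ell$, and $x_i=(-\beta\gamma^{-1})^{-i}\dfrac{\prod_{j=i+1}^{0}c_j}{\prod_{j=i}^{-1}a_j}$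 if $-\ell\le i\le-1$. Here the scalars $a_i,b_i,c_i$ (depending on $\ell,s$) are defined by $R_{k-1}(\xi^{(\ell)}_i\sigma^s)=a_i\xi^{(\ell)}_i\sigma^s$, $R_e(\xi^{(\ell)}_i\sigma^s)=b_i\xi^{(\ell)}_{i+1}\sigma^s$, $R_{fk}(\xi^{(\ell)}_i\sigma^s)=c_i\xi^{(\ell)}_{i-1}\sigma^s$.
   Context: Let $0\ne q\in\mathbb{C}$ be not a root of $1$, $\mathbf{i}=\sqrt{-1}$, $t=\mathbf{i}\sqrt q$ (fixed square root). The algebra $\mathcal{U}=U_q(osp(1,2))$: the $\mathbb{Z}_2$-graded $\mathbb{C}$-algebra generated by $k^{\pm1},e,f$ with $kk^{-1}=k^{-1}k=1$, $kek^{-1}=qe$, $kfk^{-1}=q^{-1}f$, $ef+fe=\frac{k-k^{-1}}{q-q^{-1}}$, parity $p(k^{\pm1})=0$, $p(e)=p(f)=1$; $\mathbb{Z}_2$-graded Hopf structure $\Delta(k^{\pm1})=k^{\pm1}\otimes k^{\pm1}$, $\Delta(e)=e\otimes1+k\otimes e$, $\Delta(f)=f\otimes k^{-1}+1\otimes f$, $S(k^{\pm1})=k^{\mp1}$, $S(e)=-k^{-1}e$, $S(f)=-fk$, $\varepsilon(k^{\pm1})=1$, $\varepsilon(e)=\varepsilon(f)=0$. The algebra $\mathcal{A}=\mathbb{C}_q[osp(1,2)]$: the $\mathbb{Z}_2$-graded $\mathbb{C}$-algebra generated by $a,b,c,d,\sigma$ with relations $ab=tba$, $ac=tca$, $bc=-cb$,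 $bd=-tdb$, $cd=-tdc$, $ad-da=(t^{-1}-t)bc$, $ad+tbc=\sigma$, $\sigma^2=1$, parity $p(a)=p(d)=p(\sigma)=0$, $p(b)=p(c)=1$; $\Delta(a)=a\otimes a+b\otimes c$, $\Delta(b)=a\otimes b+b\otimes d$, $\Delta(c)=c\otimes a+d\otimes c$, $\Delta(d)=c\otimes b+d\otimes d$, $\Delta(\sigma)=\sigma\otimes\sigma$; $\varepsilon(a)=\varepsilon(d)=\varepsilon(\sigma)=1$, $\varepsilon(b)=\varepsilon(c)=0$. Coproducts are multiplicative for the graded tensor product $(x\otimes y)(z\otimes w)=(-1)^{p(y)p(z)}xz\otimes yw$. Dual pairing $u(x)=x(u)$ ($u\in\mathcal{U}$, $x\in\mathcal{A}$): $k^{\pm1}$ are algebra homomorphisms $\mathcal{A}\to\mathbb{C}$ with $k^{\pm1}(a)=t^{\pm1}$, $k^{\pm1}(d)=-t^{\mp1}$, $k^{\pm1}(\sigma)=-1$, $k^{\pm1}(b)=k^{\pm1}(c)=0$; $e(b)=\frac{t-t^{-1}}{q-q^{-1}}$ and $e$ vanishes on $1,a,c,d,\sigma$; $f(c)=1$ and $f$ vanishes on $1,a,b,d,\sigma$; $e(xy)=e(x)\varepsilon(y)+(-1)^{p(x)}k(x)e(y)$, $f(xy)=f(x)k^{-1}(y)+(-1)^{p(x)}\varepsilon(x)f(y)$; and products in $\mathcal{U}$ are dual to the coproduct of $\mathcal{A}$. Right action of $\mathcal{U}$ on $\mathcal{A}$: with $\Delta(u)=\sum u_1\otimes u_2$,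 $R_x(u)=\sum x(u_1)u_2$, linear in $x$; it satisfies $R_{xy}=(-1)^{p(x)p(y)}R_yR_x$ for homogeneous $x,y$. For $x\in\mathcal{U}$ with $\varepsilon(x)=0$, the right invariant subalgebra of $\mathcal{A}$ corresponding to $x$ is by definition the space $\{u\in\mathcal{A}: R_x(u)=0\}$. For $\ell\in\frac12\mathbb{Z}_+$ (with $\mathbb{Z}_+=\{0,1,2,\dots\}$) let $I_\ell=\{-\ell,-\ell+1,\dots,\ell\}$ and, for $i\in I_\ell$, $\xi^{(\ell)}_i=\mathbf{i}^{[\frac{\ell+i}2]}\binom{2\ell}{\ell+i}^{1/2}_{t^{-2}}a^{\ell-i}c^{\ell+i}$, where $[\cdot]$ is the integer part, $\binom mn_v=\frac{(v;v)_m}{(v;v)_n(v;v)_{m-n}}$, $(u;v)_m=\prod_{r=0}^{m-1}(1-uv^r)$, with square roots fixed; $\xi^{(\ell)}_{\pm(\ell+1)}:=0$. The span $V^L_\ell\sigma^s$ of the $\xi^{(\ell)}_i\sigma^s$ ($i\in I_\ell$) is an irreducible left $\mathcal{A}$-subcomodule of $\mathcal{A}$, hence stable under the operators $R_x$, and the matrix elements $m^{(\ell)}_{ij}\in\mathcal{A}$ ($i,j\in I_\ell$) are defined by $\Delta(\xi^{(\ell)}_i\sigma^s)=\sum_{j\in I_\ell}m^{(\ell)}_{ij}\sigma^s\otimes\xi^{(\ell)}_j\sigma^s$ ($s=0,1$). With $M_\ell\sigma^s=\sum_{i,j\in I_\ell}\mathbb{C}m^{(\ell)}_{ij}\sigma^s$,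 it is known that $\mathcal{A}=\bigoplus_{\ell\in\frac12\mathbb{Z}_+}(M_\ell\oplus M_\ell\sigma)$. *)

theory Defs
  imports Complex_Main "HOL-Library.Poly_Mapping" "HOL-Algebra.QuotRing" "HOL-Algebra.Module"
begin

section \<open>Free algebras and presentations\<close>

text \<open>
  The free \<open>\<complex>\<close>-algebra on a set of generators consists of the finitely supported functions on
  words; its product is the convolution product that \<^theory>\<open>HOL-Library.Poly_Mapping\<close> provides
  over any additively written monoid.
\<close>

datatype 'g word = Word (letters: "'g list")

instantiation word :: (type) monoid_add
begin

definition zero_word_def: "0 = Word []"
definition plus_word_def: "u + v = Word (letters u @ letters v)"

instance
  by standard (simp_all add: zero_word_def plus_word_def)

end

type_synonym 'g free = "'g word \<Rightarrow>\<^sub>0 complex"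

definition gen :: "'g \<Rightarrow> 'g free" where
  "gen g = Poly_Mapping.single (Word [g]) 1"

definition scal :: "complex \<Rightarrow> ('k \<Rightarrow>\<^sub>0 complex) \<Rightarrow> ('k \<Rightarrow>\<^sub>0 complex)" where
  "scal z x = Poly_Mapping.map ((*) z) x"

definition lin_ext :: "('k \<Rightarrow> complex) \<Rightarrow> ('k \<Rightarrow>\<^sub>0 complex) \<Rightarrow> complex" where
  "lin_ext \<phi> x = (\<Sum>w\<in>Poly_Mapping.keys x. Poly_Mapping.lookup x w * \<phi> w)"

definition free_alg :: "(complex, 'g free) module" where
  "free_alg = \<lparr>carrier = UNIV, mult = (*), one = 1, zero = 0, add = (+), smult = scal\<rparr>"

definition lin_span :: "(complex, 'v, 'm) module_scheme \<Rightarrow> 'v set \<Rightarrow> 'v set" where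
  "lin_span M S =
     {\<Oplus>\<^bsub>M\<^esub>v\<in>T. \<phi> v \<odot>\<^bsub>M\<^esub> v | T \<phi>. finite T \<and> T \<subseteq> S}"

text \<open>
  The quotient of an algebra by a two-sided ideal, with its scalar multiplication. Here and below,
  \<^term>\<open>the_elem\<close> of a set of values over all representatives expresses an induced map.
\<close>

definition quot_alg :: "(complex, 'v) module \<Rightarrow> 'v set \<Rightarrow> (complex, 'v set) module" where
  "quot_alg R J = ring.extend (R Quot J)
     \<lparr>smult = (\<lambda>z X. the_elem ((\<lambda>x. J +>\<^bsub>R\<^esub> (z \<odot>\<^bsub>R\<^esub> x)) ` X))\<rparr>"


section \<open>The algebra \<open>U\<^sub>q(osp(1,2))\<close>\<close>

text \<open>\<open>Gki\<close> stands for the inverse of \<open>Gk\<close>.\<close>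

datatype ugen = Gk | Gki | Ge | Gf

definition U_rels :: "complex \<Rightarrow> ugen free set" where
  "U_rels q =
     {gen Gk * gen Gki - 1,
      gen Gki * gen Gk - 1,
      gen Gk * gen Ge * gen Gki - scal q (gen Ge),
      gen Gk * gen Gf * gen Gki - scal (1 / q) (gen Gf),
      gen Ge * gen Gf + gen Gf * gen Ge - scal (1 / (q - 1 / q)) (gen Gk - gen Gki)}"

definition U_ideal :: "complex \<Rightarrow> ugen free set" where
  "U_ideal q = Idl\<^bsub>free_alg\<^esub> (U_rels q)"

definition Uq :: "complex \<Rightarrow> (complex, ugen free set) module" where
  "Uq q = quot_alg free_alg (U_ideal q)"

definition U_proj :: "complex \<Rightarrow> ugen free \<Rightarrow> ugen free set" where
  "U_proj q x = U_ideal q +>\<^bsub>free_alg\<^esub> x"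


section \<open>The algebra \<open>\<complex>\<^sub>q[osp(1,2)]\<close>\<close>

datatype agen = Ga | Gb | Gc | Gd | Gs

definition A_rels :: "complex \<Rightarrow> agen free set" where
  "A_rels t =
     {gen Ga * gen Gb - scal t (gen Gb * gen Ga),
      gen Ga * gen Gc - scal t (gen Gc * gen Ga),
      gen Gb * gen Gc + gen Gc * gen Gb,
      gen Gb * gen Gd + scal t (gen Gd * gen Gb),
      gen Gc * gen Gd + scal t (gen Gd * gen Gc),
      gen Ga * gen Gd - gen Gd * gen Ga - scal (1 / t - t) (gen Gb * gen Gc),
      gen Ga * gen Gd + scal t (gen Gb * gen Gc) - gen Gs,
      gen Gs * gen Gs - 1}"

definition A_ideal :: "complex \<Rightarrow> agen free set" where
  "A_ideal t = Idl\<^bsub>free_alg\<^esub> (A_rels t)"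

definition Aq :: "complex \<Rightarrow> (complex, agen free set) module" where
  "Aq t = quot_alg free_alg (A_ideal t)"

definition A_proj :: "complex \<Rightarrow> agen free \<Rightarrow> agen free set" where
  "A_proj t x = A_ideal t +>\<^bsub>free_alg\<^esub> x"

fun parity :: "agen \<Rightarrow> nat" where
  "parity Gb = 1"
| "parity Gc = 1"
| "parity _ = 0"

definition word_parity :: "agen word \<Rightarrow> nat" where
  "word_parity w = sum_list (map parity (letters w))"


subsection \<open>The graded tensor square and the coproduct\<close>

text \<open>
  With \<open>F\<close> the free algebra on \<^typ>\<open>agen\<close> and \<open>J\<close> its ideal of relations, \<open>F \<otimes> F\<close> has the pairs of
  words as a basis, and the tensor square of \<open>F/J\<close> is \<open>F \<otimes> F\<close> modulo \<open>J \<otimes> F + F \<otimes> J\<close>.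
\<close>

type_synonym agen_tens = "(agen word \<times> agen word) \<Rightarrow>\<^sub>0 complex"

definition tens :: "agen free \<Rightarrow> agen free \<Rightarrow> agen_tens" where
  "tens x y = (\<Sum>u\<in>Poly_Mapping.keys x. \<Sum>v\<in>Poly_Mapping.keys y.
     Poly_Mapping.single (u, v) (Poly_Mapping.lookup x u * Poly_Mapping.lookup y v))"

definition tens_mult :: "agen_tens \<Rightarrow> agen_tens \<Rightarrow> agen_tens" where
  "tens_mult X Y = (\<Sum>(u, v)\<in>Poly_Mapping.keys X. \<Sum>(u', v')\<in>Poly_Mapping.keys Y.
     Poly_Mapping.single (u + u', v + v')
       ((-1) ^ (word_parity v * word_parity u')
          * Poly_Mapping.lookup X (u, v) * Poly_Mapping.lookup Y (u', v')))"

definition free_tens_alg :: "(complex, agen_tens) module" where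
  "free_tens_alg =
     \<lparr>carrier = UNIV, mult = tens_mult, one = tens 1 1, zero = 0, add = (+), smult = scal\<rparr>"

definition AA_ideal :: "complex \<Rightarrow> agen_tens set" where
  "AA_ideal t = lin_span free_tens_alg {tens x y | x y. x \<in> A_ideal t \<or> y \<in> A_ideal t}"

definition AAq :: "complex \<Rightarrow> (complex, agen_tens set) module" where
  "AAq t = quot_alg free_tens_alg (AA_ideal t)"

definition AA_proj :: "complex \<Rightarrow> agen_tens \<Rightarrow> agen_tens set" where
  "AA_proj t X = AA_ideal t +>\<^bsub>free_tens_alg\<^esub> X"

definition A_tens :: "complex \<Rightarrow> agen free set \<Rightarrow> agen free set \<Rightarrow> agen_tens set" where
  "A_tens t X Y = the_elem {AA_proj t (tens x y) | x y. x \<in> X \<and> y \<in> Y}"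

fun comult_gen :: "agen \<Rightarrow> agen_tens" where
  "comult_gen Ga = tens (gen Ga) (gen Ga) + tens (gen Gb) (gen Gc)"
| "comult_gen Gb = tens (gen Ga) (gen Gb) + tens (gen Gb) (gen Gd)"
| "comult_gen Gc = tens (gen Gc) (gen Ga) + tens (gen Gd) (gen Gc)"
| "comult_gen Gd = tens (gen Gc) (gen Gb) + tens (gen Gd) (gen Gd)"
| "comult_gen Gs = tens (gen Gs) (gen Gs)"

definition free_comult :: "agen free \<Rightarrow> agen_tens" where
  "free_comult x = (\<Sum>w\<in>Poly_Mapping.keys x. scal (Poly_Mapping.lookup x w)
     (foldr (\<lambda>g. tens_mult (comult_gen g)) (letters w) (tens 1 1)))"

definition comult :: "complex \<Rightarrow> agen free set \<Rightarrow> agen_tens set" where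
  "comult t X = the_elem ((\<lambda>x. AA_proj t (free_comult x)) ` X)"


subsection \<open>The dual pairing and the right action\<close>

text \<open>
  The values of the generators of \<^const>\<open>Uq\<close> on words. The recursions for \<open>e\<close> and \<open>f\<close> are the
  rules \<open>e(xy) = e(x)\<epsilon>(y) + (-1)\<^bsup>p(x)\<^esup>k(x)e(y)\<close> and \<open>f(xy) = f(x)k\<inverse>(y) + (-1)\<^bsup>p(x)\<^esup>\<epsilon>(x)f(y)\<close> with
  \<open>x\<close> a generator.
\<close>

fun counit_gen :: "agen \<Rightarrow> complex" where
  "counit_gen Gb = 0"
| "counit_gen Gc = 0"
| "counit_gen _ = 1"

fun k_gen :: "complex \<Rightarrow> agen \<Rightarrow> complex" where
  "k_gen t Ga = t"
| "k_gen t Gd = - (1 / t)"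
| "k_gen t Gs = -1"
| "k_gen t _ = 0"

fun ki_gen :: "complex \<Rightarrow> agen \<Rightarrow> complex" where
  "ki_gen t Ga = 1 / t"
| "ki_gen t Gd = - t"
| "ki_gen t Gs = -1"
| "ki_gen t _ = 0"

fun e_gen :: "complex \<Rightarrow> complex \<Rightarrow> agen \<Rightarrow> complex" where
  "e_gen q t Gb = (t - 1 / t) / (q - 1 / q)"
| "e_gen q t _ = 0"

fun f_gen :: "agen \<Rightarrow> complex" where
  "f_gen Gc = 1"
| "f_gen _ = 0"

definition mult_ext :: "(agen \<Rightarrow> complex) \<Rightarrow> agen list \<Rightarrow> complex" where
  "mult_ext \<phi> gs = prod_list (map \<phi> gs)"

fun e_word :: "complex \<Rightarrow> complex \<Rightarrow> agen list \<Rightarrow> complex" where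
  "e_word q t [] = 0"
| "e_word q t (g # gs) =
     e_gen q t g * mult_ext counit_gen gs + (-1) ^ parity g * k_gen t g * e_word q t gs"

fun f_word :: "complex \<Rightarrow> agen list \<Rightarrow> complex" where
  "f_word t [] = 0"
| "f_word t (g # gs) =
     f_gen g * mult_ext (ki_gen t) gs + (-1) ^ parity g * counit_gen g * f_word t gs"

fun ugen_word :: "complex \<Rightarrow> complex \<Rightarrow> ugen \<Rightarrow> agen word \<Rightarrow> complex" where
  "ugen_word q t Gk w = mult_ext (k_gen t) (letters w)"
| "ugen_word q t Gki w = mult_ext (ki_gen t) (letters w)"
| "ugen_word q t Ge w = e_word q t (letters w)"
| "ugen_word q t Gf w = f_word t (letters w)"

text \<open>
  Products in \<^const>\<open>Uq\<close> are dual to the coproduct: \<open>(xy)(u) = \<Sum> x(u\<^sub>1) y(u\<^sub>2)\<close>, without a sign. A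
  sign \<open>(-1)\<^bsup>p(x)p(y)\<^esup>\<close> on the right would contradict \<open>ef + fe = (k - k\<inverse>)/(q - q\<inverse>)\<close>, as evaluation
  at \<open>a\<close> shows.
\<close>

fun pair_word :: "complex \<Rightarrow> complex \<Rightarrow> ugen list \<Rightarrow> agen free \<Rightarrow> complex" where
  "pair_word q t [] u = lin_ext (\<lambda>w. mult_ext counit_gen (letters w)) u"
| "pair_word q t (g # gs) u =
     lin_ext (\<lambda>(v, w). ugen_word q t g v * pair_word q t gs (Poly_Mapping.single w 1))
       (free_comult u)"

definition free_pair :: "complex \<Rightarrow> complex \<Rightarrow> ugen free \<Rightarrow> agen free \<Rightarrow> complex" where
  "free_pair q t x u = lin_ext (\<lambda>w. pair_word q t (letters w) u) x"

definition pair :: "complex \<Rightarrow> complex \<Rightarrow> ugen free set \<Rightarrow> agen free set \<Rightarrow> complex" where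
  "pair q t X V = the_elem {free_pair q t x u | x u. x \<in> X \<and> u \<in> V}"

text \<open>\<open>R\<^sub>X(V) = \<Sum> X(V\<^sub>1) V\<^sub>2\<close>, computed from a representative of the coproduct of \<open>V\<close>.\<close>

definition R_act :: "complex \<Rightarrow> complex \<Rightarrow> ugen free set \<Rightarrow> agen free set \<Rightarrow> agen free set" where
  "R_act q t X V = the_elem
     {\<Oplus>\<^bsub>Aq t\<^esub>p\<in>Poly_Mapping.keys D.
        (Poly_Mapping.lookup D p * pair q t X (A_proj t (Poly_Mapping.single (fst p) 1)))
          \<odot>\<^bsub>Aq t\<^esub> A_proj t (Poly_Mapping.single (snd p) 1) | D. D \<in> comult t V}"

text \<open>Meant for \<open>X\<close> with \<open>\<epsilon>(X) = 0\<close>; this holds for the three elements considered below.\<close>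

definition right_inv_subalg :: "complex \<Rightarrow> complex \<Rightarrow> ugen free set \<Rightarrow> agen free set set" where
  "right_inv_subalg q t X = {V \<in> carrier (Aq t). R_act q t X V = \<zero>\<^bsub>Aq t\<^esub>}"


section \<open>Matrix elements\<close>

definition qpoch :: "complex \<Rightarrow> complex \<Rightarrow> nat \<Rightarrow> complex" where
  "qpoch u v m = (\<Prod>r<m. 1 - u * v ^ r)"

definition qbinom :: "complex \<Rightarrow> nat \<Rightarrow> nat \<Rightarrow> complex" where
  "qbinom v m n = qpoch v v m / (qpoch v v n * qpoch v v (m - n))"

text \<open>
  Both \<open>l\<close> and the elements of \<open>I\<^sub>l\<close> may be half-integers, hence the type \<^typ>\<open>rat\<close>. The
  argument \<open>sb m n\<close> below is the fixed square root of \<open>qbinom (t\<^bsup>-2\<^esup>) m n\<close>.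
\<close>

definition I_set :: "rat \<Rightarrow> rat set" where
  "I_set l = {- l + of_nat r | r. - l + of_nat r \<le> l}"

definition xi :: "complex \<Rightarrow> (nat \<Rightarrow> nat \<Rightarrow> complex) \<Rightarrow> rat \<Rightarrow> rat \<Rightarrow> agen free set" where
  "xi t sb l i =
     (if i \<in> I_set l
      then A_proj t (scal (\<i> ^ nat \<lfloor>(l + i) / 2\<rfloor> * sb (nat \<lfloor>2 * l\<rfloor>) (nat \<lfloor>l + i\<rfloor>))
             (gen Ga ^ nat \<lfloor>l - i\<rfloor> * gen Gc ^ nat \<lfloor>l + i\<rfloor>))
      else \<zero>\<^bsub>Aq t\<^esub>)"

definition times_sigma :: "complex \<Rightarrow> agen free set \<Rightarrow> nat \<Rightarrow> agen free set" where
  "times_sigma t V s = V \<otimes>\<^bsub>Aq t\<^esub> (A_proj t (gen Gs) [^]\<^bsub>Aq t\<^esub> s)"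

definition is_mat_elems ::
    "complex \<Rightarrow> (nat \<Rightarrow> nat \<Rightarrow> complex) \<Rightarrow> rat \<Rightarrow> (rat \<Rightarrow> rat \<Rightarrow> agen free set) \<Rightarrow> bool" where
  "is_mat_elems t sb l m \<longleftrightarrow>
     (\<forall>i\<in>I_set l. \<forall>j\<in>I_set l. m i j \<in> carrier (Aq t)) \<and>
     (\<forall>s\<in>{0, 1}. \<forall>i\<in>I_set l. comult t (times_sigma t (xi t sb l i) s) =
        (\<Oplus>\<^bsub>AAq t\<^esub>j\<in>I_set l.
           A_tens t (times_sigma t (m i j) s) (times_sigma t (xi t sb l j) s)))"

text \<open>
  The values on \<^term>\<open>I_set l\<close> are uniquely determined, the \<^term>\<open>xi t sb l j\<close> being linearly
  independent.
\<close>

definition mat_elem ::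
    "complex \<Rightarrow> (nat \<Rightarrow> nat \<Rightarrow> complex) \<Rightarrow> rat \<Rightarrow> rat \<Rightarrow> rat \<Rightarrow> agen free set" where
  "mat_elem t sb l = (SOME m. is_mat_elems t sb l m)"


section \<open>The elements \<open>x\<^sub>\<alpha>\<^sub>\<beta>\<close>, \<open>x\<^sub>\<alpha>\<^sub>\<gamma>\<close>, \<open>x\<^sub>\<beta>\<^sub>\<gamma>\<close> and the coefficients\<close>

definition x_\<alpha>\<beta> :: "complex \<Rightarrow> complex \<Rightarrow> complex \<Rightarrow> ugen free set" where
  "x_\<alpha>\<beta> q \<alpha> \<beta> = U_proj q (scal \<alpha> (gen Ge) + scal \<beta> (gen Gf * gen Gk))"

definition x_\<alpha>\<gamma> :: "complex \<Rightarrow> complex \<Rightarrow> complex \<Rightarrow> ugen free set" where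
  "x_\<alpha>\<gamma> q \<alpha> \<gamma> = U_proj q (scal \<alpha> (gen Ge) + scal \<gamma> (gen Gk - 1))"

definition x_\<beta>\<gamma> :: "complex \<Rightarrow> complex \<Rightarrow> complex \<Rightarrow> ugen free set" where
  "x_\<beta>\<gamma> q \<beta> \<gamma> = U_proj q (scal \<beta> (gen Gf * gen Gk) + scal \<gamma> (gen Gk - 1))"

text \<open>
  The scalars \<open>a\<^sub>i\<close>, \<open>b\<^sub>i\<close>, \<open>c\<^sub>i\<close>. The values \<open>b\<^sub>l\<close> and \<open>c\<^sub>-\<^sub>l\<close> are undetermined and not used.
\<close>

definition coef_a ::
    "complex \<Rightarrow> complex \<Rightarrow> (nat \<Rightarrow> nat \<Rightarrow> complex) \<Rightarrow> rat \<Rightarrow> nat \<Rightarrow> rat \<Rightarrow> complex" where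
  "coef_a q t sb l s i = (THE z. R_act q t (U_proj q (gen Gk - 1)) (times_sigma t (xi t sb l i) s) =
     z \<odot>\<^bsub>Aq t\<^esub> times_sigma t (xi t sb l i) s)"

definition coef_b ::
    "complex \<Rightarrow> complex \<Rightarrow> (nat \<Rightarrow> nat \<Rightarrow> complex) \<Rightarrow> rat \<Rightarrow> nat \<Rightarrow> rat \<Rightarrow> complex" where
  "coef_b q t sb l s i = (THE z. R_act q t (U_proj q (gen Ge)) (times_sigma t (xi t sb l i) s) =
     z \<odot>\<^bsub>Aq t\<^esub> times_sigma t (xi t sb l (i + 1)) s)"

definition coef_c ::
    "complex \<Rightarrow> complex \<Rightarrow> (nat \<Rightarrow> nat \<Rightarrow> complex) \<Rightarrow> rat \<Rightarrow> nat \<Rightarrow> rat \<Rightarrow> complex" where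
  "coef_c q t sb l s i = (THE z. R_act q t (U_proj q (gen Gf * gen Gk)) (times_sigma t (xi t sb l i) s) =
     z \<odot>\<^bsub>Aq t\<^esub> times_sigma t (xi t sb l (i - 1)) s)"

text \<open>
  The families \<open>(x\<^sub>i)\<close>, for \<open>i \<in> I\<^sub>l\<close>. In the first, \<open>i = -l + n\<close>. The normalisations
  \<open>x\<^sub>-\<^sub>l = 1\<close> and \<open>x\<^sub>0 = 1\<close> are the cases of empty products.
\<close>

definition sol_\<alpha>\<beta> ::
    "complex \<Rightarrow> complex \<Rightarrow> (rat \<Rightarrow> complex) \<Rightarrow> (rat \<Rightarrow> complex) \<Rightarrow> nat \<Rightarrow> rat \<Rightarrow> complex" where
  "sol_\<alpha>\<beta> \<alpha> \<beta> b c l i =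
     (let n = nat \<lfloor>of_nat l + i\<rfloor>; r = n div 2 in
      if odd n then 0
      else (- (\<alpha> / \<beta>)) ^ r * ((\<Prod>j<r. b (- of_nat l + 2 * of_nat j)) /
             (\<Prod>j=1..r. c (- of_nat l + 2 * of_nat j))))"

definition sol_\<alpha>\<gamma> ::
    "complex \<Rightarrow> complex \<Rightarrow> (rat \<Rightarrow> complex) \<Rightarrow> (rat \<Rightarrow> complex) \<Rightarrow> rat \<Rightarrow> complex" where
  "sol_\<alpha>\<gamma> \<alpha> \<gamma> a b i =
     (if i < 0 then 0
      else (- (\<alpha> / \<gamma>)) ^ nat \<lfloor>i\<rfloor> * ((\<Prod>j=0..\<lfloor>i\<rfloor> - 1. b (of_int j)) / (\<Prod>j=1..\<lfloor>i\<rfloor>. a (of_int j))))"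

definition sol_\<beta>\<gamma> ::
    "complex \<Rightarrow> complex \<Rightarrow> (rat \<Rightarrow> complex) \<Rightarrow> (rat \<Rightarrow> complex) \<Rightarrow> rat \<Rightarrow> complex" where
  "sol_\<beta>\<gamma> \<beta> \<gamma> a c i =
     (if i > 0 then 0
      else (- (\<beta> / \<gamma>)) ^ nat (- \<lfloor>i\<rfloor>) *
             ((\<Prod>j=\<lfloor>i\<rfloor> + 1..0. c (of_int j)) / (\<Prod>j=\<lfloor>i\<rfloor>..-1. a (of_int j))))"

definition mat_comb ::
    "complex \<Rightarrow> (nat \<Rightarrow> nat \<Rightarrow> complex) \<Rightarrow> rat \<Rightarrow> nat \<Rightarrow> (rat \<Rightarrow> complex) \<Rightarrow> rat \<Rightarrow> agen free set" where
  "mat_comb t sb l s x j =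
     (\<Oplus>\<^bsub>Aq t\<^esub>i\<in>I_set l. x i \<odot>\<^bsub>Aq t\<^esub> times_sigma t (mat_elem t sb l i j) s)"

end

(*
The monomials a^z b^i c^j sigma^s (z >= 0) and d^z b^i c^j sigma^s (z > 0) form a basis of A, as an explicit
representation of A on their formal span shows. Let F be the free algebra of which A is a quotient. The
generators k, e, f of U act on F by twisted derivations R that commute with the left coaction, so with
m_ij = (id (x) phi_j) Delta(xi_i), phi_j a coordinate functional, R_x(xi_i) = sum rho_ik xi_k implies
R_x(m_ij) = sum rho_ik m_kj.

The m_ij sigma^s are independent: the highest power of R_e that does not kill a combination sends it to
a combination of the m_lj sigma^s, multiples of the distinct monomials c^(l-j) d^(l+j) sigma^s. They span A by
counting monomials of degree at most n. Hence the kernel of R_x is found by solving, for each l and s,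
the linear recurrence sum_i x_i rho_ik = 0. It is two- or three-term with at most one solution up to scaling:
b_i, c_i do not vanish, and a_i = (-1)^(l+s) q^(-i) - 1 vanishes only for i = 0, l + s even.
*)
theory Submission
  imports Defs
begin

text \<open>The objects of the statement are defined on cosets through all representatives, so each
  has to be shown independent of the choice. The arguments therefore live in F with the congruence
  \<open>eqv\<close>. The representation turns \<open>eqv\<close> into equality of the vectors
  \<open>act t x vac\<close>; applied to both legs it certifies membership in the ideal of the
  tensor square, so that compatibility of the coproduct with the relations becomes a finite
  calculation. The relations of U hold for the operators R exactly on F, not just modulo the
  relations of A, and the pairing is the counit after R; one operator thus carries both the pairing
  and the action.

  Spins and square roots are removed first: with n = 2l and i counted from 0, a^(n-i) c^i sigma^s
  replaces xi. The square roots return only as a diagonal change of basis, which also conjugates b_i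
  and c_i. All nonvanishing rests on t^2 = -q not being a root of unity: up to nonzero factors the
  coefficients of R_e and R_f are the quantum integers (t^m - t^-m)/(t - t^-1), and the coefficients
  in the coproduct of c^n are Gaussian binomials in t^-2.\<close>

abbreviation single :: "'k \<Rightarrow> 'c::zero \<Rightarrow> 'k \<Rightarrow>\<^sub>0 'c" where "single \<equiv> Poly_Mapping.single"
abbreviation lookup :: "('k \<Rightarrow>\<^sub>0 'c::zero) \<Rightarrow> 'k \<Rightarrow> 'c" where "lookup \<equiv> Poly_Mapping.lookup"
abbreviation keys :: "('k \<Rightarrow>\<^sub>0 'c::zero) \<Rightarrow> 'k set" where "keys \<equiv> Poly_Mapping.keys"

section \<open>Linear maps between free vector spaces\<close>

lemma lookup_scal [simp]: "lookup (scal z x) k = z * lookup x k"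
  by (simp add: scal_def map.rep_eq when_def)

interpretation pm: vector_space "scal :: complex \<Rightarrow> ('k \<Rightarrow>\<^sub>0 complex) \<Rightarrow> _"
  by standard (auto intro!: poly_mapping_eqI simp: lookup_add algebra_simps)

lemma vector_space_complex: "vector_space ((*) :: complex \<Rightarrow> complex \<Rightarrow> complex)"
  by standard (auto simp: algebra_simps)

abbreviation lin :: "(('k \<Rightarrow>\<^sub>0 complex) \<Rightarrow> ('l \<Rightarrow>\<^sub>0 complex)) \<Rightarrow> bool" where
  "lin \<equiv> module_hom scal scal"

abbreviation linf :: "(('k \<Rightarrow>\<^sub>0 complex) \<Rightarrow> complex) \<Rightarrow> bool" where
  "linf \<equiv> module_hom scal (*)"

lemma linI:
  assumes "\<And>x y. f (x + y) = f x + f y" "\<And>z x. f (scal z x) = scal z (f x)"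
  shows "lin f"
  using assms by unfold_locales auto

lemma linfI:
  assumes "\<And>x y. f (x + y) = f x + f y" "\<And>z x. f (scal z x) = z * f x"
  shows "linf f"
  using assms by unfold_locales (auto simp: algebra_simps)

lemma scal_single [simp]: "scal z (single k c) = single k (z * c)"
  by (rule poly_mapping_eqI) (simp add: lookup_single when_def)

lemma pm_expand: "x = (\<Sum>k\<in>keys x. single k (lookup x k))"
  by (rule poly_mapping_eqI)
    (simp add: lookup_sum lookup_single when_def in_keys_iff)

lemma hom_expand:
  assumes "module_hom scal s f"
  shows "f x = (\<Sum>k\<in>keys x. s (lookup x k) (f (single k 1)))"
proof -
  have "f x = f (\<Sum>k\<in>keys x. scal (lookup x k) (single k 1))"
    using pm_expand[of x] by simp
  then show ?thesis
    by (simp only: module_hom.sum[OF assms] module_hom.scale[OF assms])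
qed

lemma hom_eqI:
  assumes "module_hom scal s f" "module_hom scal s g"
    and "\<And>k. f (single k 1) = g (single k 1)"
  shows "f x = g x"
  using assms(3) by (simp add: hom_expand[OF assms(1), of x] hom_expand[OF assms(2), of x])

text \<open>The summation range \<open>keys x\<close> varies with x, so additivity is not termwise;
  both sides are first extended by zeros to a common finite superset of the supports.\<close>

lemma keys_sum_hom:
  fixes f :: "'a \<Rightarrow> 'b::ab_group_add"
  assumes "vector_space s"
  shows "module_hom scal s (\<lambda>x. \<Sum>k\<in>keys x. s (lookup x k) (f k))"
proof -
  interpret vector_space s by fact
  have ext: "(\<Sum>k\<in>keys x. s (lookup x k) (f k)) =
     (\<Sum>k\<in>K. s (lookup x k) (f k))"
    if "keys x \<subseteq> K" "finite K" for x K
    by (rule sum.mono_neutral_left) (use that in \<open>auto simp: in_keys_iff\<close>)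
  show ?thesis
  proof unfold_locales
    fix x y :: "'a \<Rightarrow>\<^sub>0 complex"
    let ?K = "keys x \<union> keys y"
    show "(\<Sum>k\<in>keys (x + y). s (lookup (x + y) k) (f k)) =
      (\<Sum>k\<in>keys x. s (lookup x k) (f k)) +
      (\<Sum>k\<in>keys y. s (lookup y k) (f k))"
      using keys_add[of x y]
      by (simp add: ext[of "x + y" ?K] ext[of x ?K] ext[of y ?K] sum.distrib [symmetric])
        (simp add: lookup_add scale_left_distrib)
  next
    fix z and x :: "'a \<Rightarrow>\<^sub>0 complex"
    have "keys (scal z x) \<subseteq> keys x"
      by (auto simp: in_keys_iff)
    then show "(\<Sum>k\<in>keys (scal z x). s (lookup (scal z x) k) (f k)) =
      s z (\<Sum>k\<in>keys x. s (lookup x k) (f k))"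
      by (subst ext[of "scal z x" "keys x"]) (simp_all add: scale_sum_right)
  qed
qed

definition lext :: "('k \<Rightarrow> ('l \<Rightarrow>\<^sub>0 complex)) \<Rightarrow> ('k \<Rightarrow>\<^sub>0 complex) \<Rightarrow> ('l \<Rightarrow>\<^sub>0 complex)" where
  "lext f x = (\<Sum>k\<in>keys x. scal (lookup x k) (f k))"

lemma lin_lext: "lin (lext f)"
  using keys_sum_hom[OF pm.vector_space_axioms, of f] by (simp add: lext_def[abs_def])

lemma lext_single [simp]: "lext f (single k c) = scal c (f k)"
  by (simp add: lext_def)

lemma linf_lin_ext: "linf (lin_ext f)"
  using keys_sum_hom[OF vector_space_complex, of f] by (simp add: lin_ext_def[abs_def])

lemma lin_ext_single [simp]: "lin_ext f (single k c) = c * f k"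
  by (simp add: lin_ext_def)

lemmas hom_rules = module_hom.add module_hom.scale module_hom.zero module_hom.diff module_hom.neg

lemmas lext_simps [simp] =
  hom_rules[OF lin_lext]

lemmas lin_ext_simps [simp] =
  hom_rules[OF linf_lin_ext]

lemma lin_id: "lin (\<lambda>x. x)"
  by (rule linI) auto

lemma lin_comp:
  assumes "lin f" "module_hom scal s g"
  shows "module_hom scal s (\<lambda>x. g (f x))"
  using module_hom_compose[OF assms] by (simp add: o_def)

lemma lin_add:
  assumes "lin f" "lin g"
  shows "lin (\<lambda>x. f x + g x)"
  by (rule linI)
    (simp_all add: module_hom.add[OF assms(1)] module_hom.add[OF assms(2)]
      module_hom.scale[OF assms(1)] module_hom.scale[OF assms(2)] pm.scale_right_distrib)

lemma lin_scal:
  assumes "lin f"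
  shows "lin (\<lambda>x. scal z (f x))"
  by (rule linI)
    (simp_all add: module_hom.add[OF assms] module_hom.scale[OF assms] pm.scale_right_distrib
      mult.commute)

lemma lin_ext_comp: "module_hom scal (*) g \<Longrightarrow> lin_ext (\<lambda>k. g (single k 1)) x = g x"
  by (rule hom_eqI[OF linf_lin_ext]) auto

subsection \<open>Tensor products\<close>

text \<open>A polymorphic form of \<open>tens\<close>: tensors over the index type
  \<open>idx\<close> of the monomial basis are needed as well as tensors over words.\<close>

definition tns :: "('k \<Rightarrow>\<^sub>0 complex) \<Rightarrow> ('l \<Rightarrow>\<^sub>0 complex) \<Rightarrow> ('k \<times> 'l \<Rightarrow>\<^sub>0 complex)" where
  "tns x y = lext (\<lambda>u. lext (\<lambda>v. single (u, v) 1) y) x"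

lemma lookup_tns [simp]:
  "lookup (tns x y) p = lookup x (fst p) * lookup y (snd p)"
proof -
  obtain u v where p: "p = (u, v)" by (cases p)
  have 1: "lookup (lext (\<lambda>v. single (u', v) (1::complex)) y) (u, v) =
      (if u = u' then lookup y v else 0)" for u'
    by (cases "u = u'") (simp_all add: lext_def lookup_sum lookup_single when_def in_keys_iff)
  have 2: "a * (if P then b else 0) = (if P then a * b else 0)" for a b :: complex and P
    by simp
  show ?thesis
    by (simp add: p tns_def lext_def[of _ x] lookup_sum 1 2 in_keys_iff)
qed

lemma tens_eq_tns: "tens = tns"
proof (intro ext poly_mapping_eqI)
  fix x y :: "agen free" and p :: "agen word \<times> agen word"
  obtain u v where p: "p = (u, v)" by (cases p)
  have "(\<Sum>va\<in>keys y. if ua = u \<and> va = v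
           then lookup x ua * lookup y va else 0) =
      (if ua = u then lookup x ua * lookup y v else 0)" for ua
    by (cases "ua = u"; cases "v \<in> keys y") (auto simp: in_keys_iff)
  then show "lookup (tens x y) p = lookup (tns x y) p"
    by (auto simp: p tens_def lookup_sum lookup_single when_def in_keys_iff)
qed

lemma tns_add_left: "tns (x + x') y = tns x y + tns x' y"
  and tns_add_right: "tns x (y + y') = tns x y + tns x y'"
  and tns_diff_left: "tns (x - x') y = tns x y - tns x' y"
  and tns_diff_right: "tns x (y - y') = tns x y - tns x y'"
  and tns_scal_left: "tns (scal z x) y = scal z (tns x y)"
  and tns_scal_right: "tns x (scal z y) = scal z (tns x y)"
  and tns_zero_left: "tns 0 y = 0"
  and tns_zero_right: "tns x 0 = 0"
  and tns_neg_left: "tns (- x) y = - tns x y"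
  and tns_neg_right: "tns x (- y) = - tns x y"
  by (rule poly_mapping_eqI; simp add: lookup_add lookup_minus algebra_simps)+

lemmas tns_simps = tns_add_left tns_add_right tns_diff_left tns_diff_right tns_scal_left
  tns_scal_right tns_zero_left tns_zero_right tns_neg_left tns_neg_right

lemma tns_single: "tns (single u a) (single v b) =
    single (u, v) (a * b)"
  by (auto intro!: poly_mapping_eqI simp: lookup_single when_def)

lemma lin_tns_left: "lin (\<lambda>x. tns x y)" and lin_tns_right: "lin (tns x)"
  by (rule linI; simp add: tns_simps)+

lemma tns_homI:
  assumes "module_hom scal s f" "module_hom scal s g"
    and "\<And>x y. f (tns x y) = g (tns x y)"
  shows "f X = g X"
proof (rule hom_eqI[OF assms(1,2)])
  fix k :: "'a \<times> 'b"
  show "f (single k 1) = g (single k 1)"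
    using assms(3)[of "single (fst k) 1" "single (snd k) 1"]
    by (simp add: tns_single)
qed

definition tmap where
  "tmap f g = lext (\<lambda>(u, v). tns (f (single u 1)) (g (single v 1)))"

lemma lin_tmap: "lin (tmap f g)"
  unfolding tmap_def by (rule lin_lext)

lemma tns_bilin_eq:
  assumes "lin f" "lin g" "module_hom scal s h" "module_hom scal s h'"
    and "\<And>u v. h (single (u, v) 1) =
       h' (tns (f (single u 1)) (g (single v 1)))"
  shows "h (tns x y) = h' (tns (f x) (g y))"
proof -
  have A: "h (tns (single u 1) y) = h' (tns (f (single u 1)) (g y))" for u
    by (rule hom_eqI[OF lin_comp[OF lin_tns_right assms(3)]
          lin_comp[OF assms(2) lin_comp[OF lin_tns_right assms(4)]]])
      (simp add: tns_single assms(5))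
  show ?thesis
    by (rule hom_eqI[OF lin_comp[OF lin_tns_left assms(3)]
          lin_comp[OF assms(1) lin_comp[OF lin_tns_left assms(4)]]])
      (simp add: A)
qed

lemma tmap_tns: "lin f \<Longrightarrow> lin g \<Longrightarrow> tmap f g (tns x y) = tns (f x) (g y)"
  by (rule tns_bilin_eq[OF _ _ lin_tmap lin_id, of f g f g])
    (simp_all add: tmap_def)

text \<open>The slice maps phi (x) id and id (x) phi. Applied to a coproduct, the first produces the
  right action and the second the matrix elements.\<close>

definition contrL :: "('k \<Rightarrow> complex) \<Rightarrow> ('k \<times> 'l \<Rightarrow>\<^sub>0 complex) \<Rightarrow> ('l \<Rightarrow>\<^sub>0 complex)" where
  "contrL \<phi> = lext (\<lambda>(u, v). single v (\<phi> u))"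

definition contrR :: "('l \<Rightarrow> complex) \<Rightarrow> ('k \<times> 'l \<Rightarrow>\<^sub>0 complex) \<Rightarrow> ('k \<Rightarrow>\<^sub>0 complex)" where
  "contrR \<phi> = lext (\<lambda>(u, v). single u (\<phi> v))"

lemma lin_contrL: "lin (contrL \<phi>)" and lin_contrR: "lin (contrR \<phi>)"
  unfolding contrL_def contrR_def by (rule lin_lext)+

lemma contrL_tns: "contrL \<phi> (tns x y) = scal (lin_ext \<phi> x) y"
proof -
  have 1: "contrL \<phi> (tns (single u 1) y) = scal (\<phi> u) y" for u
    by (rule hom_eqI[OF lin_comp[OF lin_tns_right lin_contrL] lin_scal[OF lin_id]])
      (simp add: tns_single contrL_def)
  show ?thesis
    by (rule hom_eqI[OF lin_comp[OF lin_tns_left lin_contrL]])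
      (auto intro: linI simp: 1 pm.scale_left_distrib)
qed

lemma contrR_tns: "contrR \<phi> (tns x y) = scal (lin_ext \<phi> y) x"
proof -
  have 1: "contrR \<phi> (tns x (single u 1)) = scal (\<phi> u) x" for u
    by (rule hom_eqI[OF lin_comp[OF lin_tns_left lin_contrR] lin_scal[OF lin_id]])
      (simp add: tns_single contrR_def)
  show ?thesis
    by (rule hom_eqI[OF lin_comp[OF lin_tns_right lin_contrR]])
      (auto intro: linI simp: 1 pm.scale_left_distrib)
qed

section \<open>Ideals and quotients\<close>

lemma scal_conv_mult: "scal z x = single 0 z * (x :: ('k::monoid_add) \<Rightarrow>\<^sub>0 complex)"
  by (simp add: scal_def mult_map_scale_conv_mult)

lemma scal_mult_left [simp]: "scal z x * (y :: ('k::monoid_add) \<Rightarrow>\<^sub>0 complex) = scal z (x * y)"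
  by (simp add: scal_conv_mult mult.assoc)

lemma lin_mult_left: "lin (\<lambda>y. (x :: ('k::monoid_add) \<Rightarrow>\<^sub>0 complex) * y)"
  and lin_mult_right: "lin (\<lambda>x. x * (y :: ('k::monoid_add) \<Rightarrow>\<^sub>0 complex))"
proof -
  have c: "y * single 0 z = scal z y" for y :: "'k \<Rightarrow>\<^sub>0 complex" and z
  proof -
    have l: "lin (\<lambda>y::'k \<Rightarrow>\<^sub>0 complex. y * single 0 z)"
      by (rule linI) (auto simp: algebra_simps)
    show ?thesis by (rule hom_eqI[OF l lin_scal[OF lin_id]]) (simp add: mult_single)
  qed
  show "lin (\<lambda>y. x * y)"
  proof (rule linI)
    fix z y
    have "x * scal z y = x * single 0 z * y" by (simp add: scal_conv_mult mult.assoc)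
    then show "x * scal z y = scal z (x * y)" by (simp add: c)
  qed (simp add: distrib_left)
  show "lin (\<lambda>x. x * y)"
    by (rule linI) (simp_all add: distrib_right)
qed

lemma scal_mult_right [simp]: "(x :: ('k::monoid_add) \<Rightarrow>\<^sub>0 complex) * scal z y = scal z (x * y)"
  by (rule module_hom.scale[OF lin_mult_left])

definition mod_alg :: "(('k \<Rightarrow>\<^sub>0 complex) \<Rightarrow> ('k \<Rightarrow>\<^sub>0 complex) \<Rightarrow> ('k \<Rightarrow>\<^sub>0 complex)) \<Rightarrow> ('k \<Rightarrow>\<^sub>0 complex) \<Rightarrow>
    (complex, 'k \<Rightarrow>\<^sub>0 complex) module" where
  "mod_alg mu on = \<lparr>carrier = UNIV, mult = mu, one = on, zero = 0, add = (+), smult = scal\<rparr>"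

lemma free_alg_mod_alg: "free_alg = mod_alg (*) 1"
  by (simp add: free_alg_def mod_alg_def)

lemma free_tens_alg_mod_alg: "free_tens_alg = mod_alg tens_mult (tens 1 1)"
  by (simp add: free_tens_alg_def mod_alg_def)

lemma mod_alg_simps [simp]:
  "carrier (mod_alg mu on) = UNIV" "mult (mod_alg mu on) = mu" "one (mod_alg mu on) = on"
  "zero (mod_alg mu on) = 0" "add (mod_alg mu on) = (+)" "smult (mod_alg mu on) = scal"
  by (simp_all add: mod_alg_def)

lemma abelian_group_mod_alg: "abelian_group (mod_alg mu on)"
proof (rule abelian_groupI)
  show "\<exists>y\<in>carrier (mod_alg mu on). y \<oplus>\<^bsub>mod_alg mu on\<^esub> x = \<zero>\<^bsub>mod_alg mu on\<^esub>" for x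
    by (rule bexI[of _ "- x"]) auto
qed (simp_all add: ac_simps)

lemma finsum_mod_alg:
  assumes "finite I"
  shows "finsum (mod_alg mu on) f I = sum f I"
proof -
  interpret abelian_group "mod_alg mu on" by (rule abelian_group_mod_alg)
  show ?thesis using assms by induction (auto simp: finsum_insert)
qed

lemma lin_span_mod_alg: "lin_span (mod_alg mu on) S = pm.span S"
proof -
  have *: "(\<Oplus>\<^bsub>mod_alg mu on\<^esub>v\<in>T. \<phi> v \<odot>\<^bsub>mod_alg mu on\<^esub> v) = (\<Sum>v\<in>T. scal (\<phi> v) v)"
    if "finite T" for T \<phi>
    using that by (simp add: finsum_mod_alg)
  show ?thesis unfolding lin_span_def pm.span_explicit
    by (intro Collect_cong ex_cong1) (auto simp: * simp del: mod_alg_simps)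
qed

text \<open>One treatment of cosets for both A and its tensor square, and for U. The product of
  cosets needs an ideal rather than a subspace and follows separately in
  \<open>quot_mult\<close>.\<close>

locale quot =
  fixes mu :: "('k \<Rightarrow>\<^sub>0 complex) \<Rightarrow> ('k \<Rightarrow>\<^sub>0 complex) \<Rightarrow> ('k \<Rightarrow>\<^sub>0 complex)" and on :: "'k \<Rightarrow>\<^sub>0 complex"
      and J :: "('k \<Rightarrow>\<^sub>0 complex) set"
  assumes subsp: "pm.subspace J"
begin

abbreviation "R \<equiv> mod_alg mu on"
abbreviation "Q \<equiv> quot_alg R J"
definition proj where "proj x = J +>\<^bsub>R\<^esub> x"

lemma proj_image: "proj x = (\<lambda>h. h + x) ` J"
  by (auto simp: proj_def a_r_coset_def')

lemma in_proj: "y \<in> proj x \<longleftrightarrow> y - x \<in> J"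
  unfolding proj_image image_iff by (metis diff_add_cancel add_diff_cancel_right')

lemma proj_self: "x \<in> proj x"
  using pm.subspace_0[OF subsp] by (simp add: in_proj)

lemma proj_eq: "proj x = proj y \<longleftrightarrow> x - y \<in> J"
proof
  assume "proj x = proj y" then show "x - y \<in> J" using proj_self[of x] by (simp add: in_proj)
next
  assume *: "x - y \<in> J"
  have "z - x \<in> J \<longleftrightarrow> z - y \<in> J" for z
    using pm.subspace_add[OF subsp _ *, of "z - x"] pm.subspace_diff[OF subsp _ *, of "z - y"] by
        auto
  then show "proj x = proj y" by (auto simp: in_proj)
qed

lemma proj_0: "proj 0 = J"
  by (auto simp: in_proj)

lemma carrier_Q: "carrier Q = range proj"
  by (auto simp: quot_alg_def ring.defs FactRing_def A_RCOSETS_def' proj_def)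

lemma zero_Q: "\<zero>\<^bsub>Q\<^esub> = proj 0"
  by (simp add: quot_alg_def ring.defs FactRing_def proj_0)

lemma one_Q: "\<one>\<^bsub>Q\<^esub> = proj on"
  by (simp add: quot_alg_def ring.defs FactRing_def proj_def)

lemma add_Q: "proj x \<oplus>\<^bsub>Q\<^esub> proj y = proj (x + y)"
proof -
  have "proj x \<oplus>\<^bsub>Q\<^esub> proj y = {h + k | h k. h \<in> proj x \<and> k \<in> proj y}"
    by (auto simp: quot_alg_def ring.defs FactRing_def set_add_def')
  also have "\<dots> = proj (x + y)"
  proof (intro equalityI subsetI)
    fix z assume "z \<in> {h + k | h k. h \<in> proj x \<and> k \<in> proj y}"
    then show "z \<in> proj (x + y)" using pm.subspace_add[OF subsp]
      by (auto simp: in_proj) (metis add_diff_add)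
  next
    fix z assume "z \<in> proj (x + y)"
    then have "z = (z - y) + y" "z - y \<in> proj x" "y \<in> proj y"
      using proj_self by (auto simp: in_proj algebra_simps)
    then show "z \<in> {h + k | h k. h \<in> proj x \<and> k \<in> proj y}" by blast
  qed
  finally show ?thesis .
qed

lemma smult_Q: "z \<odot>\<^bsub>Q\<^esub> proj x = proj (scal z x)"
proof -
  have "proj (scal z x') = proj (scal z x)" if "x' \<in> proj x" for x'
    using that pm.subspace_scale[OF subsp, of "x' - x" z]
    by (simp only: proj_eq in_proj pm.scale_right_diff_distrib)
  then have "(\<lambda>x. proj (scal z x)) ` proj x = {proj (scal z x)}"
    using proj_self by blast
  then show ?thesis by (simp add: quot_alg_def ring.defs proj_def)
qed

lemma abelian_group_Q: "abelian_group Q"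
proof (rule abelian_groupI)
  fix X assume "X \<in> carrier Q"
  then obtain x where "X = proj x" by (auto simp: carrier_Q)
  then show "\<exists>Y\<in>carrier Q. Y \<oplus>\<^bsub>Q\<^esub> X = \<zero>\<^bsub>Q\<^esub>"
    by (intro bexI[of _ "proj (- x)"]) (simp_all add: carrier_Q add_Q zero_Q)
qed (auto simp: carrier_Q add_Q zero_Q ac_simps)

lemma finsum_Q:
  assumes "finite I"
  shows "(\<Oplus>\<^bsub>Q\<^esub>i\<in>I. proj (f i)) = proj (sum f I)"
proof -
  interpret abelian_group Q by (rule abelian_group_Q)
  show ?thesis using assms by induction (auto simp: finsum_insert carrier_Q zero_Q add_Q)
qed

lemma lin_span_Q: "lin_span Q (proj ` S) = proj ` pm.span S"
proof (intro equalityI subsetI)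
  interpret abelian_group Q by (rule abelian_group_Q)
  fix V assume "V \<in> lin_span Q (proj ` S)"
  then obtain T \<phi> where T: "V = (\<Oplus>\<^bsub>Q\<^esub>v\<in>T. \<phi> v \<odot>\<^bsub>Q\<^esub> v)" "finite T" "T \<subseteq> proj ` S"
    by (auto simp: lin_span_def)
  then have "\<forall>v\<in>T. \<exists>g\<in>S. v = proj g" by blast
  then obtain g where g: "\<forall>v\<in>T. g v \<in> S \<and> v = proj (g v)" by metis
  have "V = (\<Oplus>\<^bsub>Q\<^esub>v\<in>T. proj (scal (\<phi> v) (g v)))"
    unfolding T(1)
  proof (rule finsum_cong')
    fix v assume "v \<in> T"
    then have "v = proj (g v)" using g by blast
    then show "\<phi> v \<odot>\<^bsub>Q\<^esub> v = proj (scal (\<phi> v) (g v))" by (metis smult_Q)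
  qed (auto simp: carrier_Q)
  then have "V = proj (\<Sum>v\<in>T. scal (\<phi> v) (g v))" by (simp add: finsum_Q T)
  moreover have "(\<Sum>v\<in>T. scal (\<phi> v) (g v)) \<in> pm.span S"
    by (intro pm.span_sum pm.span_scale pm.span_base) (use g in blast)
  ultimately show "V \<in> proj ` pm.span S" by blast
next
  interpret abelian_group Q by (rule abelian_group_Q)
  fix V assume "V \<in> proj ` pm.span S"
  then obtain x where x: "x \<in> pm.span S" and V: "V = proj x" by blast
  from x have "proj x \<in> lin_span Q (proj ` S)"
  proof (induction rule: pm.span_induct_alt)
    case base
    show ?case unfolding lin_span_def mem_Collect_eq
      by (intro exI[of _ "{}"] exI[of _ "\<lambda>_. 0"]) (simp add: zero_Q)
  next
    case (step c x y)
    then obtain T \<phi> where T: "proj y = (\<Oplus>\<^bsub>Q\<^esub>v\<in>T. \<phi> v \<odot>\<^bsub>Q\<^esub> v)" "finite T" "T \<subseteq> proj ` S"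
      by (auto simp: lin_span_def)
    \<comment> \<open>The class of x may already occur in T, because different elements of S can
      have the same class. Its old coefficient d (0 if it does not occur) is split off and merged
      with c.\<close>
    let ?T = "T - {proj x}"
    define d where "d = (if proj x \<in> T then \<phi> (proj x) else 0)"
    define \<psi> where "\<psi> = \<phi>(proj x := c + d)"
    have car: "z \<odot>\<^bsub>Q\<^esub> v \<in> carrier Q" if "v \<in> proj ` S" for z v
      using that by (auto simp: smult_Q carrier_Q)
    have [simp]: "\<phi> v \<odot>\<^bsub>Q\<^esub> v \<in> carrier Q" if "v \<in> T" for v using car T(3) that by blast
    have eqT: "(\<Oplus>\<^bsub>Q\<^esub>v\<in>?T. \<psi> v \<odot>\<^bsub>Q\<^esub> v) = (\<Oplus>\<^bsub>Q\<^esub>v\<in>?T. \<phi> v \<odot>\<^bsub>Q\<^esub> v)"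
      by (rule finsum_cong') (auto simp: \<psi>_def)
    have y: "proj y = d \<odot>\<^bsub>Q\<^esub> proj x \<oplus>\<^bsub>Q\<^esub> (\<Oplus>\<^bsub>Q\<^esub>v\<in>?T. \<phi> v \<odot>\<^bsub>Q\<^esub> v)"
    proof (cases "proj x \<in> T")
      case True
      then have "T = insert (proj x) ?T" by blast
      then have "proj y = (\<Oplus>\<^bsub>Q\<^esub>v\<in>insert (proj x) ?T. \<phi> v \<odot>\<^bsub>Q\<^esub> v)" by (simp only: T(1))
      also have "\<dots> = \<phi> (proj x) \<odot>\<^bsub>Q\<^esub> proj x \<oplus>\<^bsub>Q\<^esub> (\<Oplus>\<^bsub>Q\<^esub>v\<in>?T. \<phi> v \<odot>\<^bsub>Q\<^esub> v)"
        using T True by (subst finsum_insert) auto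
      finally show ?thesis using True by (simp add: d_def)
    next
      case False
      have "(\<Oplus>\<^bsub>Q\<^esub>v\<in>T. \<phi> v \<odot>\<^bsub>Q\<^esub> v) = \<zero>\<^bsub>Q\<^esub> \<oplus>\<^bsub>Q\<^esub> (\<Oplus>\<^bsub>Q\<^esub>v\<in>T. \<phi> v \<odot>\<^bsub>Q\<^esub> v)"
        by (subst l_zero) auto
      with False T(1) show ?thesis by (simp add: d_def smult_Q zero_Q)
    qed
    have fc: "(\<Oplus>\<^bsub>Q\<^esub>v\<in>?T. \<phi> v \<odot>\<^bsub>Q\<^esub> v) \<in> carrier Q" by (rule finsum_closed) auto
    then obtain y' where y': "(\<Oplus>\<^bsub>Q\<^esub>v\<in>?T. \<phi> v \<odot>\<^bsub>Q\<^esub> v) = proj y'" by (auto simp: carrier_Q)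
    have "proj (scal c x + y) = c \<odot>\<^bsub>Q\<^esub> proj x \<oplus>\<^bsub>Q\<^esub> proj y"
      by (simp add: smult_Q add_Q)
    also have "\<dots> = (c + d) \<odot>\<^bsub>Q\<^esub> proj x \<oplus>\<^bsub>Q\<^esub> (\<Oplus>\<^bsub>Q\<^esub>v\<in>?T. \<phi> v \<odot>\<^bsub>Q\<^esub> v)"
      unfolding y y' by (simp add: smult_Q add_Q pm.scale_left_distrib add.assoc)
    also have "\<dots> = (\<Oplus>\<^bsub>Q\<^esub>v\<in>insert (proj x) ?T. \<psi> v \<odot>\<^bsub>Q\<^esub> v)"
    proof (subst finsum_insert)
      show "(\<lambda>v. \<psi> v \<odot>\<^bsub>Q\<^esub> v) \<in> ?T \<rightarrow> carrier Q" using car T(3) by blast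
      show "\<psi> (proj x) \<odot>\<^bsub>Q\<^esub> proj x \<in> carrier Q" using car step(1) by blast
    qed (use T(2) in \<open>simp_all add: eqT, simp add: \<psi>_def\<close>)
    finally have "proj (scal c x + y) = (\<Oplus>\<^bsub>Q\<^esub>v\<in>insert (proj x) ?T. \<psi> v \<odot>\<^bsub>Q\<^esub> v)" .
    moreover have "finite (insert (proj x) ?T)" "insert (proj x) ?T \<subseteq> proj ` S"
      using T step(1) by auto
    ultimately show ?case unfolding lin_span_def by blast
  qed
  then show "V \<in> lin_span Q (proj ` S)" by (simp add: V)
qed

end

lemma quot_mult:
  assumes "quot J"
    and l: "\<And>x y. y \<in> J \<Longrightarrow> mu x y \<in> J" and r: "\<And>x y. x \<in> J \<Longrightarrow> mu x y \<in> J"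
    and dl: "\<And>x y z. mu (x - y) z = mu x z - mu y z" and dr:
        "\<And>x y z. mu x (y - z) = mu x y - mu x z"
  shows "quot.proj mu on J x \<otimes>\<^bsub>quot_alg (mod_alg mu on) J\<^esub> quot.proj mu on J y =
      quot.proj mu on J (mu x y)"
proof -
  interpret quot mu on J by fact
  have "proj (mu x' y') = proj (mu x y)" if "x' \<in> proj x" "y' \<in> proj y" for x' y'
  proof -
    have "mu x' (y' - y) + mu (x' - x) y \<in> J"
      by (intro pm.subspace_add[OF subsp] l r) (use that in \<open>simp_all add: in_proj\<close>)
    then show ?thesis by (simp add: proj_eq dl dr)
  qed
  then have "(\<Union>a\<in>proj x. \<Union>b\<in>proj y. proj (mu a b)) = proj (mu x y)"
    using proj_self by blast
  then show ?thesis
    by (simp add: quot_alg_def ring.defs FactRing_def rcoset_mult_def proj_def)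
qed

lemma ring_free_alg: "ring free_alg"
proof (rule ringI)
  show "abelian_group free_alg" unfolding free_alg_mod_alg by (rule abelian_group_mod_alg)
  show "Group.monoid (free_alg :: (complex, 'g free) module)"
    by (rule monoidI) (auto simp: free_alg_mod_alg mult.assoc)
qed (auto simp: free_alg_mod_alg algebra_simps)

definition two_sided :: "'g free set \<Rightarrow> bool" where
  "two_sided I \<longleftrightarrow> pm.subspace I \<and> (\<forall>x. \<forall>y\<in>I. x * y \<in> I \<and> y * x \<in> I)"

text \<open>Multiplication by \<open>single 0 z\<close> is scaling by z, so ring ideals of the free
  algebra are automatically linear subspaces. This allows linear algebra on the ideals generated by
  the relations.\<close>

lemma ideal_free_alg: "ideal I (free_alg :: (complex, 'g free) module) \<longleftrightarrow> two_sided I"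
proof
  assume I: "ideal I (free_alg :: (complex, 'g free) module)"
  interpret ideal I "free_alg :: (complex, 'g free) module" by fact
  have m: "x * y \<in> I" "y * x \<in> I" if "y \<in> I" for x y
    using I_l_closed[OF that, of x] I_r_closed[OF that, of x] by (auto simp: free_alg_mod_alg)
  have "pm.subspace I"
  proof (rule pm.subspaceI)
    show "0 \<in> I" using a_subgroup subgroup.one_closed[OF a_subgroup] by (simp add: free_alg_mod_alg)
    show "x + y \<in> I" if "x \<in> I" "y \<in> I" for x y
      using subgroup.m_closed[OF a_subgroup that] by (simp add: free_alg_mod_alg)
    show "scal c x \<in> I" if "x \<in> I" for c x
      using m(1)[OF that] by (simp add: scal_conv_mult)
  qed
  then show "two_sided I" using m by (auto simp: two_sided_def)
next
  assume I: "two_sided I"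
  show "ideal I (free_alg :: (complex, 'g free) module)"
  proof (rule idealI[OF ring_free_alg])
    interpret abelian_group "free_alg :: (complex, 'g free) module"
      by (metis ring_free_alg ring_def)
    show "subgroup I (add_monoid free_alg)"
    proof (rule add.subgroupI)
      show "I \<subseteq> carrier free_alg" by (simp add: free_alg_mod_alg)
      show "I \<noteq> {}" using I pm.subspace_0 by (auto simp: two_sided_def)
      show "x \<oplus>\<^bsub>free_alg\<^esub> y \<in> I" if "x \<in> I" "y \<in> I" for x y
        using I pm.subspace_add that by (auto simp: two_sided_def free_alg_mod_alg)
      show "\<ominus>\<^bsub>free_alg\<^esub> x \<in> I" if "x \<in> I" for x
      proof -
        have "\<ominus>\<^bsub>free_alg\<^esub> x = - x"
          by (rule minus_equality) (auto simp: free_alg_mod_alg)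
        then show ?thesis using I pm.subspace_neg that by (auto simp: two_sided_def)
      qed
    qed
  qed (use I in \<open>auto simp: two_sided_def free_alg_mod_alg\<close>)
qed

lemma two_sided_Idl: "two_sided (Idl\<^bsub>free_alg\<^esub> S)"
  using ring.genideal_ideal[OF ring_free_alg, of S] by (simp add: ideal_free_alg[symmetric]) (simp
      add: free_alg_mod_alg)

lemma Idl_superset: "S \<subseteq> Idl\<^bsub>free_alg\<^esub> S"
  using ring.genideal_self[OF ring_free_alg, of S] by (simp add: free_alg_mod_alg)

lemma Idl_minimal: "two_sided I \<Longrightarrow> S \<subseteq> I \<Longrightarrow> Idl\<^bsub>free_alg\<^esub> S \<subseteq> I"
  using ring.genideal_minimal[OF ring_free_alg, of I S] by (simp add: ideal_free_alg)

section \<open>The graded tensor square of the free algebra\<close>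

lemma bilin_eqI:
  assumes "\<And>y. module_hom scal s (\<lambda>x. f x y)" "\<And>x. module_hom scal s (\<lambda>y. f x y)"
    and "\<And>y. module_hom scal s (\<lambda>x. g x y)" "\<And>x. module_hom scal s (\<lambda>y. g x y)"
    and "\<And>k l. f (single k 1) (single l 1) =
           g (single k 1) (single l 1)"
  shows "f x y = g x y"
proof -
  have "f (single k 1) y = g (single k 1) y" for k
    by (rule hom_eqI[OF assms(2,4) assms(5)])
  then show ?thesis by (rule hom_eqI[OF assms(1,3)])
qed

lemma lin_lext_param:
  assumes "\<And>k. lin (g k)"
  shows "lin (\<lambda>y. lext (\<lambda>k. g k y) x)"
  by (rule linI)
    (simp_all add: lext_def module_hom.add[OF assms] module_hom.scale[OF assms]
        pm.scale_right_distrib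
      sum.distrib pm.scale_sum_right mult.commute)

lemma word_parity_add: "word_parity (u + v) = word_parity u + word_parity v"
  by (simp add: word_parity_def plus_word_def)

lemma tens_mult_lext: "tens_mult X Y = lext (\<lambda>k. lext (\<lambda>l. single (fst k + fst l, snd k + snd l)
    ((-1) ^ (word_parity (snd k) * word_parity (fst l)))) Y) X"
  unfolding tens_mult_def lext_def
  by (intro sum.cong refl) (auto simp: pm.scale_sum_right mult_ac intro!: sum.cong)

lemma lin_tens_mult_left: "lin (\<lambda>X. tens_mult X Y)"
  unfolding tens_mult_lext by (rule lin_lext)

lemma lin_tens_mult_right: "lin (tens_mult X)"
  unfolding tens_mult_lext[abs_def] by (rule lin_lext_param) (rule lin_lext)

lemmas tens_mult_simps [simp] =
  hom_rules[OF lin_tens_mult_left]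
  hom_rules[OF lin_tens_mult_right]

lemma tens_mult_single:
  "tens_mult (single (u, v) 1) (single (u', v') 1) =
     single (u + u', v + v') ((-1) ^ (word_parity v * word_parity u'))"
  by (simp add: tens_mult_lext)

lemma tens_mult_assoc: "tens_mult (tens_mult X Y) Z = tens_mult X (tens_mult Y Z)"
proof -
  have 1: "tens_mult (tens_mult (single k 1) (single l 1)) (single m 1) =
      tens_mult (single k 1) (tens_mult (single l 1) (single m 1))" for k l m
    by (cases k; cases l; cases m)
      (simp add: tens_mult_lext word_parity_add add.assoc distrib_left distrib_right power_add
          mult_ac)
  have 2: "tens_mult (tens_mult (single k 1) (single l 1)) Z =
      tens_mult (single k 1) (tens_mult (single l 1) Z)" for k l
    by (rule hom_eqI[OF lin_tens_mult_right lin_comp[OF lin_tens_mult_right lin_tens_mult_right] 1])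
  show ?thesis
    by (rule bilin_eqI[OF lin_comp[OF lin_tens_mult_left lin_tens_mult_left]
          lin_comp[OF lin_tens_mult_right lin_tens_mult_left] lin_tens_mult_left
          lin_comp[OF lin_tens_mult_left lin_tens_mult_right] 2])
qed

text \<open>The p-th power of the parity automorphism: the sign picked up when something of parity p
  moves past the argument.\<close>

definition twist :: "nat \<Rightarrow> agen free \<Rightarrow> agen free" where
  "twist p = lext (\<lambda>w. single w ((-1) ^ (p * word_parity w)))"

lemma lin_twist: "lin (twist p)"
  unfolding twist_def by (rule lin_lext)

lemmas twist_simps [simp] =
  hom_rules[OF lin_twist]

lemma twist_single: "twist p (single w c) = single w (c * (-1) ^ (p * word_parity w))"
  by (simp add: twist_def)

lemma twist_mult [simp]: "twist p (x * y) = twist p x * twist p y"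
  by (rule bilin_eqI[where f = "\<lambda>x y. twist p (x * y)" and g = "\<lambda>x y. twist p x * twist p y",
        OF lin_comp[OF lin_mult_right lin_twist] lin_comp[OF lin_mult_left lin_twist]
        lin_comp[OF lin_twist lin_mult_right] lin_comp[OF lin_twist lin_mult_left]])
    (simp add: mult_single twist_single word_parity_add distrib_left power_add)

lemma twist_gen [simp]: "twist p (gen g) = scal ((-1) ^ (p * parity g)) (gen g)"
  by (simp add: gen_def twist_single word_parity_def)

lemma one_free: "(1 :: 'g free) = single (Word []) 1"
  by (metis single_one zero_word_def)

lemma twist_1 [simp]: "twist p 1 = 1"
  by (simp add: one_free twist_single word_parity_def)

lemma twist_zero [simp]: "twist 0 x = x"
  by (rule hom_eqI[OF lin_twist lin_id]) (simp add: twist_single)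

lemma lin_mult_twist: "lin (\<lambda>z. x * twist p z)" "lin (\<lambda>w. twist p w * y)"
  by (rule lin_comp[OF lin_twist lin_mult_left] lin_comp[OF lin_twist lin_mult_right])+

text \<open>In the graded product only the second leg of the left factor crosses the first leg of
  the right factor. With that second leg a word of known parity, the sign becomes a
  \<open>twist\<close> and the product a tensor product of linear maps.\<close>

lemma tens_mult_tns_left:
  "tens_mult (tns x (single v 1)) D =
     tmap (\<lambda>z. x * twist (word_parity v) z) ((*) (single v 1)) D"
proof (rule tns_homI[OF lin_tens_mult_right lin_tmap])
  fix z w
  have "tens_mult (tns x (single v 1)) (single l 1) =
    tns (x * twist (word_parity v) (single (fst l) 1)) (single v 1 * single (snd l) 1)" for l
    by (rule hom_eqI[where x = x, OF lin_comp[OF lin_tns_left lin_tens_mult_left] lin_comp[OF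
        lin_mult_right lin_tns_left]], cases l)
      (simp add: tns_single tens_mult_single twist_single mult_single)
  then have "tens_mult (tns x (single v 1)) (tns z w) =
      tns (x * twist (word_parity v) z) (single v 1 * w)"
    by (intro tns_bilin_eq[OF lin_mult_twist(1) lin_mult_left lin_tens_mult_right lin_id]) simp
  then show "tens_mult (tns x (single v 1)) (tns z w) =
      tmap (\<lambda>z. x * twist (word_parity v) z) ((*) (single v 1)) (tns z w)"
    by (simp add: tmap_tns[OF lin_mult_twist(1) lin_mult_left])
qed

lemma tens_mult_tns_right:
  "tens_mult D (tns (single u 1) y) =
     tmap (\<lambda>z. z * single u 1) (\<lambda>w. twist (word_parity u) w * y) D"
proof (rule tns_homI[OF lin_tens_mult_left lin_tmap])
  fix z w
  have "tens_mult (single l 1) (tns (single u 1) y) =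
    tns (single (fst l) 1 * single u 1) (twist (word_parity u) (single (snd l) 1) * y)" for l
    by (rule hom_eqI[where x = y, OF lin_comp[OF lin_tns_right lin_tens_mult_right] lin_comp[OF
        lin_mult_left lin_tns_right]], cases l)
      (simp add: tns_single tens_mult_single twist_single mult_single mult.commute)
  then have "tens_mult (tns z w) (tns (single u 1) y) =
      tns (z * single u 1) (twist (word_parity u) w * y)"
    by (intro tns_bilin_eq[OF lin_mult_right lin_mult_twist(2) lin_tens_mult_left lin_id]) simp
  then show "tens_mult (tns z w) (tns (single u 1) y) =
      tmap (\<lambda>z. z * single u 1) (\<lambda>w. twist (word_parity u) w * y) (tns z w)"
    by (simp add: tmap_tns[OF lin_mult_right lin_mult_twist(2)])
qed

lemma tens_mult_gen_left:
  "tens_mult (tns x (gen g)) D = tmap (\<lambda>z. x * twist (parity g) z) ((*) (gen g)) D"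
  unfolding gen_def by (simp add: tens_mult_tns_left word_parity_def)

lemma tens_mult_tns_gen [simp]:
  "tens_mult (tns x (gen g)) (tns z w) = tns (x * twist (parity g) z) (gen g * w)"
  by (simp add: tens_mult_gen_left tmap_tns lin_mult_twist lin_mult_left)

lemma tens_mult_one_left [simp]: "tens_mult (tns 1 1) D = D"
proof -
  have "(*) 1 = (\<lambda>z :: agen free. z)" by auto
  then have "tens_mult (tns 1 1) D = tmap (\<lambda>z. z) (\<lambda>z. z) D"
    using tens_mult_tns_left[of 1 "Word []" D] by (simp add: one_free[symmetric] word_parity_def)
  also have "\<dots> = D"
    by (rule tns_homI[OF lin_tmap lin_id]) (simp add: tmap_tns lin_id)
  finally show ?thesis .
qed

subsection \<open>The coproduct\<close>

lemma free_comult_lext: "free_comult =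
    lext (\<lambda>w. foldr (\<lambda>g. tens_mult (comult_gen g)) (letters w) (tns 1 1))"
  by (simp add: fun_eq_iff free_comult_def lext_def tens_eq_tns)

lemma lin_free_comult: "lin free_comult"
  unfolding free_comult_lext by (rule lin_lext)

lemmas free_comult_simps [simp] =
  hom_rules[OF lin_free_comult]

lemma free_comult_1 [simp]: "free_comult 1 = tns 1 1"
  by (simp add: one_free free_comult_lext)

lemma gen_mult_single: "gen g * single w c = single (Word (g # letters w)) c"
  by (simp add: gen_def mult_single plus_word_def)

lemma free_comult_gen_mult: "free_comult (gen g * x) = tens_mult (comult_gen g) (free_comult x)"
  by (rule hom_eqI[OF lin_comp[OF lin_mult_left lin_free_comult] lin_comp[OF lin_free_comult
      lin_tens_mult_right]])
    (simp add: gen_mult_single free_comult_lext)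

text \<open>Words grow on the left, in step with the recursions for \<open>free_comult\<close>,
  \<open>act\<close>, \<open>e_word\<close> and \<open>f_word\<close>.\<close>

lemma free_induct [case_names one gen add scal]:
  assumes "P (1 :: 'g free)" "\<And>g x. P x \<Longrightarrow> P (gen g * x)"
    and "\<And>x y. P x \<Longrightarrow> P y \<Longrightarrow> P (x + y)" "\<And>z x. P x \<Longrightarrow> P (scal z x)"
  shows "P x"
proof -
  have w: "P (single (Word gs) 1)" for gs
    by (induction gs) (use assms(1,2) in \<open>auto simp: one_free gen_mult_single\<close>,
      metis assms(2) gen_mult_single word.sel)
  have "P (\<Sum>k\<in>K. scal (lookup x k) (single k 1))" if "finite K" for K
    using that
  proof induction
    case empty
    show ?case using assms(4)[OF assms(1), of 0] by simp
  next
    case (insert k K)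
    then show ?case using assms(3)[OF assms(4)[OF w[of "letters k"]]] by simp
  qed
  then show ?thesis using hom_expand[OF lin_id, of x] by (metis finite_keys)
qed

lemma free_comult_mult: "free_comult (x * y) = tens_mult (free_comult x) (free_comult y)"
proof (induction x rule: free_induct)
  case (gen g x)
  then show ?case by (simp add: mult.assoc free_comult_gen_mult tens_mult_assoc)
qed (simp_all add: distrib_right)

lemma free_comult_gen [simp]: "free_comult (gen g) = comult_gen g"
proof -
  have "tens_mult (comult_gen g) (tns 1 1) = comult_gen g"
    by (cases g) (simp_all add: tens_eq_tns)
  then show ?thesis using free_comult_gen_mult[of g 1] by simp
qed

section \<open>A basis of \<open>\<complex>\<^sub>q[osp(1,2)]\<close>\<close>

text \<open>
  The index \<open>(z, i, j, s)\<close> stands for \<open>a\<^bsup>z\<^esup>b\<^bsup>i\<^esup>c\<^bsup>j\<^esup>\<sigma>\<^bsup>s\<^esup>\<close> if \<open>z \<ge> 0\<close> and for \<open>d\<^bsup>-z\<^esup>b\<^bsup>i\<^esup>c\<^bsup>j\<^esup>\<sigma>\<^bsup>s\<^esup>\<close> if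
  \<open>z < 0\<close>; the generators act by left multiplication.
\<close>

type_synonym idx = "int \<times> nat \<times> nat \<times> bool"

text \<open>The scalar gained when b or c moves to the right past a^z or d^(-z), from ba = t^-1 ab
  and bd = -t db and the same rules for c.\<close>

definition comm_factor :: "complex \<Rightarrow> int \<Rightarrow> complex" where
  "comm_factor t z = (if z \<ge> 0 then (1 / t) ^ nat z else (- t) ^ nat (- z))"

text \<open>The two differences straighten a d^(m+1), m = -z - 1, by ad = sigma - t bc, and d
  a^(m+1), m = z - 1, by da = sigma - t^-1 bc. The even powers of t come from moving both b and c
  past d^m or a^m, the signs from moving sigma past b^i c^j and c past b^i.\<close>

fun gen_op :: "complex \<Rightarrow> agen \<Rightarrow> idx \<Rightarrow> (idx \<Rightarrow>\<^sub>0 complex)" where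
  "gen_op t Ga (z, i, j, s) =
     (if z \<ge> 0 then single (z + 1, i, j, s) 1
      else single (z + 1, i, j, \<not> s) ((-1) ^ (i + j))
        - single (z + 1, i + 1, j + 1, s) (t * t ^ (2 * nat (- z - 1)) * (-1) ^ i))"
| "gen_op t Gd (z, i, j, s) =
     (if z \<le> 0 then single (z - 1, i, j, s) 1
      else single (z - 1, i, j, \<not> s) ((-1) ^ (i + j))
        - single (z - 1, i + 1, j + 1, s) (1 / t * (1 / t) ^ (2 * nat (z - 1)) * (-1) ^ i))"
| "gen_op t Gb (z, i, j, s) = single (z, i + 1, j, s) (comm_factor t z)"
| "gen_op t Gc (z, i, j, s) = single (z, i, j + 1, s) (comm_factor t z * (-1) ^ i)"
| "gen_op t Gs (z, i, j, s) = single (z, i, j, \<not> s) ((-1) ^ (i + j))"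

definition act :: "complex \<Rightarrow> agen free \<Rightarrow> (idx \<Rightarrow>\<^sub>0 complex) \<Rightarrow> (idx \<Rightarrow>\<^sub>0 complex)" where
  "act t x p = lext (\<lambda>w. foldr (\<lambda>g. lext (gen_op t g)) (letters w) p) x"

lemma lin_act_left: "lin (\<lambda>x. act t x p)"
  unfolding act_def by (rule lin_lext)

lemma lin_act_right: "lin (act t x)"
proof -
  have "lin (foldr (\<lambda>g. lext (gen_op t g)) gs)" for gs
    by (induction gs) (auto simp: id_def lin_id o_def intro: lin_comp lin_lext)
  then show ?thesis unfolding act_def[abs_def] by (intro lin_lext_param)
qed

lemmas act_simps [simp] =
  hom_rules[OF lin_act_left]
  hom_rules[OF lin_act_right]

lemma act_1 [simp]: "act t 1 p = p"
  by (simp add: act_def one_free)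

lemma act_gen_mult: "act t (gen g * x) p = lext (gen_op t g) (act t x p)"
  by (rule hom_eqI[OF lin_comp[OF lin_mult_left lin_act_left] lin_comp[OF lin_act_left lin_lext]])
    (simp add: gen_mult_single act_def)

lemma act_gen [simp]: "act t (gen g) p = lext (gen_op t g) p"
  using act_gen_mult[of t g 1 p] by simp

lemma act_mult [simp]: "act t (x * y) p = act t x (act t y p)"
proof (induction x rule: free_induct)
  case (gen g x)
  then show ?case by (simp add: mult.assoc act_gen_mult)
qed (simp_all add: distrib_right)

lemma two_sided_A: "two_sided (A_ideal t)"
  unfolding A_ideal_def by (rule two_sided_Idl)

lemma A_rels_in: "A_rels t \<subseteq> A_ideal t"
  unfolding A_ideal_def by (rule Idl_superset)

lemma A_ideal_minimal: "two_sided I \<Longrightarrow> A_rels t \<subseteq> I \<Longrightarrow> A_ideal t \<subseteq> I"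
  unfolding A_ideal_def by (rule Idl_minimal)

text \<open>The elements acting by zero form a two-sided ideal, so it suffices to test each defining
  relation on each basis vector.\<close>

lemma act_A_ideal:
  assumes "t \<noteq> 0" "x \<in> A_ideal t"
  shows "act t x p = 0"
proof -
  let ?I = "{x. \<forall>p. act t x p = 0}"
  have rel: "act t x (single k 1) = 0" if "x \<in> A_rels t" for x k
  proof -
    obtain z i j s where k: "k = (z, i, j, s)" by (cases k)
    \<comment> \<open>The values z = 0 and z = -1 are set apart because there a letter of a relation
      moves z across a case distinction of \<open>gen_op\<close> or
      \<open>comm_factor\<close>.\<close>
    have c: "z = 0 \<or> (\<exists>n. z = 1 + int n) \<or> z = - 1 \<or> (\<exists>n. z = - 2 - int n)"
    proof -
      have "z = 0 \<or> z = 1 + int (nat (z - 1)) \<or> z = - 1 \<or> z = - 2 - int (nat (- 2 - z))" by auto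
      then show ?thesis by blast
    qed
    have nats [simp]: "nat (1 + int n) = Suc n" "nat (2 + int n) = Suc (Suc n)"
        "nat (- 2 - int n) = 0"
       "nat (- 1 - int n) = 0" "nat (int n + 1) = Suc n" "nat (int n + 2) = Suc (Suc n)" for n by
           auto
    have pw: "(- t) ^ n = (-1) ^ n * t ^ n" "x ^ (n * 2) = x ^ n * x ^ n"
        "(-1) ^ n * ((-1) ^ n * x) = x"
        "nat (int n + 3) = Suc (Suc (Suc n))" "nat (3 + int n) = Suc (Suc (Suc n))"
        for n and x :: complex
      by (auto simp: power_mult power2_eq_square power_mult_distrib power_minus[of t]
          mult.assoc[symmetric] power_add[symmetric])
    from that c show ?thesis
      unfolding A_rels_def insert_iff empty_iff
      apply (elim disjE exE; hypsubst)
      apply (simp_all add: k comm_factor_def pw)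
      using \<open>t \<noteq> 0\<close>
      apply (simp_all add: field_simps pw single_diff[symmetric] single_add[symmetric]
          single_uminus[symmetric])
      apply (simp_all add: power2_eq_square diff_divide_distrib)
      apply (simp_all add: mult_ac)
      done
  qed
  have "two_sided ?I"
    by (auto simp: two_sided_def intro!: pm.subspaceI)
  moreover have "act t x p = 0" if "x \<in> A_rels t" for x p
    by (subst hom_expand[OF lin_act_right]) (simp add: rel[OF that])
  then have "A_rels t \<subseteq> ?I" by blast
  ultimately show ?thesis using A_ideal_minimal assms(2) by blast
qed

section \<open>Congruence modulo the relations and straightening to normal form\<close>

definition eqv :: "complex \<Rightarrow> agen free \<Rightarrow> agen free \<Rightarrow> bool" where
  "eqv t x y \<longleftrightarrow> x - y \<in> A_ideal t"

lemma subspace_A: "pm.subspace (A_ideal t)"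
  and A_ideal_mult: "y \<in> A_ideal t \<Longrightarrow> x * y \<in> A_ideal t" "y \<in> A_ideal t \<Longrightarrow> y * x \<in> A_ideal t"
  using two_sided_A by (auto simp: two_sided_def)

lemma eqv_refl [simp]: "eqv t x x"
  using pm.subspace_0[OF subspace_A] by (simp add: eqv_def)

lemma eqv_sym: "eqv t x y \<Longrightarrow> eqv t y x"
  using pm.subspace_neg[OF subspace_A, of "x - y"] by (simp add: eqv_def)

lemma eqv_trans [trans]: "eqv t x y \<Longrightarrow> eqv t y z \<Longrightarrow> eqv t x z"
  using pm.subspace_add[OF subspace_A, of "x - y" _ "y - z"] by (simp add: eqv_def)

lemma eqv_add: "eqv t x y \<Longrightarrow> eqv t x' y' \<Longrightarrow> eqv t (x + x') (y + y')"
  using pm.subspace_add[OF subspace_A, of "x - y" _ "x' - y'"] by (simp add: eqv_def algebra_simps)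

lemma eqv_diff: "eqv t x y \<Longrightarrow> eqv t x' y' \<Longrightarrow> eqv t (x - x') (y - y')"
  using pm.subspace_diff[OF subspace_A, of "x - y" _ "x' - y'"] by (simp add: eqv_def algebra_simps)

lemma eqv_scal: "eqv t x y \<Longrightarrow> eqv t (scal z x) (scal z y)"
  using pm.subspace_scale[OF subspace_A, of "x - y" _ z] by (simp add: eqv_def
      pm.scale_right_diff_distrib)

lemma eqv_left: "eqv t x y \<Longrightarrow> eqv t (z * x) (z * y)"
  using A_ideal_mult(1)[of "x - y" _ z] by (simp add: eqv_def right_diff_distrib)

lemma eqv_right: "eqv t x y \<Longrightarrow> eqv t (x * z) (y * z)"
  using A_ideal_mult(2)[of "x - y" _ z] by (simp add: eqv_def left_diff_distrib)

lemma eqv_sum: "(\<And>i. i \<in> I \<Longrightarrow> eqv t (f i) (g i)) \<Longrightarrow> eqv t (sum f I) (sum g I)"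
  by (induction I rule: infinite_finite_induct) (auto intro: eqv_add)

lemma eqv_scal_flip: "z \<noteq> 0 \<Longrightarrow> eqv t x (scal z y) \<Longrightarrow> eqv t y (scal (1 / z) x)"
  using eqv_scal[of t "scal z y" x "1 / z"] by (auto intro: eqv_sym)

lemma eqv_subst:
  assumes "eqv t x (scal z y)"
  shows "eqv t (u * (x * v)) (scal z (u * (y * v)))" "eqv t (x * v) (scal z (y * v))"
  using eqv_left[OF eqv_right[OF assms, of v], of u] eqv_right[OF assms, of v] by simp_all

lemma eqv_comm_power:
  assumes "eqv t (x * y) (scal z (y * x))"
  shows "eqv t (x * y ^ n) (scal (z ^ n) (y ^ n * x))"
proof (induction n)
  case (Suc n)
  have "eqv t (x * y ^ Suc n) (scal z (y * (x * y ^ n)))"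
    using eqv_right[OF assms, of "y ^ n"] by (simp add: mult.assoc)
  also have "eqv t \<dots> (scal z (y * scal (z ^ n) (y ^ n * x)))"
    by (intro eqv_scal eqv_left Suc)
  finally show ?case by (simp add: mult.assoc)
qed simp

context
  fixes t :: complex
  assumes t0: "t \<noteq> 0"
begin

private abbreviation (input) "a \<equiv> gen Ga"
private abbreviation (input) "b \<equiv> gen Gb"
private abbreviation (input) "c \<equiv> gen Gc"
private abbreviation (input) "d \<equiv> gen Gd"
private abbreviation (input) "\<sigma> \<equiv> gen Gs"

lemma eqv_ab: "eqv t (a * b) (scal t (b * a))"
  and eqv_ac: "eqv t (a * c) (scal t (c * a))"
  and eqv_cb: "eqv t (c * b) (scal (-1) (b * c))"
  and eqv_bd: "eqv t (b * d) (scal (-t) (d * b))"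
  and eqv_cd: "eqv t (c * d) (scal (-t) (d * c))"
  and eqv_ad: "eqv t (a * d) (\<sigma> - scal t (b * c))"
  and eqv_ss: "eqv t (\<sigma> * \<sigma>) 1"
  using A_rels_in[of t] by (auto simp: A_rels_def eqv_def algebra_simps)

lemma eqv_da: "eqv t (d * a) (\<sigma> - scal (1 / t) (b * c))"
proof -
  have "eqv t (a * d - d * a) (scal (1 / t - t) (b * c))"
    using A_rels_in[of t] by (auto simp: A_rels_def eqv_def algebra_simps)
  from eqv_diff[OF eqv_ad this] show ?thesis
    by (simp add: pm.scale_left_diff_distrib)
qed

lemma eqv_ba: "eqv t (b * a) (scal (1 / t) (a * b))" and eqv_ca:
    "eqv t (c * a) (scal (1 / t) (a * c))"
  by (rule eqv_scal_flip[OF t0 eqv_ab] eqv_scal_flip[OF t0 eqv_ac])+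

lemma eqv_s: "eqv t \<sigma> (a * d + scal t (b * c))" "eqv t \<sigma> (d * a + scal (1 / t) (b * c))"
  using eqv_add[OF eqv_sym[OF eqv_ad] eqv_refl[of t "scal t (b * c)"]]
    eqv_add[OF eqv_sym[OF eqv_da] eqv_refl[of t "scal (1 / t) (b * c)"]] by auto

text \<open>How sigma commutes with the generators is not among the relations. It follows from the
  two forms of sigma in \<open>eqv_s\<close>: sigma a in the form starting with ad and a sigma in
  the form starting with da share the term ada, and the bc terms are matched by moving a past them.
  The case of d is symmetric; for b and c the first form alone suffices.\<close>

lemma eqv_sa: "eqv t (\<sigma> * a) (scal 1 (a * \<sigma>))"
proof -
  have "eqv t (\<sigma> * a) (a * (d * a) + scal t (b * (c * a)))"
    using eqv_right[OF eqv_s(1), of a] by (simp add: distrib_right mult.assoc)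
  also have "eqv t \<dots> (a * (d * a) + scal (1 / t) (a * (b * c)))"
  proof (intro eqv_add eqv_refl)
    have "eqv t (b * (c * a)) (scal (1 / t) (b * a * c))"
      using eqv_left[OF eqv_ca, of b] by (simp add: mult.assoc)
    also have "eqv t \<dots> (scal (1 / t) (scal (1 / t) (a * b * c)))"
      using eqv_scal[OF eqv_right[OF eqv_ba, of c], of "1 / t"] by simp
    finally have *: "eqv t (b * (c * a)) (scal (1 / t) (scal (1 / t) (a * b * c)))" .
    show "eqv t (scal t (b * (c * a))) (scal (1 / t) (a * (b * c)))"
      using eqv_scal[OF *, of t] t0 by (simp add: mult.assoc)
  qed
  also have "eqv t \<dots> (a * \<sigma>)"
    using eqv_sym[OF eqv_left[OF eqv_s(2), of a]] by (simp add: distrib_left)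
  finally show ?thesis by simp
qed

lemma eqv_sd: "eqv t (\<sigma> * d) (scal 1 (d * \<sigma>))"
proof -
  have "eqv t (\<sigma> * d) (d * (a * d) + scal (1 / t) (b * (c * d)))"
    using eqv_right[OF eqv_s(2), of d] by (simp add: distrib_right mult.assoc)
  also have "eqv t \<dots> (d * (a * d) + scal t (d * (b * c)))"
  proof (intro eqv_add eqv_refl)
    have "eqv t (b * (c * d)) (scal (-t) (b * d * c))"
      using eqv_left[OF eqv_cd, of b] by (simp add: mult.assoc)
    also have "eqv t \<dots> (scal (-t) (scal (-t) (d * b * c)))"
      using eqv_scal[OF eqv_right[OF eqv_bd, of c], of "-t"] by simp
    finally have *: "eqv t (b * (c * d)) (scal (-t) (scal (-t) (d * b * c)))" .
    show "eqv t (scal (1 / t) (b * (c * d))) (scal t (d * (b * c)))"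
      using eqv_scal[OF *, of "1 / t"] t0 by (simp add: mult.assoc)
  qed
  also have "eqv t \<dots> (d * \<sigma>)"
    using eqv_sym[OF eqv_left[OF eqv_s(1), of d]] by (simp add: distrib_left)
  finally show ?thesis by simp
qed

lemma eqv_sb: "eqv t (\<sigma> * b) (scal (-1) (b * \<sigma>))"
proof -
  have "eqv t (\<sigma> * b) (a * (d * b) + scal t (b * (c * b)))"
    using eqv_right[OF eqv_s(1), of b] by (simp add: distrib_right mult.assoc)
  also have "eqv t \<dots> (scal (-1) (b * a * d) + scal (-t) (b * (b * c)))"
  proof (intro eqv_add)
    have "eqv t (b * a * d) (scal (1 / t) (a * (b * d)))"
      using eqv_right[OF eqv_ba, of d] by (simp add: mult.assoc)
    also have "eqv t \<dots> (scal (1 / t) (scal (-t) (a * (d * b))))"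
      using eqv_scal[OF eqv_left[OF eqv_bd, of a], of "1 / t"] by simp
    finally have *: "eqv t (b * a * d) (scal (1 / t) (scal (-t) (a * (d * b))))" .
    show "eqv t (a * (d * b)) (scal (-1) (b * a * d))"
      using eqv_sym[OF eqv_scal[OF *, of "-1"]] t0 by simp
    show "eqv t (scal t (b * (c * b))) (scal (-t) (b * (b * c)))"
      using eqv_scal[OF eqv_left[OF eqv_cb, of b], of t] by simp
  qed
  also have "eqv t \<dots> (scal (-1) (b * \<sigma>))"
    using eqv_sym[OF eqv_scal[OF eqv_left[OF eqv_s(1), of b], of "-1"]]
    by (simp add: distrib_left mult.assoc)
  finally show ?thesis .
qed

lemma eqv_sc: "eqv t (\<sigma> * c) (scal (-1) (c * \<sigma>))"
proof -
  have "eqv t (\<sigma> * c) (a * (d * c) + scal t (b * (c * c)))"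
    using eqv_right[OF eqv_s(1), of c] by (simp add: distrib_right mult.assoc)
  also have "eqv t \<dots> (scal (-1) (c * a * d) + scal (-t) (c * (b * c)))"
  proof (intro eqv_add)
    have "eqv t (c * a * d) (scal (1 / t) (a * (c * d)))"
      using eqv_right[OF eqv_ca, of d] by (simp add: mult.assoc)
    also have "eqv t \<dots> (scal (1 / t) (scal (-t) (a * (d * c))))"
      using eqv_scal[OF eqv_left[OF eqv_cd, of a], of "1 / t"] by simp
    finally have *: "eqv t (c * a * d) (scal (1 / t) (scal (-t) (a * (d * c))))" .
    show "eqv t (a * (d * c)) (scal (-1) (c * a * d))"
      using eqv_sym[OF eqv_scal[OF *, of "-1"]] t0 by simp
    show "eqv t (scal t (b * (c * c))) (scal (-t) (c * (b * c)))"
      using eqv_sym[OF eqv_scal[OF eqv_right[OF eqv_cb, of c], of "-t"]] by (simp add: mult.assoc)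
  qed
  also have "eqv t \<dots> (scal (-1) (c * \<sigma>))"
    using eqv_sym[OF eqv_scal[OF eqv_left[OF eqv_s(1), of c], of "-1"]]
    by (simp add: distrib_left mult.assoc)
  finally show ?thesis .
qed

definition tail :: "nat \<Rightarrow> nat \<Rightarrow> bool \<Rightarrow> agen free" where
  "tail i j s = b ^ i * (c ^ j * (if s then \<sigma> else 1))"

fun normal_form :: "idx \<Rightarrow> agen free" where
  "normal_form (z, i, j, s) = (if z \<ge> 0 then a ^ nat z else d ^ nat (- z)) * tail i j s"

lemma c_tail: "eqv t (c * tail i j s) (scal ((-1) ^ i) (tail i (Suc j) s))"
  using eqv_subst(2)[OF eqv_comm_power[OF eqv_cb, of i], of "c ^ j * (if s then \<sigma> else 1)"]
  by (simp add: tail_def mult.assoc)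

lemma b_tail: "b * tail i j s = tail (Suc i) j s"
  by (simp add: tail_def mult.assoc)

lemma s_tail: "eqv t (\<sigma> * tail i j s) (scal ((-1) ^ (i + j)) (tail i j (\<not> s)))"
proof -
  have "eqv t (\<sigma> * tail i j s) (scal ((-1) ^ i) (b ^ i * (\<sigma> * c ^ j * (if s then \<sigma> else 1))))"
    using eqv_subst(2)[OF eqv_comm_power[OF eqv_sb, of i], of "c ^ j * (if s then \<sigma> else 1)"]
    by (simp add: tail_def mult.assoc)
  also have "eqv t \<dots> (scal ((-1) ^ i) (b ^ i * scal ((-1) ^ j) (c ^ j * (\<sigma> *
      (if s then \<sigma> else 1)))))"
    by (intro eqv_scal eqv_left)
      (use eqv_subst(2)[OF eqv_comm_power[OF eqv_sc, of j], of "(if s then \<sigma> else 1)"] in \<open>simp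
          add: mult.assoc\<close>)
  also have "eqv t \<dots> (scal ((-1) ^ i) (b ^ i * scal ((-1) ^ j) (c ^ j * (if s then 1 else \<sigma>))))"
    by (intro eqv_scal eqv_left) (use eqv_ss in auto)
  finally show ?thesis by (cases s) (simp_all add: tail_def power_add)
qed

lemma bc_tail: "eqv t (b * c * tail i j s) (scal ((-1) ^ i) (tail (Suc i) (Suc j) s))"
  using eqv_left[OF c_tail, of b i j s] by (simp add: b_tail mult.assoc)

text \<open>The straightening that motivates \<open>gen_op\<close>, now carried out in the algebra
  itself. It makes \<open>normal_form\<close> intertwine the representation with left
  multiplication, so the normal forms span.\<close>

lemma gen_normal_form: "eqv t (gen g * normal_form k) (lext normal_form (gen_op t g k))"
proof -
  obtain z i j s where k: "k = (z, i, j, s)" by (cases k)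
  define x where "x = (if z \<ge> 0 then a ^ nat z else d ^ nat (- z))"
  have comm: "eqv t (b * x) (scal (comm_factor t z) (x * b))"
      "eqv t (c * x) (scal (comm_factor t z) (x * c))"
    "eqv t (\<sigma> * x) (x * \<sigma>)"
    using eqv_comm_power[OF eqv_ba, of "nat z"] eqv_comm_power[OF eqv_bd, of "nat (- z)"]
      eqv_comm_power[OF eqv_ca, of "nat z"] eqv_comm_power[OF eqv_cd, of "nat (- z)"]
      eqv_comm_power[OF eqv_sa, of "nat z"] eqv_comm_power[OF eqv_sd, of "nat (- z)"]
    by (auto simp: x_def comm_factor_def)
  have *: "normal_form k = x * tail i j s" by (simp add: k x_def)
  show ?thesis
  proof (cases g)
    case Gb
    then show ?thesis
      using eqv_right[OF comm(1), of "tail i j s"] unfolding *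
      by (simp add: k mult.assoc b_tail x_def)
  next
    case Gc
    have "eqv t (c * x * tail i j s) (scal (comm_factor t z) (x * (c * tail i j s)))"
      using eqv_right[OF comm(2), of "tail i j s"] by (simp add: mult.assoc)
    also have "eqv t \<dots> (scal (comm_factor t z) (x * scal ((-1) ^ i) (tail i (Suc j) s)))"
      by (intro eqv_scal eqv_left c_tail)
    finally show ?thesis unfolding * using Gc by (simp add: k mult.assoc x_def)
  next
    case Gs
    have "eqv t (\<sigma> * x * tail i j s) (x * (\<sigma> * tail i j s))"
      using eqv_right[OF comm(3), of "tail i j s"] by (simp add: mult.assoc)
    also have "eqv t \<dots> (x * scal ((-1) ^ (i + j)) (tail i j (\<not> s)))"
      by (intro eqv_left s_tail)
    finally show ?thesis unfolding * using Gs by (simp add: k mult.assoc x_def)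
  next
    case Ga
    show ?thesis
    proof (cases "z \<ge> 0")
      case True
      then show ?thesis using Ga by (simp add: k nat_add_distrib mult.assoc)
    next
      case False
      define m where "m = nat (- z - 1)"
      have z: "z = - 1 - int m" "nat (- z) = Suc m" using False by (auto simp: m_def)
      have nf: "normal_form (z + 1, i', j', s') = d ^ m * tail i' j' s'" for i' j' s'
        by (cases "m = 0") (auto simp: z)
      have "eqv t (a * d * (d ^ m * tail i j s)) ((\<sigma> - scal t (b * c)) * (d ^ m * tail i j s))"
        by (rule eqv_right[OF eqv_ad])
      also have "\<dots> = \<sigma> * d ^ m * tail i j s - scal t (b * (c * d ^ m) * tail i j s)"
        by (simp add: left_diff_distrib mult.assoc)
      also have "eqv t \<dots> (d ^ m * \<sigma> * tail i j s - scal t (b * (scal ((-t) ^ m) (d ^ m * c)) *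
          tail i j s))"
        by (intro eqv_diff eqv_scal eqv_right eqv_left eqv_comm_power[OF eqv_cd])
          (use eqv_comm_power[OF eqv_sd, of m] in simp)
      also have "\<dots> = d ^ m * (\<sigma> * tail i j s) - scal (t * (-t) ^ m) (b * d ^ m * c * tail i j s)"
        by (simp add: mult.assoc)
      also have "eqv t \<dots> (d ^ m * scal ((-1) ^ (i + j)) (tail i j (\<not> s)) -
          scal (t * (-t) ^ m) (scal ((-t) ^ m) (d ^ m * b) * c * tail i j s))"
        by (intro eqv_diff eqv_scal eqv_right eqv_left eqv_comm_power[OF eqv_bd] s_tail)
      also have "\<dots> = scal ((-1) ^ (i + j)) (d ^ m * tail i j (\<not> s)) -
          scal (t * t ^ (2 * m)) (d ^ m * (b * c * tail i j s))"
        by (simp add: mult.assoc power_mult power2_eq_square power_mult_distrib[symmetric])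
      also have "eqv t \<dots> (scal ((-1) ^ (i + j)) (d ^ m * tail i j (\<not> s)) -
          scal (t * t ^ (2 * m)) (d ^ m * scal ((-1) ^ i) (tail (Suc i) (Suc j) s)))"
        by (intro eqv_diff eqv_refl eqv_scal eqv_left bc_tail)
      finally show ?thesis
        using Ga False z by (cases "m = 0") (simp_all add: k mult.assoc)
    qed
  next
    case Gd
    show ?thesis
    proof (cases "z \<le> 0")
      case True
      then have "nat (1 - z) = Suc (nat (- z))" by auto
      then show ?thesis using Gd True by (cases "z = 0") (simp_all add: k mult.assoc)
    next
      case False
      define m where "m = nat (z - 1)"
      have z: "z = 1 + int m" "nat z = Suc m" using False by (auto simp: m_def)
      have nf: "normal_form (z - 1, i', j', s') = a ^ m * tail i' j' s'" for i' j' s'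
        by (auto simp: z)
      have "eqv t (d * a * (a ^ m * tail i j s)) ((\<sigma> - scal (1 / t) (b * c)) * (a ^ m *
          tail i j s))"
        by (rule eqv_right[OF eqv_da])
      also have "\<dots> = \<sigma> * a ^ m * tail i j s - scal (1 / t) (b * (c * a ^ m) * tail i j s)"
        by (simp add: left_diff_distrib mult.assoc)
      also have "eqv t \<dots> (a ^ m * \<sigma> * tail i j s - scal (1 / t) (b * (scal ((1 / t) ^ m) (a ^ m *
          c)) * tail i j s))"
        by (intro eqv_diff eqv_scal eqv_right eqv_left eqv_comm_power[OF eqv_ca])
          (use eqv_comm_power[OF eqv_sa, of m] in simp)
      also have "\<dots> = a ^ m * (\<sigma> * tail i j s) - scal (1 / t * (1 / t) ^ m) (b * a ^ m * c *
          tail i j s)"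
        by (simp add: mult.assoc)
      also have "eqv t \<dots> (a ^ m * scal ((-1) ^ (i + j)) (tail i j (\<not> s)) -
          scal (1 / t * (1 / t) ^ m) (scal ((1 / t) ^ m) (a ^ m * b) * c * tail i j s))"
        by (intro eqv_diff eqv_scal eqv_right eqv_left eqv_comm_power[OF eqv_ba] s_tail)
      also have "\<dots> = scal ((-1) ^ (i + j)) (a ^ m * tail i j (\<not> s)) -
          scal (1 / t * (1 / t) ^ (2 * m)) (a ^ m * (b * c * tail i j s))"
        by (simp add: mult.assoc power_mult power2_eq_square power_mult_distrib[symmetric])
      also have "eqv t \<dots> (scal ((-1) ^ (i + j)) (a ^ m * tail i j (\<not> s)) -
          scal (1 / t * (1 / t) ^ (2 * m)) (a ^ m * scal ((-1) ^ i) (tail (Suc i) (Suc j) s)))"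
        by (intro eqv_diff eqv_refl eqv_scal eqv_left bc_tail)
      finally show ?thesis
        using Gd False z by (simp add: k nf mult.assoc del: normal_form.simps) (simp add:
            mult.assoc)
    qed
  qed
qed

abbreviation vac :: "idx \<Rightarrow>\<^sub>0 complex" where "vac \<equiv> single (0, 0, 0, False) 1"

lemma eqv_normal_form: "eqv t x (lext normal_form (act t x vac))"
proof (induction x rule: free_induct)
  case (gen g x)
  have l: "eqv t (gen g * lext normal_form p) (lext normal_form (lext (gen_op t g) p))" for p
  proof -
    have "lin (\<lambda>p. gen g * lext normal_form p)" "lin (\<lambda>p. lext normal_form (lext (gen_op t g) p))"
      by (rule lin_comp[OF lin_lext lin_mult_left] lin_comp[OF lin_lext lin_lext])+
    note e = hom_expand[OF this(1), of p] hom_expand[OF this(2), of p]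
    show ?thesis unfolding e by (intro eqv_sum eqv_scal) (simp add: gen_normal_form)
  qed
  have "eqv t (gen g * x) (gen g * lext normal_form (act t x vac))" by (rule eqv_left[OF gen])
  also have "eqv t \<dots> (lext normal_form (lext (gen_op t g) (act t x vac)))" by (rule l)
  finally show ?case by simp
next
  case one
  then show ?case by (simp add: tail_def)
qed (auto intro: eqv_add eqv_scal)

text \<open>One direction says that the representation respects the relations, the other that every
  element is congruent to the normal form read off from its action on \<open>vac\<close>. Congruence
  thereby becomes equality of vectors.\<close>

lemma A_ideal_iff: "x \<in> A_ideal t \<longleftrightarrow> act t x vac = 0"
proof
  assume "act t x vac = 0"
  then show "x \<in> A_ideal t" using eqv_normal_form[of x] by (simp add: eqv_def)
qed (rule act_A_ideal[OF t0])

lemma eqv_iff: "eqv t x y \<longleftrightarrow> act t x vac = act t y vac"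
  by (simp add: eqv_def A_ideal_iff)

end

section \<open>The tensor square of \<open>\<complex>\<^sub>q[osp(1,2)]\<close>\<close>

lemma lin_subspace:
  assumes "lin h" "pm.subspace W" "\<And>k. h (single k 1) \<in> W"
  shows "h x \<in> W"
  unfolding hom_expand[OF assms(1), of x]
  by (intro pm.subspace_sum[OF assms(2)] pm.subspace_scale[OF assms(2)] assms(3))

lemma subspace_vimage: "lin h \<Longrightarrow> pm.subspace W \<Longrightarrow> pm.subspace {x. h x \<in> W}"
  by (rule pm.subspaceI)
    (auto simp: module_hom.add module_hom.scale module_hom.zero pm.subspace_0 pm.subspace_add
        pm.subspace_scale)

lemma AA_ideal_span: "AA_ideal t = pm.span {tns x y | x y. x \<in> A_ideal t \<or> y \<in> A_ideal t}"
  unfolding AA_ideal_def free_tens_alg_mod_alg lin_span_mod_alg by (simp add: tens_eq_tns)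

lemma subspace_AA: "pm.subspace (AA_ideal t)"
  unfolding AA_ideal_span by (rule pm.subspace_span)

lemma tns_in_AA: "x \<in> A_ideal t \<or> y \<in> A_ideal t \<Longrightarrow> tns x y \<in> AA_ideal t"
  unfolding AA_ideal_span by (rule pm.span_base) blast

lemma AA_image:
  assumes "lin h" "pm.subspace W" "\<And>x y. x \<in> A_ideal t \<or> y \<in> A_ideal t \<Longrightarrow> h (tns x y) \<in> W"
    and "X \<in> AA_ideal t"
  shows "h X \<in> W"
proof -
  have "AA_ideal t \<subseteq> {x. h x \<in> W}"
    unfolding AA_ideal_span by (rule pm.span_minimal) (use assms in \<open>auto intro: subspace_vimage\<close>)
  then show ?thesis using assms(4) by blast
qed

text \<open>Write p for the action on \<open>vac\<close> and N for the normal form map. Each x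
  differs from N (p x) by an element of the ideal, hence X differs from its image under Np (x) Np by
  an element of \<open>AA_ideal\<close>, and that image is 0 here.\<close>

lemma AA_ideal_if_zero:
  assumes "t \<noteq> 0" "tmap (\<lambda>x. act t x vac) (\<lambda>x. act t x vac) X = 0"
  shows "X \<in> AA_ideal t"
proof -
  let ?p = "\<lambda>x. act t x vac" and ?N = "lext normal_form"
  have p: "lin ?p" by (rule lin_act_left)
  have N: "x - ?N (?p x) \<in> A_ideal t" for x
    using eqv_normal_form[OF assms(1)] by (simp add: eqv_def)
  have "X - tmap ?N ?N (tmap ?p ?p X) \<in> AA_ideal t" for X
  proof (rule lin_subspace[where h = "\<lambda>X. X - tmap ?N ?N (tmap ?p ?p X)"])
    show "lin (\<lambda>X. X - tmap ?N ?N (tmap ?p ?p X))"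
      using lin_add[OF lin_id lin_scal[OF lin_comp[OF lin_tmap lin_tmap], of "-1"]] by simp
    fix k :: "agen word \<times> agen word"
    define x y where "x = single (fst k) (1::complex)" and "y = single (snd k) (1::complex)"
    have k: "single k 1 = tns x y" by (simp add: x_def y_def tns_single)
    have "tns (x - ?N (?p x)) y + tns (?N (?p x)) (y - ?N (?p y)) \<in> AA_ideal t"
      by (rule pm.subspace_add[OF subspace_AA tns_in_AA[OF disjI1[OF N]] tns_in_AA[OF disjI2[OF
          N]]])
    then show "single k 1 - tmap ?N ?N (tmap ?p ?p (single k 1)) \<in> AA_ideal t"
      unfolding k by (simp add: tmap_tns[OF p p] tmap_tns[OF lin_lext lin_lext] tns_simps)
  qed (rule subspace_AA)
  from this[of X] show ?thesis using assms(2) by (simp add: module_hom.zero[OF lin_tmap])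
qed

lemma two_sided_vimage_twist: "two_sided {x. twist p x \<in> A_ideal t}"
  unfolding two_sided_def using subspace_vimage[OF lin_twist subspace_A] by (auto simp:
      A_ideal_mult)

text \<open>Every relation is homogeneous, so \<open>twist\<close> multiplies it by 1 or (-1)^p.
  Stability under these signs is what makes \<open>AA_ideal\<close> two-sided for the graded
  product.\<close>

lemma twist_A_ideal: "x \<in> A_ideal t \<Longrightarrow> twist p x \<in> A_ideal t"
proof -
  have sc: "scal z x \<in> A_ideal t" if "x \<in> A_rels t" for x z
    using that A_rels_in pm.subspace_scale[OF subspace_A] by blast
  have pp: "(-1) ^ p * ((-1) ^ p * z) = z" "(-1) ^ p * (-1) ^ p = (1 :: complex)" for z :: complex
    by (simp_all add: mult.assoc[symmetric] power_add[symmetric] mult_2[symmetric])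
  have "twist p x = scal 1 x \<or> twist p x = scal ((-1) ^ p) x" if "x \<in> A_rels t" for x
    using that unfolding A_rels_def insert_iff empty_iff
    by (elim disjE; hypsubst?; simp add: pp pm.scale_right_diff_distrib pm.scale_right_distrib
        mult_ac)
  then have "twist p x \<in> A_ideal t" if "x \<in> A_rels t" for x
    using that sc[OF that] by metis
  then have "A_rels t \<subseteq> {x. twist p x \<in> A_ideal t}" by blast
  from A_ideal_minimal[OF two_sided_vimage_twist this] show "x \<in> A_ideal t \<Longrightarrow> twist p x \<in> A_ideal t"
    by blast
qed

lemma tens_mult_AA_left: "X \<in> AA_ideal t \<Longrightarrow> tens_mult D X \<in> AA_ideal t"
proof (rule lin_subspace[OF lin_tens_mult_left subspace_AA])
  fix k :: "agen word \<times> agen word" assume X: "X \<in> AA_ideal t"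
  obtain u v where k: "k = (u, v)" by (cases k)
  show "tens_mult (single k 1) X \<in> AA_ideal t"
  proof (rule AA_image[OF lin_tens_mult_right subspace_AA _ X])
    fix x y assume "x \<in> A_ideal t \<or> y \<in> A_ideal t"
    then show "tens_mult (single k 1) (tns x y) \<in> AA_ideal t"
      using tens_mult_tns_left[of "single u 1" v "tns x y"]
      by (auto simp: k tns_single tmap_tns lin_mult_twist lin_mult_left intro!: tns_in_AA
          A_ideal_mult(1) twist_A_ideal)
  qed
qed

lemma tens_mult_AA_right: "X \<in> AA_ideal t \<Longrightarrow> tens_mult X D \<in> AA_ideal t"
proof (rule lin_subspace[OF lin_tens_mult_right subspace_AA])
  fix k :: "agen word \<times> agen word" assume X: "X \<in> AA_ideal t"
  obtain u v where k: "k = (u, v)" by (cases k)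
  show "tens_mult X (single k 1) \<in> AA_ideal t"
  proof (rule AA_image[OF lin_tens_mult_left subspace_AA _ X])
    fix x y assume "x \<in> A_ideal t \<or> y \<in> A_ideal t"
    then show "tens_mult (tns x y) (single k 1) \<in> AA_ideal t"
      using tens_mult_tns_right[of "tns x y" u "single v 1"]
      by (auto simp: k tns_single tmap_tns lin_mult_twist lin_mult_right intro!: tns_in_AA
          A_ideal_mult(2) twist_A_ideal)
  qed
qed

text \<open>Multiplicativity of the coproduct reduces this to the defining relations;
  \<open>AA_ideal_if_zero\<close> turns each of them into an identity between finitely many pairs of
  monomials.\<close>

lemma free_comult_A_ideal:
  assumes "t \<noteq> 0" "x \<in> A_ideal t"
  shows "free_comult x \<in> AA_ideal t"
proof -
  let ?I = "{x. free_comult x \<in> AA_ideal t}"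
  have "two_sided ?I"
    unfolding two_sided_def using subspace_vimage[OF lin_free_comult subspace_AA]
    by (auto simp: free_comult_mult tens_mult_AA_left tens_mult_AA_right)
  moreover have "free_comult x \<in> AA_ideal t" if "x \<in> A_rels t" for x
  proof (rule AA_ideal_if_zero[OF assms(1)])
    let ?p = "\<lambda>x. act t x vac"
    have p: "lin ?p" by (rule lin_act_left)
    note [simp] = hom_rules[OF lin_tmap]
    show "tmap ?p ?p (free_comult x) = 0"
      using that unfolding A_rels_def insert_iff empty_iff
      apply (elim disjE; hypsubst?)
      using \<open>t \<noteq> 0\<close>
      apply (simp_all add: free_comult_mult tens_eq_tns tmap_tns[OF p p] comm_factor_def tns_simps
          tns_single)
      apply (simp_all add: field_simps single_diff[symmetric] single_add[symmetric]
          single_uminus[symmetric])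
      apply (rule poly_mapping_eqI, simp add: lookup_add lookup_single when_def field_simps)
      done
  qed
  ultimately show ?thesis using A_ideal_minimal[of ?I t] assms(2) by blast
qed

section \<open>Operations on cosets computed from representatives\<close>

lemma A_quot: "quot (A_ideal t)" and AA_quot: "quot (AA_ideal t)"
  using subspace_A subspace_AA by (auto simp: quot_def)

lemma A_proj_proj: "A_proj t = quot.proj (*) 1 (A_ideal t)"
  by (simp add: fun_eq_iff A_proj_def quot.proj_def[OF A_quot] free_alg_mod_alg)

lemma AA_proj_proj: "AA_proj t = quot.proj tens_mult (tens 1 1) (AA_ideal t)"
  by (simp add: fun_eq_iff AA_proj_def quot.proj_def[OF AA_quot] free_tens_alg_mod_alg)

lemma A_proj_eq: "A_proj t x = A_proj t y \<longleftrightarrow> eqv t x y"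
  by (simp add: A_proj_proj quot.proj_eq[OF A_quot] eqv_def)

lemma in_A_proj: "y \<in> A_proj t x \<longleftrightarrow> eqv t y x"
  by (simp add: A_proj_proj quot.in_proj[OF A_quot] eqv_def)

lemma AA_proj_eq: "AA_proj t x = AA_proj t y \<longleftrightarrow> x - y \<in> AA_ideal t"
  by (simp add: AA_proj_proj quot.proj_eq[OF AA_quot])

lemma in_AA_proj: "y \<in> AA_proj t x \<longleftrightarrow> y - x \<in> AA_ideal t"
  by (simp add: AA_proj_proj quot.in_proj[OF AA_quot])

lemma Aq_quot: "Aq t = quot_alg (mod_alg (*) 1) (A_ideal t)"
  by (simp add: Aq_def free_alg_mod_alg)

lemma AAq_quot: "AAq t = quot_alg (mod_alg tens_mult (tens 1 1)) (AA_ideal t)"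
  by (simp add: AAq_def free_tens_alg_mod_alg)

lemma carrier_Aq: "carrier (Aq t) = range (A_proj t)"
  and zero_Aq: "\<zero>\<^bsub>Aq t\<^esub> = A_proj t 0"
  and one_Aq: "\<one>\<^bsub>Aq t\<^esub> = A_proj t 1"
  and smult_Aq: "z \<odot>\<^bsub>Aq t\<^esub> A_proj t x = A_proj t (scal z x)"
  and finsum_Aq: "finite I \<Longrightarrow> (\<Oplus>\<^bsub>Aq t\<^esub>i\<in>I. A_proj t (f i)) = A_proj t (sum f I)"
  and lin_span_Aq: "lin_span (Aq t) (A_proj t ` S) = A_proj t ` pm.span S"
  unfolding Aq_quot A_proj_proj
  by (simp_all add: quot.carrier_Q[OF A_quot] quot.zero_Q[OF A_quot] quot.one_Q[OF A_quot]
      quot.smult_Q[OF A_quot] quot.finsum_Q[OF A_quot] quot.lin_span_Q[OF A_quot])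

lemma mult_Aq: "A_proj t x \<otimes>\<^bsub>Aq t\<^esub> A_proj t y = A_proj t (x * y)"
  unfolding Aq_quot A_proj_proj
  by (rule quot_mult[OF A_quot]) (auto simp: A_ideal_mult algebra_simps)

lemma finsum_AAq: "finite I \<Longrightarrow> (\<Oplus>\<^bsub>AAq t\<^esub>i\<in>I. AA_proj t (f i)) = AA_proj t (sum f I)"
  unfolding AAq_quot AA_proj_proj by (simp add: quot.finsum_Q[OF AA_quot])

lemma A_proj_finsum_cong:
  assumes "finite I" "\<And>i. i \<in> I \<Longrightarrow> g i = A_proj t (f i)"
  shows "(\<Oplus>\<^bsub>Aq t\<^esub>i\<in>I. g i) = A_proj t (sum f I)"
proof -
  interpret abelian_group "Aq t" unfolding Aq_quot by (rule quot.abelian_group_Q[OF A_quot])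
  have "(\<Oplus>\<^bsub>Aq t\<^esub>i\<in>I. g i) = (\<Oplus>\<^bsub>Aq t\<^esub>i\<in>I. A_proj t (f i))"
    by (rule finsum_cong') (auto simp: assms carrier_Aq)
  then show ?thesis by (simp add: finsum_Aq assms)
qed

lemma AA_proj_finsum_cong:
  assumes "finite I" "\<And>i. i \<in> I \<Longrightarrow> g i = AA_proj t (f i)"
  shows "(\<Oplus>\<^bsub>AAq t\<^esub>i\<in>I. g i) = AA_proj t (sum f I)"
proof -
  interpret abelian_group "AAq t" unfolding AAq_quot by (rule quot.abelian_group_Q[OF AA_quot])
  have "(\<Oplus>\<^bsub>AAq t\<^esub>i\<in>I. g i) = (\<Oplus>\<^bsub>AAq t\<^esub>i\<in>I. AA_proj t (f i))"
    by (rule finsum_cong')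
      (auto simp: assms AAq_quot AA_proj_proj quot.carrier_Q[OF AA_quot])
  then show ?thesis by (simp add: finsum_AAq assms)
qed

lemma comult_A_proj: "t \<noteq> 0 \<Longrightarrow> comult t (A_proj t x) = AA_proj t (free_comult x)"
proof -
  assume t: "t \<noteq> 0"
  have "AA_proj t (free_comult y) = AA_proj t (free_comult x)" if "y \<in> A_proj t x" for y
    using free_comult_A_ideal[OF t, of "y - x"] that by (simp add: AA_proj_eq in_A_proj eqv_def)
  then have "(\<lambda>x. AA_proj t (free_comult x)) ` A_proj t x = {AA_proj t (free_comult x)}"
    using in_A_proj eqv_refl by blast
  then show ?thesis by (simp add: comult_def)
qed

lemma A_tens_A_proj: "A_tens t (A_proj t x) (A_proj t y) = AA_proj t (tns x y)"
proof -
  have "AA_proj t (tns x' y') = AA_proj t (tns x y)" if "x' \<in> A_proj t x" "y' \<in> A_proj t y" for x'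
      y'
  proof -
    have "tns (x' - x) y' + tns x (y' - y) \<in> AA_ideal t"
      using that by (intro pm.subspace_add[OF subspace_AA] tns_in_AA) (auto simp: in_A_proj eqv_def)
    then show ?thesis by (simp add: AA_proj_eq tns_simps)
  qed
  then have "{AA_proj t (tens x' y') | x' y'. x' \<in> A_proj t x \<and> y' \<in> A_proj t y} =
      {AA_proj t (tns x y)}"
    using in_A_proj eqv_refl unfolding tens_eq_tns by blast
  then show ?thesis by (simp add: A_tens_def)
qed

section \<open>The dual pairing and the right action\<close>

abbreviation (input) counit :: "agen word \<Rightarrow> complex" where
    "counit \<equiv> \<lambda>w. mult_ext counit_gen (letters w)"

lemma mult_ext_simps [simp]: "mult_ext \<phi> [] = 1" "mult_ext \<phi> (g # gs) = \<phi> g * mult_ext \<phi> gs"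
  by (simp_all add: mult_ext_def)

lemma lin_ext_1 [simp]: "lin_ext \<phi> 1 = \<phi> (Word [])"
  by (simp add: one_free)

lemma lin_ext_gen [simp]: "lin_ext \<phi> (gen g) = \<phi> (Word [g])"
  by (simp add: gen_def)

abbreviation char_ext where "char_ext \<phi> \<equiv> lin_ext (\<lambda>w. mult_ext \<phi> (letters w))"

lemma lin_ext_gen_mult_eqI:
  assumes "\<And>gs. lin_ext \<phi> (gen g * single (Word gs) 1) = h (single (Word gs) 1)" "linf h"
  shows "lin_ext \<phi> (gen g * x) = h x"
  by (rule hom_eqI[OF lin_comp[OF lin_mult_left linf_lin_ext] assms(2)]) (metis assms(1)
      word.collapse)

lemma char_ext_gen_mult [simp]: "char_ext \<phi> (gen g * x) = \<phi> g * char_ext \<phi> x"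
  by (rule lin_ext_gen_mult_eqI) (auto simp: gen_mult_single intro!: linfI simp: algebra_simps)

lemma char_ext_mult [simp]: "char_ext \<phi> (x * y) = char_ext \<phi> x * char_ext \<phi> y"
  by (induction x rule: free_induct) (simp_all add: mult.assoc distrib_right)

definition e_val :: "complex \<Rightarrow> complex \<Rightarrow> complex" where
  "e_val q t = (t - 1 / t) / (q - 1 / q)"

lemma e_gen_b [simp]: "e_gen q t Gb = e_val q t"
  by (simp add: e_val_def)

declare e_gen.simps(1) [simp del]

lemma ugen_word_eq:
  "ugen_word q t Gk = (\<lambda>w. mult_ext (k_gen t) (letters w))"
  "ugen_word q t Gki = (\<lambda>w. mult_ext (ki_gen t) (letters w))"
  "ugen_word q t Ge = (\<lambda>w. e_word q t (letters w))"
  "ugen_word q t Gf = (\<lambda>w. f_word t (letters w))"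
  by (simp_all add: fun_eq_iff)

abbreviation "e_ext q t \<equiv> lin_ext (\<lambda>w. e_word q t (letters w))"
abbreviation "f_ext t \<equiv> lin_ext (\<lambda>w. f_word t (letters w))"

lemma e_ext_gen_mult [simp]: "e_ext q t (gen g * x) = e_gen q t g * char_ext counit_gen x +
    k_gen t g * e_ext q t x"
proof (rule lin_ext_gen_mult_eqI)
  fix gs
  show "e_ext q t (gen g * single (Word gs) 1) =
      e_gen q t g * char_ext counit_gen (single (Word gs) 1) + k_gen t g * e_ext q t (single (Word
          gs) 1)"
    by (cases g) (simp_all add: gen_mult_single)
qed (auto intro!: linfI simp: algebra_simps)

lemma f_ext_gen_mult [simp]: "f_ext t (gen g * x) = f_gen g * char_ext (ki_gen t) x +
    counit_gen g * f_ext t x"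
proof (rule lin_ext_gen_mult_eqI)
  fix gs
  show "f_ext t (gen g * single (Word gs) 1) =
      f_gen g * char_ext (ki_gen t) (single (Word gs) 1) + counit_gen g * f_ext t (single (Word
          gs) 1)"
    by (cases g) (simp_all add: gen_mult_single)
qed (auto intro!: linfI simp: algebra_simps)

lemma e_ext_mult: "e_ext q t (x * y) = e_ext q t x * char_ext counit_gen y +
    char_ext (k_gen t) x * e_ext q t y"
  by (induction x rule: free_induct) (simp_all add: mult.assoc distrib_right algebra_simps)

lemma f_ext_mult: "f_ext t (x * y) = f_ext t x * char_ext (ki_gen t) y + char_ext counit_gen x *
    f_ext t y"
  by (induction x rule: free_induct) (simp_all add: mult.assoc distrib_right algebra_simps)

text \<open>The kernel of e or f alone is not an ideal, since e(xy) and f(xy) also involve the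
  counit, k and k^-1. The common kernel of all five functionals is one, so they are treated
  together.\<close>

lemma functionals_A_ideal:
  assumes "t \<noteq> 0" "x \<in> A_ideal t"
  shows "char_ext counit_gen x = 0" "lin_ext (ugen_word q t g) x = 0"
proof -
  let ?I = "{x. char_ext counit_gen x = 0 \<and> char_ext (k_gen t) x = 0 \<and> char_ext (ki_gen t) x = 0 \<and>
     e_ext q t x = 0 \<and> f_ext t x = 0}"
  have "two_sided ?I"
    by (auto simp: two_sided_def e_ext_mult f_ext_mult intro!: pm.subspaceI)
  moreover have "x \<in> ?I" if "x \<in> A_rels t" for x
    using that unfolding A_rels_def insert_iff empty_iff
    by (elim disjE; hypsubst?; use assms(1) in simp)
  ultimately have "x \<in> ?I" using A_ideal_minimal assms(2) by blast
  then show "char_ext counit_gen x = 0" "lin_ext (ugen_word q t g) x = 0"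
    by (auto simp: ugen_word_eq intro: ugen.exhaust[of g])
qed

section \<open>The right action of the generators of U on representatives\<close>

definition R_gen :: "complex \<Rightarrow> complex \<Rightarrow> ugen \<Rightarrow> agen free \<Rightarrow> agen free" where
  "R_gen q t g u = contrL (ugen_word q t g) (free_comult u)"

lemma lin_R_gen: "lin (R_gen q t g)"
  unfolding R_gen_def[abs_def] by (rule lin_comp[OF lin_free_comult lin_contrL])

lemmas R_gen_simps [simp] =
  hom_rules[OF lin_R_gen]

lemma R_gen_A_ideal: "t \<noteq> 0 \<Longrightarrow> u \<in> A_ideal t \<Longrightarrow> R_gen q t g u \<in> A_ideal t"
  unfolding R_gen_def
  by (rule AA_image[OF lin_contrL subspace_A _ free_comult_A_ideal])
    (auto simp: contrL_tns functionals_A_ideal intro: pm.subspace_scale[OF subspace_A]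
        pm.subspace_0[OF subspace_A])

text \<open>A character that kills b and c lives on words without these letters, whereas e and f
  live on words of odd parity. The sign of the graded product is therefore constant on the support
  of each functional and can be pulled out of the contractions below.\<close>

lemma even_word: "mult_ext \<phi> gs \<noteq> 0 \<Longrightarrow> \<phi> Gb = 0 \<Longrightarrow> \<phi> Gc = 0 \<Longrightarrow> even (word_parity (Word gs))"
proof (induction gs)
  case (Cons g gs)
  then show ?case by (cases g) (auto simp: word_parity_def)
qed (simp add: word_parity_def)

lemma odd_e_word: "e_word q t gs \<noteq> 0 \<Longrightarrow> odd (word_parity (Word gs))"
proof (induction gs)
  case (Cons g gs)
  then show ?case using even_word[of counit_gen gs]
    by (cases g; cases "e_word q t gs = 0"; cases "mult_ext counit_gen gs = 0") (auto simp:
        word_parity_def)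
qed simp

lemma odd_f_word: "f_word t gs \<noteq> 0 \<Longrightarrow> odd (word_parity (Word gs))"
proof (induction gs)
  case (Cons g gs)
  then show ?case using even_word[of "ki_gen t" gs]
    by (cases g; cases "f_word t gs = 0"; cases "mult_ext (ki_gen t) gs = 0") (auto simp:
        word_parity_def)
qed simp

lemma contrL_gen_mult:
  assumes "lin h" "\<And>gs v. h (single (Word gs, v) 1) =
      scal ((-1) ^ (parity z * word_parity (Word gs)) * \<phi> (Word (y # gs))) (gen z * single v 1)"
  shows "contrL \<phi> (tens_mult (tns (gen y) (gen z)) D) = h D"
proof (rule hom_eqI[OF lin_comp[OF lin_tens_mult_right lin_contrL] assms(1)])
  fix k :: "agen word \<times> agen word"
  obtain gs v where k: "k = (Word gs, v)" by (metis surj_pair word.exhaust)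
  show "contrL \<phi> (tens_mult (tns (gen y) (gen z)) (single k 1)) = h (single k 1)"
    unfolding k assms(2)
    by (simp add: gen_def tns_single tens_mult_single contrL_def mult_single plus_word_def)
      (simp add: word_parity_def)
qed

lemma contrL_char:
  assumes "\<phi> Gb = 0" "\<phi> Gc = 0"
  shows "contrL (\<lambda>w. mult_ext \<phi> (letters w)) (tens_mult (tns (gen y) (gen z)) D) =
    scal (\<phi> y) (gen z * contrL (\<lambda>w. mult_ext \<phi> (letters w)) D)"
proof (rule contrL_gen_mult)
  fix gs v
  show "scal (\<phi> y) (gen z * contrL (\<lambda>w. mult_ext \<phi> (letters w)) (single (Word gs, v) 1)) =
     scal ((-1) ^ (parity z * word_parity (Word gs)) * mult_ext \<phi> (letters (Word (y # gs)))) (gen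
         z * single v 1)"
    using even_word[of \<phi> gs, OF _ assms] by (cases "mult_ext \<phi> gs = 0") (auto simp: contrL_def
        gen_def mult_single)
qed (intro lin_scal lin_comp[OF lin_contrL lin_mult_left])

lemma contrL_e:
  "contrL (\<lambda>w. e_word q t (letters w)) (tens_mult (tns (gen y) (gen z)) D) =
    scal (e_gen q t y) (gen z * contrL counit D) +
    scal ((-1) ^ (parity z + parity y) * k_gen t y) (gen z * contrL (\<lambda>w. e_word q t (letters w)) D)"
proof (rule contrL_gen_mult)
  fix gs v
  show "scal (e_gen q t y) (gen z * contrL counit (single (Word gs, v) 1)) +
    scal ((-1) ^ (parity z + parity y) * k_gen t y) (gen z * contrL (\<lambda>w. e_word q t (letters w))
        (single (Word gs, v) 1)) =
     scal ((-1) ^ (parity z * word_parity (Word gs)) * e_word q t (letters (Word (y # gs)))) (gen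
         z * single v 1)"
    using even_word[of counit_gen gs] odd_e_word[of q t gs]
    by (cases "mult_ext counit_gen gs = 0"; cases "e_word q t gs = 0"; cases z)
      (auto simp: contrL_def gen_def mult_single single_add[symmetric] algebra_simps)
qed (intro lin_add lin_scal lin_comp[OF lin_contrL lin_mult_left])

lemma contrL_f:
  "contrL (\<lambda>w. f_word t (letters w)) (tens_mult (tns (gen y) (gen z)) D) =
    scal (f_gen y) (gen z * contrL (\<lambda>w. mult_ext (ki_gen t) (letters w)) D) +
    scal ((-1) ^ (parity z + parity y) * counit_gen y) (gen z * contrL (\<lambda>w. f_word t (letters w))
        D)"
proof (rule contrL_gen_mult)
  fix gs v
  show "scal (f_gen y) (gen z * contrL (\<lambda>w. mult_ext (ki_gen t) (letters w)) (single (Word gs,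
      v) 1)) +
    scal ((-1) ^ (parity z + parity y) * counit_gen y) (gen z * contrL (\<lambda>w. f_word t (letters w))
        (single (Word gs, v) 1)) =
     scal ((-1) ^ (parity z * word_parity (Word gs)) * f_word t (letters (Word (y # gs)))) (gen z
         * single v 1)"
    using even_word[of "ki_gen t" gs] odd_f_word[of t gs]
    by (cases "mult_ext (ki_gen t) gs = 0"; cases "f_word t gs = 0"; cases z)
      (auto simp: contrL_def gen_def mult_single single_add[symmetric] algebra_simps)
qed (intro lin_add lin_scal lin_comp[OF lin_contrL lin_mult_left])

lemmas contrL_simps =
  hom_rules[OF lin_contrL]

lemma contrL_counit [simp]: "contrL counit (free_comult x) = x"
proof (induction x rule: free_induct)
  case (gen g x)
  then show ?case by (cases g) (simp_all add: free_comult_gen_mult tens_eq_tns contrL_simps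
      contrL_char)
qed (simp_all add: contrL_simps contrL_tns)

text \<open>R_k acts through the first leg of the coproduct, so the weight depends only on the row
  of the matrix with rows (a, b) and (c, d).\<close>

fun k_weight :: "complex \<Rightarrow> agen \<Rightarrow> complex" where
  "k_weight t Ga = t"
| "k_weight t Gb = t"
| "k_weight t Gc = - (1 / t)"
| "k_weight t Gd = - (1 / t)"
| "k_weight t Gs = -1"

text \<open>R_e replaces the first row (a, b) by the second, up to the factor e(b), and R_f replaces
  the second row by the first.\<close>

fun e_shift :: "agen \<Rightarrow> agen free" where
  "e_shift Ga = gen Gc"
| "e_shift Gb = gen Gd"
| "e_shift _ = 0"

fun f_shift :: "agen \<Rightarrow> agen free" where
  "f_shift Gc = gen Ga"
| "f_shift Gd = gen Gb"
| "f_shift _ = 0"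

lemma R_k_gen [simp]: "R_gen q t Gk (gen g * x) = scal (k_weight t g) (gen g * R_gen q t Gk x)"
  by (cases g) (simp_all add: R_gen_def ugen_word_eq free_comult_gen_mult tens_eq_tns contrL_simps
      contrL_char)

lemma R_ki_gen [simp]: "R_gen q t Gki (gen g * x) = scal (1 / k_weight t g) (gen g *
    R_gen q t Gki x)"
  by (cases g) (simp_all add: R_gen_def ugen_word_eq free_comult_gen_mult tens_eq_tns contrL_simps
      contrL_char)

lemma R_e_gen [simp]: "R_gen q t Ge (gen g * x) =
    scal (e_val q t) (e_shift g * x) + scal ((-1) ^ parity g * k_weight t g) (gen g * R_gen q t Ge
        x)"
  by (cases g) (simp_all add: R_gen_def ugen_word_eq free_comult_gen_mult tens_eq_tns contrL_simps
      contrL_e)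

lemma R_f_gen [simp]: "R_gen q t Gf (gen g * x) =
    f_shift g * R_gen q t Gki x + scal ((-1) ^ parity g) (gen g * R_gen q t Gf x)"
  by (cases g) (simp_all add: R_gen_def ugen_word_eq free_comult_gen_mult tens_eq_tns contrL_simps
      contrL_f)

lemma R_gen_1 [simp]: "R_gen q t Gk 1 = 1" "R_gen q t Gki 1 = 1" "R_gen q t Ge 1 = 0"
    "R_gen q t Gf 1 = 0"
  by (simp_all add: R_gen_def contrL_tns)

text \<open>R_k and its inverse are even, R_e and R_f odd. These signs are needed to move the
  operators past the \<open>twist\<close> in a graded product.\<close>

lemma twist_R_gen:
  "twist p (R_gen q t Gk x) = R_gen q t Gk (twist p x)"
  "twist p (R_gen q t Gki x) = R_gen q t Gki (twist p x)"
  "twist p (R_gen q t Ge x) = scal ((-1) ^ p) (R_gen q t Ge (twist p x))"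
  "twist p (R_gen q t Gf x) = scal ((-1) ^ p) (R_gen q t Gf (twist p x))"
proof -
  have pp: "(-1) ^ p * ((-1) ^ p * z) = z" "(-1) ^ p * (-1) ^ p = (1 :: complex)" for z :: complex
    by (simp_all add: mult.assoc[symmetric] power_add[symmetric] mult_2[symmetric])
  show "twist p (R_gen q t Gk x) = R_gen q t Gk (twist p x)"
    by (induction x rule: free_induct) (simp_all add: mult_ac)
  show ki: "twist p (R_gen q t Gki x) = R_gen q t Gki (twist p x)" for x
    by (induction x rule: free_induct) (simp_all add: mult_ac)
  show "twist p (R_gen q t Ge x) = scal ((-1) ^ p) (R_gen q t Ge (twist p x))"
  proof (induction x rule: free_induct)
    case (gen g x)
    then show ?case by (cases g) (simp_all add: pp pm.scale_right_distrib mult_ac)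
  qed (simp_all add: pm.scale_right_distrib mult.commute)
  show "twist p (R_gen q t Gf x) = scal ((-1) ^ p) (R_gen q t Gf (twist p x))"
  proof (induction x rule: free_induct)
    case (gen g x)
    then show ?case by (cases g) (simp_all add: pp ki pm.scale_right_distrib mult_ac)
  qed (simp_all add: pm.scale_right_distrib mult.commute)
qed

lemmas tmap_simps =
  hom_rules[OF lin_tmap]

text \<open>A form of coassociativity: contracting the first leg does not interfere with splitting
  off the last. The proof compares how both sides behave under left multiplication by a generator.
  The rule for f involves k^-1, so that case is settled beforehand.\<close>

lemma free_comult_R_gen: "free_comult (R_gen q t g u) = tmap (R_gen q t g) (\<lambda>x. x) (free_comult u)"
proof -
  note R = tmap_tns[OF lin_R_gen lin_id]
  have t1: "tmap (R_gen q t g) (\<lambda>x. x) (tns 1 1) = tns (R_gen q t g 1) 1" for g by (rule R)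
  have k: "tmap (R_gen q t Gk) (\<lambda>x. x) (tens_mult (comult_gen h) D) =
      scal (k_weight t h) (tens_mult (comult_gen h) (tmap (R_gen q t Gk) (\<lambda>x. x) D))" for h D
    by (rule tns_homI[OF lin_comp[OF lin_tens_mult_right lin_tmap]
          lin_scal[OF lin_comp[OF lin_tmap lin_tens_mult_right]]], cases h)
      (simp_all add: tens_eq_tns R tmap_simps tns_simps twist_R_gen pm.scale_right_distrib
          pm.scale_right_diff_distrib)
  have ki: "tmap (R_gen q t Gki) (\<lambda>x. x) (tens_mult (comult_gen h) D) =
      scal (1 / k_weight t h) (tens_mult (comult_gen h) (tmap (R_gen q t Gki) (\<lambda>x. x) D))" for h D
    by (rule tns_homI[OF lin_comp[OF lin_tens_mult_right lin_tmap]
          lin_scal[OF lin_comp[OF lin_tmap lin_tens_mult_right]]], cases h)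
      (simp_all add: tens_eq_tns R tmap_simps tns_simps twist_R_gen pm.scale_right_distrib
          pm.scale_right_diff_distrib)
  have e: "tmap (R_gen q t Ge) (\<lambda>x. x) (tens_mult (comult_gen h) D) =
      scal (e_val q t) (tens_mult (free_comult (e_shift h)) D) +
      scal ((-1) ^ parity h * k_weight t h) (tens_mult (comult_gen h) (tmap (R_gen q t Ge) (\<lambda>x. x)
          D))" for h D
    by (rule tns_homI[OF lin_comp[OF lin_tens_mult_right lin_tmap]
          lin_add[OF lin_scal[OF lin_tens_mult_right] lin_scal[OF lin_comp[OF lin_tmap
              lin_tens_mult_right]]]], cases h)
      (simp_all add: tens_eq_tns R tmap_simps tns_simps twist_R_gen pm.scale_right_distrib
          pm.scale_right_diff_distrib)
  have f: "tmap (R_gen q t Gf) (\<lambda>x. x) (tens_mult (comult_gen h) D) =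
      tens_mult (free_comult (f_shift h)) (tmap (R_gen q t Gki) (\<lambda>x. x) D) +
      scal ((-1) ^ parity h) (tens_mult (comult_gen h) (tmap (R_gen q t Gf) (\<lambda>x. x) D))" for h D
    by (rule tns_homI[OF lin_comp[OF lin_tens_mult_right lin_tmap]
          lin_add[OF lin_comp[OF lin_tmap lin_tens_mult_right] lin_scal[OF lin_comp[OF lin_tmap
              lin_tens_mult_right]]]], cases h)
      (simp_all add: tens_eq_tns R tmap_simps tns_simps twist_R_gen pm.scale_right_distrib
          pm.scale_right_diff_distrib)
  have 0: "free_comult (R_gen q t Gki u) = tmap (R_gen q t Gki) (\<lambda>x. x) (free_comult u)" for u
    by (induction u rule: free_induct) (simp_all add: free_comult_gen_mult ki tmap_simps t1)
  show ?thesis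
    by (cases g; induction u rule: free_induct)
      (simp_all add: free_comult_gen_mult free_comult_mult k ki e f 0 tmap_simps t1 tns_simps)
qed

subsection \<open>The relations of \<open>U\<^sub>q(osp(1,2))\<close>\<close>

lemma R_k_ki:
  assumes "t \<noteq> 0"
  shows "R_gen q t Gk (R_gen q t Gki u) = u" "R_gen q t Gki (R_gen q t Gk u) = u"
proof -
  have w: "k_weight t g \<noteq> 0" for g using assms by (cases g) auto
  show "R_gen q t Gk (R_gen q t Gki u) = u" "R_gen q t Gki (R_gen q t Gk u) = u"
    by (induction u rule: free_induct) (simp_all add: w)
qed

text \<open>R reverses products, so k e k^-1 acts as R_{k^-1} R_e R_k. The factor -t^2 = q is thus
  the one in k e k^-1 = q e.\<close>

lemma R_ki_e: 
  assumes "t \<noteq> 0"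
  shows "R_gen q t Gki (R_gen q t Ge u) = scal (- (t\<^sup>2)) (R_gen q t Ge (R_gen q t Gki u))"
proof (induction u rule: free_induct)
  case (gen g u)
  then show ?case using assms
    by (cases g) (simp_all add: pm.scale_right_distrib pm.scale_right_diff_distrib power2_eq_square)
qed (simp_all add: pm.scale_right_distrib mult.commute)

lemma R_ki_f: 
  assumes "t \<noteq> 0"
  shows "R_gen q t Gki (R_gen q t Gf u) = scal (- 1 / t\<^sup>2) (R_gen q t Gf (R_gen q t Gki u))"
proof (induction u rule: free_induct)
  case (gen g u)
  then show ?case using assms
    by (cases g) (simp_all add: pm.scale_right_distrib pm.scale_right_diff_distrib power2_eq_square)
qed (simp_all add: pm.scale_right_distrib mult.commute)

lemma R_e_f:
  assumes "t \<noteq> 0"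
  shows "R_gen q t Gf (R_gen q t Ge u) + R_gen q t Ge (R_gen q t Gf u) =
    scal (1 / (q - 1 / q)) (R_gen q t Gk u - R_gen q t Gki u)"
proof (induction u rule: free_induct)
  case (gen g u)
  \<comment> \<open>With this abbreviation the induction hypothesis becomes a rewrite rule for R_e
    R_f u. The mixed terms of the two Leibniz rules are then matched by
    \<open>R_ki_e\<close>.\<close>
  define X where "X = R_gen q t Gf (R_gen q t Ge u)"
  have *: "R_gen q t Ge (R_gen q t Gf u) =
      scal (1 / (q - 1 / q)) (R_gen q t Gk u - R_gen q t Gki u) - X"
    using gen by (simp add: X_def algebra_simps)
  define r where "r = 1 / (q - 1 / q)"
  have ev: "e_val q t = r * (t - 1 / t)" by (simp add: e_val_def r_def)
  show ?case using assms
    by (cases g)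
      (simp_all add: * X_def[symmetric] r_def[symmetric] ev R_ki_e pm.scale_right_distrib
        pm.scale_right_diff_distrib distrib_left right_diff_distrib power2_eq_square,
       (rule poly_mapping_eqI, simp add: lookup_add lookup_minus field_simps)+)
next
  case (scal z u)
  show ?case
    using arg_cong[OF scal, of "scal z"]
    by (simp add: pm.scale_right_distrib pm.scale_right_diff_distrib)
qed (simp_all add: pm.scale_right_distrib pm.scale_right_diff_distrib add.commute add.left_commute)

section \<open>Action and pairing of arbitrary elements of U\<close>

fun R_word :: "complex \<Rightarrow> complex \<Rightarrow> ugen list \<Rightarrow> agen free \<Rightarrow> agen free" where
  "R_word q t [] u = u"
| "R_word q t (g # gs) u = R_word q t gs (R_gen q t g u)"

definition R_free :: "complex \<Rightarrow> complex \<Rightarrow> ugen free \<Rightarrow> agen free \<Rightarrow> agen free" where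
  "R_free q t x u = lext (\<lambda>w. R_word q t (letters w) u) x"

lemma lin_R_free_left: "lin (\<lambda>x. R_free q t x u)"
  unfolding R_free_def by (rule lin_lext)

lemma lin_R_free: "lin (R_free q t x)"
proof -
  have "lin (R_word q t gs)" for gs
    by (induction gs) (auto simp: lin_id intro: lin_comp lin_R_gen)
  then show ?thesis unfolding R_free_def[abs_def] by (intro lin_lext_param)
qed

lemmas R_free_simps [simp] =
  hom_rules[OF lin_R_free_left]
  hom_rules[OF lin_R_free]

lemma R_free_1 [simp]: "R_free q t 1 u = u"
  by (simp add: R_free_def one_free)

lemma R_free_gen_mult: "R_free q t (gen g * x) u = R_free q t x (R_gen q t g u)"
  by (rule hom_eqI[OF lin_comp[OF lin_mult_left lin_R_free_left] lin_R_free_left])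
    (simp add: R_free_def gen_mult_single)

lemma R_free_gen [simp]: "R_free q t (gen g) u = R_gen q t g u"
  using R_free_gen_mult[of q t g 1 u] by simp

text \<open>The first factor of a product pairs with the first leg of the coproduct, so it acts
  first and the order is reversed.\<close>

lemma R_free_mult [simp]: "R_free q t (x * y) u = R_free q t y (R_free q t x u)"
proof (induction x arbitrary: u rule: free_induct)
  case (gen g x)
  then show ?case by (simp add: mult.assoc R_free_gen_mult)
qed (simp_all add: distrib_right)

text \<open>The relations of U hold for these operators already on the free algebra; only t^2 = -q
  and t being nonzero enter.\<close>

lemma R_free_U_ideal:
  assumes "t \<noteq> 0" "t\<^sup>2 = - q" "x \<in> U_ideal q"
  shows "R_free q t x u = 0"
proof -
  let ?I = "{x. \<forall>u. R_free q t x u = 0}"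
  have t2: "1 / t\<^sup>2 = - 1 / q" "- 1 / t\<^sup>2 = 1 / q" using assms(2) by simp_all
  have "two_sided ?I"
    by (auto simp: two_sided_def intro!: pm.subspaceI)
  moreover have "R_free q t x u = 0" if "x \<in> U_rels q" for x u
    using that unfolding U_rels_def insert_iff empty_iff
    by (elim disjE; hypsubst?)
      (use R_e_f[OF assms(1), of q u] in \<open>simp_all add: R_k_ki[OF assms(1)] R_ki_e[OF assms(1)]
          R_ki_f[OF assms(1)] assms(2) algebra_simps\<close>)
  ultimately have "U_ideal q \<subseteq> ?I" unfolding U_ideal_def by (intro Idl_minimal) auto
  then show ?thesis using assms(3) by blast
qed

lemma R_free_A_ideal:
  assumes "t \<noteq> 0" "u \<in> A_ideal t"
  shows "R_free q t x u \<in> A_ideal t"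
proof -
  have "R_word q t gs u \<in> A_ideal t" if "u \<in> A_ideal t" for gs u
    using that by (induction gs arbitrary: u) (auto simp: R_gen_A_ideal assms(1))
  then show ?thesis unfolding R_free_def lext_def
    by (intro pm.subspace_sum pm.subspace_scale subspace_A) (use assms(2) in blast)
qed

lemma lin_ext_contrL:
  assumes "linf \<psi>"
  shows "lin_ext (\<lambda>(v, w). \<phi> v * \<psi> (single w 1)) D = \<psi> (contrL \<phi> D)"
  by (rule hom_eqI[OF linf_lin_ext lin_comp[OF lin_contrL assms]])
    (use module_hom.scale[OF assms, of "\<phi> _" "single _ 1"] in \<open>simp add: contrL_def split:
        prod.split\<close>)

text \<open>Pairing with a product contracts one leg of an iterated coproduct per factor, and the
  empty word evaluates the counit on what is left. Hence the pairing is the counit after the right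
  action.\<close>

lemma pair_word_R: "pair_word q t gs u = char_ext counit_gen (R_word q t gs u)"
proof (induction gs arbitrary: u)
  case (Cons g gs)
  have l: "linf (\<lambda>u. char_ext counit_gen (R_word q t gs u))"
  proof -
    have "lin (R_word q t gs)" 
      by (induction gs) (auto simp: lin_id intro: lin_comp lin_R_gen)
    then show ?thesis by (rule lin_comp[OF _ linf_lin_ext])
  qed
  show ?case using lin_ext_contrL[OF l, of "ugen_word q t g" "free_comult u"]
    by (simp add: Cons R_gen_def)
qed simp

lemma free_pair_R: "free_pair q t x u = char_ext counit_gen (R_free q t x u)"
  unfolding free_pair_def pair_word_R
  by (rule hom_eqI[OF linf_lin_ext lin_comp[OF lin_R_free_left linf_lin_ext]]) (simp add:
      R_free_def)

lemma U_quot: "quot (U_ideal q)"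
  using two_sided_Idl[of "U_rels q"] by (auto simp: quot_def U_ideal_def two_sided_def)

lemma in_U_proj: "y \<in> U_proj q x \<longleftrightarrow> y - x \<in> U_ideal q"
  using quot.in_proj[OF U_quot, of y "(*)" 1 q x]
  by (simp add: U_proj_def quot.proj_def[OF U_quot] free_alg_mod_alg)

lemma pair_proj:
  assumes "t \<noteq> 0" "t\<^sup>2 = - q"
  shows "pair q t (U_proj q x) (A_proj t u) = char_ext counit_gen (R_free q t x u)"
proof -
  have "free_pair q t x' u' = char_ext counit_gen (R_free q t x u)"
    if "x' \<in> U_proj q x" "u' \<in> A_proj t u" for x' u'
  proof -
    have "R_free q t (x' - x) u' = 0"
      using R_free_U_ideal[OF assms, of "x' - x"] that by (simp add: in_U_proj)
    moreover have "char_ext counit_gen (R_free q t x (u' - u)) = 0"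
      using functionals_A_ideal(1)[OF assms(1) R_free_A_ideal[OF assms(1), of "u' - u" q x]] that
      by (simp add: in_A_proj eqv_def)
    ultimately show ?thesis by (simp add: free_pair_R)
  qed
  moreover have "x \<in> U_proj q x" "u \<in> A_proj t u"
    using pm.subspace_0[OF quot.subsp[OF U_quot]] by (auto simp: in_U_proj in_A_proj)
  ultimately have "{free_pair q t x' u' | x' u'. x' \<in> U_proj q x \<and> u' \<in> A_proj t u} =
      {char_ext counit_gen (R_free q t x u)}"
    by (intro equalityI subsetI) (auto, metis)
  then show ?thesis by (simp add: pair_def)
qed

lemma free_comult_R_free: "free_comult (R_free q t x u) =
    tmap (R_free q t x) (\<lambda>x. x) (free_comult u)"
proof (induction x arbitrary: u rule: free_induct)
  case one
  show ?case using tns_homI[OF lin_tmap lin_id, of "\<lambda>x. x" "\<lambda>x. x" "free_comult u"]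
    by (simp add: tmap_tns[OF lin_id lin_id] R_free_1[abs_def])
next
  case (gen g x)
  have "tmap (R_free q t x) (\<lambda>x. x) (tmap (R_gen q t g) (\<lambda>x. x) D) = tmap (R_free q t (gen g *
      x)) (\<lambda>x. x) D" for D :: agen_tens
    by (rule tns_homI[OF lin_comp[OF lin_tmap lin_tmap] lin_tmap])
      (simp add: tmap_tns lin_R_gen lin_R_free lin_id)
  then show ?case by (simp only: R_free_gen_mult[of q t g x u] gen free_comult_R_gen)
next
  case (add x y)
  have "tmap (R_free q t (x + y)) (\<lambda>x. x) D = tmap (R_free q t x) (\<lambda>x. x) D +
      tmap (R_free q t y) (\<lambda>x. x) D" for D :: agen_tens
    by (rule tns_homI[OF lin_tmap lin_add[OF lin_tmap lin_tmap]])
      (simp add: tmap_tns lin_R_free lin_id tns_simps)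
  moreover have "free_comult (R_free q t (x + y) u) =
      free_comult (R_free q t x u) + free_comult (R_free q t y u)" by simp
  ultimately show ?case by (simp only: add)
next
  case (scal z x)
  have "tmap (R_free q t (scal z x)) (\<lambda>x. x) D = scal z (tmap (R_free q t x) (\<lambda>x. x) D)" for D ::
      agen_tens
    by (rule tns_homI[OF lin_tmap lin_scal[OF lin_tmap]])
      (simp add: tmap_tns lin_R_free lin_id tns_simps)
  moreover have "free_comult (R_free q t (scal z x) u) = scal z (free_comult (R_free q t x u))" by
      simp
  ultimately show ?case by (simp only: scal)
qed

text \<open>The left side is the defining formula of the right action, with the pairing written as
  the counit after R. The compatibility of R with the coproduct and the counit axiom reduce it to
  \<open>R_free\<close>.\<close>

lemma contrL_R_free: "contrL (\<lambda>w. char_ext counit_gen (R_free q t x (single w 1))) (free_comult u) = R_free q t x u"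
proof -
  have "contrL (\<lambda>w. char_ext counit_gen (R_free q t x (single w 1))) D =
      contrL counit (tmap (R_free q t x) (\<lambda>x. x) D)" for D :: agen_tens
    by (rule tns_homI[OF lin_contrL lin_comp[OF lin_tmap lin_contrL]])
      (simp add: contrL_tns tmap_tns[OF lin_R_free lin_id] lin_ext_comp[OF lin_comp[OF lin_R_free
          linf_lin_ext]])
  then show ?thesis by (simp only: free_comult_R_free[symmetric] contrL_counit)
qed

text \<open>The bridge from cosets to representatives. The choice of D is immaterial because the
  pairing with x kills \<open>A_ideal\<close>, so the contraction maps \<open>AA_ideal\<close> into
  \<open>A_ideal\<close>.\<close>

lemma R_act_proj:
  assumes "t \<noteq> 0" "t\<^sup>2 = - q"
  shows "R_act q t (U_proj q x) (A_proj t u) = A_proj t (R_free q t x u)"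
proof -
  let ?\<phi> = "\<lambda>w. char_ext counit_gen (R_free q t x (single w 1))"
  have "(\<Oplus>\<^bsub>Aq t\<^esub>p\<in>keys D.
        (lookup D p * pair q t (U_proj q x) (A_proj t (single (fst p) 1)))
          \<odot>\<^bsub>Aq t\<^esub> A_proj t (single (snd p) 1)) = A_proj t (R_free q t x u)"
    if "D \<in> comult t (A_proj t u)" for D
  proof -
    have "contrL ?\<phi> D = (\<Sum>p\<in>keys D. scal (lookup D p * ?\<phi> (fst p)) (single (snd p) 1))"
      unfolding contrL_def lext_def by (intro sum.cong) (auto split: prod.split)
    then have "(\<Oplus>\<^bsub>Aq t\<^esub>p\<in>keys D.
        (lookup D p * pair q t (U_proj q x) (A_proj t (single (fst p) 1)))
          \<odot>\<^bsub>Aq t\<^esub> A_proj t (single (snd p) 1)) = A_proj t (contrL ?\<phi> D)"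
      by (simp only: pair_proj[OF assms] smult_Aq finsum_Aq finite_keys)
    also have "\<dots> = A_proj t (contrL ?\<phi> (free_comult u))"
    proof -
      have "D - free_comult u \<in> AA_ideal t" using that by (simp add: comult_A_proj assms in_AA_proj)
      then have "contrL ?\<phi> (D - free_comult u) \<in> A_ideal t"
      proof (rule AA_image[OF lin_contrL subspace_A, rotated])
        fix x' y assume "x' \<in> A_ideal t \<or> y \<in> A_ideal t"
        then show "contrL ?\<phi> (tns x' y) \<in> A_ideal t"
          using functionals_A_ideal(1)[OF assms(1) R_free_A_ideal[OF assms(1), of x' q x]]
          by (auto simp: contrL_tns lin_ext_comp[OF lin_comp[OF lin_R_free linf_lin_ext]]
              intro: pm.subspace_scale[OF subspace_A] pm.subspace_0[OF subspace_A])
      qed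
      then show ?thesis by (simp add: A_proj_eq eqv_def contrL_simps)
    qed
    finally show ?thesis by (simp add: contrL_R_free)
  qed
  moreover have "free_comult u \<in> comult t (A_proj t u)"
    using pm.subspace_0[OF subspace_AA] by (simp add: comult_A_proj assms in_AA_proj)
  ultimately have "{\<Oplus>\<^bsub>Aq t\<^esub>p\<in>keys D.
        (lookup D p * pair q t (U_proj q x) (A_proj t (single (fst p) 1)))
          \<odot>\<^bsub>Aq t\<^esub> A_proj t (single (snd p) 1) | D. D \<in> comult t (A_proj t u)} =
      {A_proj t (R_free q t x u)}"
    by blast
  then show ?thesis by (simp add: R_act_def)
qed

section \<open>Matrix elements\<close>

lemma contrR_tmap:
  assumes "lin f"
  shows "contrR \<psi> (tmap f (\<lambda>x. x) D) = f (contrR \<psi> D)"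
  by (rule tns_homI[OF lin_comp[OF lin_tmap lin_contrR] lin_comp[OF lin_contrR assms]])
    (simp add: tmap_tns[OF assms lin_id] contrR_tns module_hom.scale[OF assms])

lemmas contrR_simps =
  hom_rules[OF lin_contrR] module_hom.sum[OF lin_contrR]

definition eqvT :: "complex \<Rightarrow> agen_tens \<Rightarrow> agen_tens \<Rightarrow> bool" where
  "eqvT t X Y \<longleftrightarrow> X - Y \<in> AA_ideal t"

lemma eqvT_refl [simp]: "eqvT t x x"
  using pm.subspace_0[OF subspace_AA] by (simp add: eqvT_def)

lemma eqvT_trans [trans]: "eqvT t x y \<Longrightarrow> eqvT t y z \<Longrightarrow> eqvT t x z"
  using pm.subspace_add[OF subspace_AA, of "x - y" _ "y - z"] by (simp add: eqvT_def)

lemma eqvT_add: "eqvT t x y \<Longrightarrow> eqvT t x' y' \<Longrightarrow> eqvT t (x + x') (y + y')"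
  using pm.subspace_add[OF subspace_AA, of "x - y" _ "x' - y'"] by (simp add: eqvT_def
      algebra_simps)

lemma eqvT_sum: "(\<And>i. i \<in> I \<Longrightarrow> eqvT t (f i) (g i)) \<Longrightarrow> eqvT t (sum f I) (sum g I)"
  by (induction I rule: infinite_finite_induct) (auto intro: eqvT_add)

lemma eqvT_mult_left: "eqvT t x y \<Longrightarrow> eqvT t (tens_mult z x) (tens_mult z y)"
  using tens_mult_AA_left[of "x - y" t z] by (simp add: eqvT_def)

lemma eqvT_mult_right: "eqvT t x y \<Longrightarrow> eqvT t (tens_mult x z) (tens_mult y z)"
  using tens_mult_AA_right[of "x - y" t z] by (simp add: eqvT_def)

lemma eqvT_tns: "eqv t x x' \<Longrightarrow> eqv t y y' \<Longrightarrow> eqvT t (tns x y) (tns x' y')"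
proof -
  assume "eqv t x x'" "eqv t y y'"
  then have "tns (x - x') y + tns x' (y - y') \<in> AA_ideal t"
    by (intro pm.subspace_add[OF subspace_AA] tns_in_AA) (auto simp: eqv_def)
  then show ?thesis by (simp add: eqvT_def tns_simps)
qed

lemma tens_mult_sum_right: "tens_mult X (sum f I) = (\<Sum>i\<in>I. tens_mult X (f i))"
  and tens_mult_sum_left: "tens_mult (sum f I) X = (\<Sum>i\<in>I. tens_mult (f i) X)"
  by (rule module_hom.sum[OF lin_tens_mult_right] module_hom.sum[OF lin_tens_mult_left])+

text \<open>Since sigma is even and grouplike, no sign arises and both legs are simply multiplied by
  sigma^s.\<close>

lemma tns_sigma_power: "tens_mult (tns x y) (free_comult (gen Gs ^ s)) = tns (x * gen Gs ^ s) (y *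
    gen Gs ^ s)"
proof (induction s arbitrary: x y)
  case 0
  show ?case using tens_mult_tns_right[of "tns x y" "Word []" 1]
    by (simp add: one_free[symmetric] word_parity_def tmap_tns lin_id)
next
  case (Suc s)
  have "tens_mult (tns x y) (tns (gen Gs) (gen Gs)) = tns (x * gen Gs) (y * gen Gs)"
    using tens_mult_tns_right[of "tns x y" "Word [Gs]" "gen Gs"]
    by (simp add: gen_def[symmetric] word_parity_def tmap_tns lin_mult_right)
  then show ?case
    using Suc[of "x * gen Gs" "y * gen Gs"]
    by (simp add: free_comult_mult tens_mult_assoc[symmetric] tens_eq_tns mult.assoc)
qed

section \<open>Degree filtration and coproducts of the comodule basis\<close>

definition words_upto :: "nat \<Rightarrow> agen free set" where
  "words_upto n = pm.span {single (Word gs) 1 | gs. length (filter (\<lambda>g. g \<noteq> Gs) gs) \<le> n}"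

lemma subspace_words_upto: "pm.subspace (words_upto n)"
  unfolding words_upto_def by (rule pm.subspace_span)

lemma words_upto_image:
  assumes "lin h" "pm.subspace W" "x \<in> words_upto n"
    and "\<And>gs. length (filter (\<lambda>g. g \<noteq> Gs) gs) \<le> n \<Longrightarrow> h (single (Word gs) 1) \<in> W"
  shows "h x \<in> W"
proof -
  have "words_upto n \<subseteq> {x. h x \<in> W}"
    unfolding words_upto_def by (rule pm.span_minimal) (use assms in \<open>auto intro: subspace_vimage\<close>)
  then show ?thesis using assms(3) by blast
qed

lemma words_upto_single: "length (filter (\<lambda>g. g \<noteq> Gs) gs) \<le> n \<Longrightarrow> single (Word gs) 1 \<in> words_upto n"
  unfolding words_upto_def by (rule pm.span_base) blast

lemma words_upto_twist: "x \<in> words_upto n \<Longrightarrow> twist p x \<in> words_upto n"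
proof (rule words_upto_image[OF lin_twist subspace_words_upto])
  fix gs assume "length (filter (\<lambda>g. g \<noteq> Gs) gs) \<le> n"
  then show "twist p (single (Word gs) 1) \<in> words_upto n"
    using pm.subspace_scale[OF subspace_words_upto words_upto_single, of gs n
        "(-1) ^ (p * word_parity (Word gs))"]
    by (simp add: twist_single)
qed

lemma words_upto_gen: "x \<in> words_upto n \<Longrightarrow> gen g * x \<in> words_upto (Suc n)"
  by (rule words_upto_image[OF lin_mult_left subspace_words_upto])
    (auto simp: gen_mult_single intro!: words_upto_single)

text \<open>Letters sigma do not count, so m_ij and m_ij sigma lie in the same step of the
  filtration, as the dimension count requires.\<close>

lemma words_upto_sigma: "x \<in> words_upto n \<Longrightarrow> x * gen Gs ^ s \<in> words_upto n"
proof (induction s arbitrary: x)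
  case (Suc s)
  have "x * gen Gs \<in> words_upto n"
    by (rule words_upto_image[OF lin_mult_right subspace_words_upto Suc.prems])
      (auto simp: gen_def mult_single plus_word_def intro!: words_upto_single)
  then show ?case using Suc.IH[of "x * gen Gs"] by (simp add: mult.assoc)
qed simp

fun idx_deg :: "idx \<Rightarrow> nat" where
  "idx_deg (z, i, j, s) = nat \<bar>z\<bar> + i + j"

definition deg_upto :: "nat \<Rightarrow> (idx \<Rightarrow>\<^sub>0 complex) set" where
  "deg_upto n = pm.span {single k 1 | k. idx_deg k \<le> n}"

lemma deg_upto_single: "idx_deg k \<le> n \<Longrightarrow> single k c \<in> deg_upto n"
proof -
  assume "idx_deg k \<le> n"
  then have "single k 1 \<in> {single k 1 | k. idx_deg k \<le> n}" by blast
  from pm.span_scale[OF pm.span_base[OF this], of c] show ?thesis by (simp add: deg_upto_def)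
qed

lemma subspace_deg_upto: "pm.subspace (deg_upto n)"
  unfolding deg_upto_def by (rule pm.subspace_span)

text \<open>Straightening ad or da yields sigma and bc, of degrees 0 and 2, so the degree never
  exceeds the number of letters other than sigma.\<close>

lemma deg_upto_gen_op:
  assumes "p \<in> deg_upto n"
  shows "lext (gen_op t g) p \<in> deg_upto (if g = Gs then n else Suc n)"
proof -
  let ?m = "if g = Gs then n else Suc n"
  have "gen_op t g k \<in> deg_upto ?m" if "idx_deg k \<le> n" for k
    using that by (cases k; cases g)
      (auto intro!: deg_upto_single pm.subspace_diff[OF subspace_deg_upto] simp: abs_if split:
          if_splits)
  then have "deg_upto n \<subseteq> {p. lext (gen_op t g) p \<in> deg_upto ?m}"
    unfolding deg_upto_def[of n]
    by (intro pm.span_minimal subspace_vimage lin_lext subspace_deg_upto) auto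
  then show ?thesis using assms by blast
qed

lemma words_upto_act: "x \<in> words_upto n \<Longrightarrow> act t x vac \<in> deg_upto n"
proof (rule words_upto_image[OF lin_act_left subspace_deg_upto])
  fix gs :: "agen list" assume n: "length (filter (\<lambda>g. g \<noteq> Gs) gs) \<le> n"
  have "act t (single (Word gs) 1) vac \<in> deg_upto (length (filter (\<lambda>g. g \<noteq> Gs) gs))"
  proof (induction gs)
    case Nil
    show ?case by (simp add: one_free[symmetric] deg_upto_single)
  next
    case (Cons g gs)
    have "single (Word (g # gs)) 1 = gen g * single (Word gs) (1 :: complex)"
      by (simp add: gen_mult_single)
    then show ?case using deg_upto_gen_op[OF Cons, of t g] by (simp add: act_gen_mult split:
        if_splits)
  qed
  moreover have "deg_upto m \<subseteq> deg_upto n" if "m \<le> n" for m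
    unfolding deg_upto_def by (rule pm.span_mono) (use that order_trans in blast)
  ultimately show "act t (single (Word gs) 1) vac \<in> deg_upto n" using n by blast
qed

text \<open>The vector xi_(i-l) sigma^s for n = 2l without its normalising scalar. Natural indices
  cover integral and half-integral spins alike.\<close>

definition zeta :: "nat \<Rightarrow> nat \<Rightarrow> nat \<Rightarrow> agen free" where
  "zeta n i s = gen Ga ^ (n - i) * (gen Gc ^ i * gen Gs ^ s)"

lemma act_zeta: "act t (zeta n i s) vac = single (int (n - i), 0, i, odd s) 1"
proof -
  have s: "act t (gen Gs ^ s) vac = single (0, 0, 0, odd s) 1"
    by (induction s) simp_all
  have c: "act t (gen Gc ^ i) (single (0, 0, 0, b) 1) = single (0, 0, i, b) 1" for b
    by (induction i) (simp_all add: comm_factor_def)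
  have a: "act t (gen Ga ^ m) (single (0, 0, i, b) 1) = single (int m, 0, i, b) 1" for b m
    by (induction m) (simp_all add: add.commute)
  show ?thesis by (simp add: zeta_def s c a)
qed

text \<open>For g = a or c the coproduct is g (x) a + h (x) c with h = b or d. The summand with a
  keeps r; the one with c raises r after c has moved past a^(n-r), and the parity of c puts
  \<open>twist 1\<close> on the first leg. The case distinctions suppress the coefficients r = n + 1
  of the first sum and r = 0 of the second.\<close>

lemma comult_expand_step:
  assumes t: "t \<noteq> 0"
    and g: "comult_gen g = tns (gen g) (gen Ga) + tns (gen h) (gen Gc)"
    and M: "eqvT t (free_comult x) (\<Sum>r\<le>n. tns (M r) (zeta n r 0))"
  shows "eqvT t (free_comult (gen g * x))
    (\<Sum>r\<le>Suc n. tns ((if r \<le> n then gen g * M r else 0) +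
       (if r = 0 then 0 else scal ((1 / t) ^ (n - (r - 1))) (gen h * twist 1 (M (r - 1))))) (zeta
           (Suc n) r 0))"
proof -
  have z: "gen Ga * zeta n r 0 = zeta (Suc n) r 0" if "r \<le> n" for r
    using that by (simp add: zeta_def mult.assoc Suc_diff_le)
  have cz: "eqv t (gen Gc * zeta n r 0) (scal ((1 / t) ^ (n - r)) (zeta (Suc n) (Suc r) 0))" for r
    using eqv_subst(2)[OF eqv_comm_power[OF eqv_ca[OF t], of "n - r"], of "gen Gc ^ r"]
    by (simp add: zeta_def mult.assoc)
  have "eqvT t (free_comult (gen g * x)) (tens_mult (comult_gen g) (\<Sum>r\<le>n. tns (M r) (zeta n r 0)))"
    unfolding free_comult_gen_mult by (rule eqvT_mult_left[OF M])
  also have "\<dots> = (\<Sum>r\<le>n. tns (gen g * M r) (gen Ga * zeta n r 0)) +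
      (\<Sum>r\<le>n. tns (gen h * twist 1 (M r)) (gen Gc * zeta n r 0))"
    by (simp add: g tens_mult_sum_right sum.distrib)
  also have "eqvT t \<dots> ((\<Sum>r\<le>n. tns (gen g * M r) (zeta (Suc n) r 0)) +
      (\<Sum>r\<le>n. tns (gen h * twist 1 (M r)) (scal ((1 / t) ^ (n - r)) (zeta (Suc n) (Suc r) 0))))"
    by (intro eqvT_add eqvT_sum eqvT_tns cz eqv_refl) (simp add: z)
  also have "\<dots> = (\<Sum>r\<le>Suc n. tns (if r \<le> n then gen g * M r else 0) (zeta (Suc n) r 0)) +
      (\<Sum>r\<le>Suc n. tns (if r = 0 then 0 else scal ((1 / t) ^ (n - (r - 1))) (gen h * twist 1 (M (r -
          1)))) (zeta (Suc n) r 0))"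
    by (subst (2) sum.atMost_Suc_shift) (simp add: tns_simps)
  finally show ?thesis by (simp only: tns_add_left sum.distrib)
qed

text \<open>The coefficients M serve every s at once, as the single family required by
  \<open>is_mat_elems\<close> does. Their degree bound feeds the dimension count.\<close>

lemma comult_expand:
  assumes t: "t \<noteq> 0" and "i \<le> n"
  obtains M where "\<And>r. M r \<in> words_upto n"
    "\<And>s. eqvT t (free_comult (zeta n i s)) (\<Sum>r\<le>n. tns (M r * gen Gs ^ s) (zeta n r s))"
proof -
  let ?P = "\<lambda>n x. \<exists>M. (\<forall>r. M r \<in> words_upto n) \<and>
      eqvT t (free_comult x) (\<Sum>r\<le>n. tns (M r) (zeta n r 0))"
  have step: "?P (Suc n) (gen g * x)" if "?P n x" "g = Ga \<or> g = Gc" for n g x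
  proof -
    from that(1) obtain M where M: "\<forall>r. M r \<in> words_upto n"
        "eqvT t (free_comult x) (\<Sum>r\<le>n. tns (M r) (zeta n r 0))"
      by blast
    from that(2) obtain h where h: "comult_gen g = tns (gen g) (gen Ga) + tns (gen h) (gen Gc)"
      by (metis comult_gen.simps(1,3) tens_eq_tns)
    let ?M = "\<lambda>r. (if r \<le> n then gen g * M r else 0) +
       (if r = 0 then 0 else scal ((1 / t) ^ (n - (r - 1))) (gen h * twist 1 (M (r - 1))))"
    have "?M r \<in> words_upto (Suc n)" for r
      using M(1) by (intro pm.subspace_add[OF subspace_words_upto])
        (auto intro!: words_upto_gen words_upto_twist pm.subspace_0[OF subspace_words_upto]
          pm.subspace_scale[OF subspace_words_upto])
    then show ?thesis using comult_expand_step[OF t h M(2)] by (intro exI[of _ ?M]) blast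
  qed
  have 0: "?P 0 1"
    using words_upto_single[of "[]" 0]
    by (intro exI[of _ "\<lambda>_. 1"]) (simp add: zeta_def one_free[symmetric])
  have c: "?P i (gen Gc ^ i)" for i by (induction i) (use 0 step in auto)
  have "?P (m + i) (gen Ga ^ m * gen Gc ^ i)" for m
    by (induction m) (use c step in \<open>auto simp: mult.assoc\<close>)
  from this[of "n - i"] \<open>i \<le> n\<close> obtain M where M: "\<forall>r. M r \<in> words_upto n"
      "eqvT t (free_comult (gen Ga ^ (n - i) * gen Gc ^ i)) (\<Sum>r\<le>n. tns (M r) (zeta n r 0))"
    by auto
  have "eqvT t (free_comult (zeta n i s)) (\<Sum>r\<le>n. tns (M r * gen Gs ^ s) (zeta n r s))" for s
    using eqvT_mult_right[OF M(2), of "free_comult (gen Gs ^ s)"]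
    by (simp add: free_comult_mult[symmetric] tens_mult_sum_left tns_sigma_power zeta_def
        mult.assoc)
  with M(1) show ?thesis using that by blast
qed

text \<open>Gaussian binomials through the Pascal rule in exactly the shape that
  \<open>comult_expand_step\<close> produces.\<close>

fun gauss_binom :: "complex \<Rightarrow> nat \<Rightarrow> nat \<Rightarrow> complex" where
  "gauss_binom v 0 r = (if r = 0 then 1 else 0)"
| "gauss_binom v (Suc n) r = (if r \<le> n then gauss_binom v n r else 0) + (if r =
    0 then 0 else v ^ (n - (r - 1)) * gauss_binom v n (r - 1))"

lemma qpoch_Suc: "qpoch u v (Suc m) = qpoch u v m * (1 - u * v ^ m)"
  by (simp add: qpoch_def)

text \<open>With the denominators cleared this holds for every v. The induction adds the two Pascal
  terms by 1 - v^(k+1) + v^(k+1) (1 - v^(m+1)) = 1 - v^(n+1), where n = m + k + 1.\<close>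

lemma gauss_binom_qpoch: "r \<le> n \<Longrightarrow> gauss_binom v n r * (qpoch v v r * qpoch v v (n - r)) =
    qpoch v v n"
proof (induction n arbitrary: r)
  case 0
  then show ?case by (simp add: qpoch_def)
next
  case (Suc n)
  consider "r = 0" | "r = Suc n" | m where "r = Suc m" "m < n"
    using Suc.prems by (cases r) (auto simp: le_less)
  then show ?case
  proof cases
    case 1
    then show ?thesis using arg_cong[OF Suc.IH[of 0], of "\<lambda>x. x * (1 - v * v ^ n)"]
      by (simp add: qpoch_Suc mult.assoc)
  next
    case 2
    then show ?thesis using arg_cong[OF Suc.IH[of n], of "\<lambda>x. x * (1 - v * v ^ n)"]
      by (simp add: qpoch_Suc mult_ac)
  next
    case 3
    obtain k where k: "n - m = Suc k" "n - Suc m = k" using \<open>m < n\<close> by (metis Suc_diff_Suc)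
    have n: "n = Suc (m + k)" using k \<open>m < n\<close> by simp
    have e1: "gauss_binom v n (Suc m) * (qpoch v v (Suc m) * qpoch v v k) = qpoch v v n"
      using Suc.IH[of "Suc m"] \<open>m < n\<close> k by simp
    have e2: "gauss_binom v n m * (qpoch v v m * qpoch v v (Suc k)) = qpoch v v n"
      using Suc.IH[of m] \<open>m < n\<close> k by simp
    have "gauss_binom v (Suc n) r * (qpoch v v r * qpoch v v (Suc n - r)) =
      gauss_binom v n (Suc m) * (qpoch v v (Suc m) * qpoch v v k) * (1 - v ^ Suc k) +
      v ^ Suc k * (1 - v ^ Suc m) * (gauss_binom v n m * (qpoch v v m * qpoch v v (Suc k)))"
      using 3 k by (simp add: qpoch_Suc algebra_simps)
    also have "\<dots> = qpoch v v n * (1 - v ^ Suc k + v ^ Suc k * (1 - v ^ Suc m))"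
      unfolding e1 e2 by (simp add: algebra_simps)
    also have "1 - v ^ Suc k + v ^ Suc k * (1 - v ^ Suc m) = 1 - v * v ^ n"
      by (simp add: n algebra_simps power_add)
    finally show ?thesis by (simp add: qpoch_Suc)
  qed
qed

text \<open>The base t^-2 has two sources: moving c past a^k gives t^-k, and moving d past c^k gives
  (-1/t)^k, whose sign cancels against the graded sign (-1)^k of c^k.\<close>

lemma comult_c_power:
  assumes t: "t \<noteq> 0"
  shows "eqvT t (free_comult (gen Gc ^ n))
    (\<Sum>r\<le>n. tns (scal (gauss_binom (1 / t\<^sup>2) n r) (gen Gc ^ (n - r) * gen Gd ^ r)) (zeta n r 0))"
proof (induction n)
  case 0
  show ?case by (simp add: zeta_def)
next
  case (Suc n)
  let ?M = "\<lambda>n r. scal (gauss_binom (1 / t\<^sup>2) n r) (gen Gc ^ (n - r) * gen Gd ^ r)"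
  let ?M' = "\<lambda>r. (if r \<le> n then gen Gc * ?M n r else 0) +
       (if r = 0 then 0 else scal ((1 / t) ^ (n - (r - 1))) (gen Gd * twist 1 (?M n (r - 1))))"
  have dc: "eqv t (gen Gd * gen Gc) (scal (- (1 / t)) (gen Gc * gen Gd))"
    using eqv_scal_flip[OF _ eqv_cd[OF t]] t by simp
  have tw: "twist 1 (gen Gc ^ k * gen Gd ^ r) = scal ((-1) ^ k) (gen Gc ^ k * gen Gd ^ r)" for k r
  proof -
    have "twist 1 (gen Gd ^ r) = gen Gd ^ r" by (induction r) simp_all
    moreover have "twist 1 (gen Gc ^ k) = scal ((-1) ^ k) (gen Gc ^ k)" by (induction k) simp_all
    ultimately show ?thesis by simp
  qed
  have e: "eqv t (scal ((1 / t) ^ k) (gen Gd * twist 1 (scal z (gen Gc ^ k * gen Gd ^ r))))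
      (scal ((1 / t\<^sup>2) ^ k * z) (gen Gc ^ k * gen Gd ^ Suc r))" for k r z
  proof -
    have "scal ((1 / t) ^ k) (gen Gd * twist 1 (scal z (gen Gc ^ k * gen Gd ^ r))) =
      scal ((1 / t) ^ k * z * (-1) ^ k) (gen Gd * (gen Gc ^ k * gen Gd ^ r))"
      unfolding module_hom.scale[OF lin_twist] tw by (simp add: mult_ac)
    also have "eqv t \<dots> (scal ((1 / t) ^ k * z * (-1) ^ k) (scal ((- (1 / t)) ^ k) (gen Gc ^ k *
        (gen Gd * gen Gd ^ r))))"
      using eqv_scal[OF eqv_subst(2)[OF eqv_comm_power[OF dc, of k], of "gen Gd ^ r"]] by (simp
          only: mult.assoc)
    also have "\<dots> = scal ((1 / t\<^sup>2) ^ k * z) (gen Gc ^ k * gen Gd ^ Suc r)"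
    proof -
      have "(1 / t) ^ k * z * (-1) ^ k * (- (1 / t)) ^ k = (1 / t\<^sup>2) ^ k * z"
        by (simp add: power_mult_distrib[symmetric] power2_eq_square)
      then show ?thesis by simp
    qed
    finally show ?thesis .
  qed
  have "eqv t (?M' r) (?M (Suc n) r)" if "r \<le> Suc n" for r
  proof -
    have "eqv t (?M' r) ((if r \<le> n then scal (gauss_binom (1 / t\<^sup>2) n r) (gen Gc ^ (Suc n - r) *
        gen Gd ^ r) else 0) +
       (if r = 0 then 0 else scal ((1 / t\<^sup>2) ^ (n - (r - 1)) * gauss_binom (1 / t\<^sup>2) n (r - 1))
           (gen Gc ^ (n - (r - 1)) * gen Gd ^ Suc (r - 1))))"
    proof (intro eqv_add)
      show "eqv t (if r \<le> n then gen Gc * ?M n r else 0)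
          (if r \<le> n then scal (gauss_binom (1 / t\<^sup>2) n r) (gen Gc ^ (Suc n - r) * gen Gd ^ r) else
              0)"
        by (simp add: Suc_diff_le mult.assoc)
    qed (use e[of "n - (r - 1)" _ "r - 1"] in \<open>auto simp del: twist_simps twist_mult power_Suc\<close>)
    also have "\<dots> = ?M (Suc n) r"
      using that by (cases r) (auto simp: pm.scale_left_distrib)
    finally show ?thesis .
  qed
  then have "eqvT t (\<Sum>r\<le>Suc n. tns (?M' r) (zeta (Suc n) r 0)) (\<Sum>r\<le>Suc n. tns (?M (Suc n) r) (zeta (Suc n) r 0))"
    by (intro eqvT_sum eqvT_tns eqv_refl) auto
  moreover have "comult_gen Gc = tns (gen Gc) (gen Ga) + tns (gen Gd) (gen Gc)" by (simp add:
      tens_eq_tns)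
  ultimately show ?case using eqvT_trans[OF comult_expand_step[OF t _ Suc]] by simp
qed

text \<open>The coefficient of a^(n-j) c^j sigma^s in the normal form. By \<open>act_zeta\<close> it
  is dual to the vectors \<open>zeta\<close>, and it vanishes on the ideal.\<close>

definition coord :: "complex \<Rightarrow> nat \<Rightarrow> nat \<Rightarrow> nat \<Rightarrow> agen word \<Rightarrow> complex" where
  "coord t n s j w = lookup (act t (single w 1) vac) (int (n - j), 0, j, odd s)"

text \<open>The matrix element m_ij sigma^s of the unnormalised basis \<open>zeta\<close>. The
  factor sigma^s is built in, so a single index (n, s, i, j) covers both summands of the
  decomposition of A.\<close>

definition mel :: "complex \<Rightarrow> nat \<Rightarrow> nat \<Rightarrow> nat \<Rightarrow> nat \<Rightarrow> agen free" where
  "mel t n s i j = contrR (coord t n s j) (free_comult (zeta n i s))"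

lemma lin_ext_coord: "lin_ext (coord t n s j) u = lookup (act t u vac) (int (n - j), 0, j, odd s)"
proof -
  have "linf (\<lambda>u. lookup (act t u vac) (int (n - j), 0, j, odd s))"
    by (rule linfI) (simp_all add: lookup_add)
  from lin_ext_comp[OF this, of u] show ?thesis by (simp only: coord_def[abs_def])
qed

locale osp =
  fixes q t :: complex
  assumes t0: "t \<noteq> 0" and t2: "t\<^sup>2 = - q" and q_root: "\<And>n. n > 0 \<Longrightarrow> q ^ n \<noteq> 1"
begin

text \<open>Squaring removes the sign in t^2 = -q: (t^2)^n = 1 would give q^(2n) = 1.\<close>

lemma t2_root: "n > 0 \<Longrightarrow> (t\<^sup>2) ^ n \<noteq> 1"
proof
  assume n: "n > 0" and "(t\<^sup>2) ^ n = 1"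
  moreover have "q ^ (2 * n) = ((- q) ^ n)\<^sup>2"
    using power_even_eq[of "- q" n] by simp
  ultimately show False using q_root[of "2 * n"] by (simp add: t2)
qed

lemma eqvT_contrR: 
  assumes "eqvT t X Y"
  shows "eqv t (contrR (coord t n s j) X) (contrR (coord t n s j) Y)"
proof -
  have "contrR (coord t n s j) (X - Y) \<in> A_ideal t"
  proof (rule AA_image[OF lin_contrR subspace_A _ assms[unfolded eqvT_def]])
    fix x y assume "x \<in> A_ideal t \<or> y \<in> A_ideal t"
    then show "contrR (coord t n s j) (tns x y) \<in> A_ideal t"
      by (auto simp: contrR_tns lin_ext_coord A_ideal_iff[OF t0])
  qed
  then show ?thesis by (simp add: eqv_def contrR_simps)
qed

lemma eqv_comult: "eqv t x y \<Longrightarrow> eqvT t (free_comult x) (free_comult y)"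
  using free_comult_A_ideal[OF t0, of "x - y"] by (simp add: eqv_def eqvT_def)

lemma contrR_expansion:
  assumes "eqvT t X (\<Sum>r\<le>n. tns (M r) (zeta n r s))" "j \<le> n"
  shows "eqv t (contrR (coord t n s j) X) (M j)"
proof -
  have "contrR (coord t n s j) (\<Sum>r\<le>n. tns (M r) (zeta n r s)) = (\<Sum>r\<le>n. if r = j then M j else 0)"
    unfolding contrR_simps
    by (intro sum.cong refl) (auto simp: contrR_tns lin_ext_coord act_zeta lookup_single when_def)
  also have "\<dots> = M j" using assms(2) by simp
  finally show ?thesis using eqvT_contrR[OF assms(1), of n s j] by simp
qed

lemma R_free_mel:
  assumes "eqv t (R_free q t x (zeta n i s)) (\<Sum>k\<le>n. scal (\<rho> k) (zeta n k s))"
  shows "eqv t (R_free q t x (mel t n s i j)) (\<Sum>k\<le>n. scal (\<rho> k) (mel t n s k j))"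
proof -
  have "R_free q t x (mel t n s i j) =
      contrR (coord t n s j) (free_comult (R_free q t x (zeta n i s)))"
    by (simp only: mel_def free_comult_R_free contrR_tmap[OF lin_R_free])
  also have "eqv t \<dots> (contrR (coord t n s j) (free_comult (\<Sum>k\<le>n. scal (\<rho> k) (zeta n k s))))"
    by (intro eqvT_contrR eqv_comult assms)
  also have "\<dots> = (\<Sum>k\<le>n. scal (\<rho> k) (mel t n s k j))"
    by (simp add: module_hom.sum[OF lin_free_comult] contrR_simps mel_def)
  finally show ?thesis .
qed

subsection \<open>The action on the basis of a comodule\<close>

definition k_coef :: "nat \<Rightarrow> nat \<Rightarrow> nat \<Rightarrow> complex" where
  "k_coef n s i = t ^ (n - i) * (- (1 / t)) ^ i * (-1) ^ s"

lemma R_k_power: "R_gen q t Gk (gen g ^ m * x) = scal (k_weight t g ^ m) (gen g ^ m *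
    R_gen q t Gk x)"
  and R_ki_power: "R_gen q t Gki (gen g ^ m * x) = scal ((1 / k_weight t g) ^ m) (gen g ^ m *
      R_gen q t Gki x)"
  by (induction m) (simp_all add: mult.assoc)

lemma R_k_sigma: "R_gen q t Gk (gen Gs ^ s) = scal ((-1) ^ s) (gen Gs ^ s)"
  and R_ki_sigma: "R_gen q t Gki (gen Gs ^ s) = scal ((-1) ^ s) (gen Gs ^ s)"
  using R_k_power[of Gs s 1] R_ki_power[of Gs s 1] by simp_all

lemma R_k_zeta: "R_gen q t Gk (zeta n i s) = scal (k_coef n s i) (zeta n i s)"
  by (simp add: zeta_def R_k_power R_k_sigma k_coef_def mult.assoc)

lemma R_e_c: "R_gen q t Ge (gen Gc ^ i * gen Gs ^ s) = 0"
proof -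
  have "R_gen q t Ge (gen Gs ^ s) = 0" by (induction s) simp_all
  then show ?thesis by (induction i) (simp_all add: mult.assoc)
qed

text \<open>The quantum integer (t^m - t^-m)/(t - t^-1) times e(b), in the recursive form given by
  the Leibniz rule on a^m; the closed form comes next.\<close>

fun e_coef :: "nat \<Rightarrow> complex" where
  "e_coef 0 = 0"
| "e_coef (Suc m) = e_val q t * (1 / t) ^ m + t * e_coef m"

lemma e_coef_closed: "e_coef m * t ^ m * (t\<^sup>2 - 1) = e_val q t * t * ((t\<^sup>2) ^ m - 1)"
proof (induction m)
  case (Suc m)
  have "(1 / t) ^ m * t ^ m = 1" using t0 by (simp add: power_mult_distrib[symmetric])
  then have "e_coef (Suc m) * t ^ Suc m * (t\<^sup>2 - 1) =
      e_val q t * t * (t\<^sup>2 - 1) + t\<^sup>2 * (e_coef m * t ^ m * (t\<^sup>2 - 1))"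
    by (simp add: algebra_simps power2_eq_square)
  then show ?case unfolding Suc.IH by (simp add: algebra_simps)
qed simp

lemma e_val_nz: "e_val q t \<noteq> 0"
proof -
  have "t\<^sup>2 \<noteq> 1" using t2_root[of 1] by simp
  moreover have "q\<^sup>2 \<noteq> 1" using q_root[of 2] by simp
  moreover have "q \<noteq> 0" using t0 t2 by auto
  ultimately show ?thesis using t0 by (auto simp: e_val_def field_simps power2_eq_square)
qed

lemma e_coef_nz:
  assumes "m > 0"
  shows "e_coef m \<noteq> 0"
proof
  assume "e_coef m = 0"
  then have "e_val q t * t * ((t\<^sup>2) ^ m - 1) = 0" using e_coef_closed[of m] by simp
  then show False using e_val_nz t0 t2_root[OF assms] by simp
qed

text \<open>For i = n the index i + 1 is out of range, harmlessly, because \<open>e_coef 0\<close>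
  vanishes. The recursion for \<open>e_coef\<close> comes from splitting off one a and moving the
  resulting c past the remaining powers of a.\<close>

lemma R_e_zeta: "i \<le> n \<Longrightarrow> eqv t (R_gen q t Ge (zeta n i s)) (scal (e_coef (n - i)) (zeta n (Suc i) s))"
proof -
  assume "i \<le> n"
  let ?x = "gen Gc ^ i * gen Gs ^ s"
  have "eqv t (R_gen q t Ge (gen Ga ^ m * ?x)) (scal (e_coef m) (gen Ga ^ (m - 1) * (gen Gc *
      ?x)))" for m
  proof (induction m)
    case 0
    show ?case by (simp add: R_e_c)
  next
    case (Suc m)
    have 1: "eqv t (gen Gc * (gen Ga ^ m * ?x)) (scal ((1 / t) ^ m) (gen Ga ^ m * (gen Gc * ?x)))"
      using eqv_subst(2)[OF eqv_comm_power[OF eqv_ca[OF t0], of m], of ?x] by (simp add: mult.assoc)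
    have 2: "eqv t (gen Ga * R_gen q t Ge (gen Ga ^ m * ?x)) (scal (e_coef m) (gen Ga ^ m *
        (gen Gc * ?x)))"
      using eqv_left[OF Suc, of "gen Ga"] by (cases m) (simp_all add: mult.assoc)
    have "R_gen q t Ge (gen Ga ^ Suc m * ?x) =
        scal (e_val q t) (gen Gc * (gen Ga ^ m * ?x)) + scal t (gen Ga * R_gen q t Ge (gen Ga ^ m
            * ?x))"
      by (simp add: mult.assoc)
    also have "eqv t \<dots> (scal (e_val q t) (scal ((1 / t) ^ m) (gen Ga ^ m * (gen Gc * ?x))) +
        scal t (scal (e_coef m) (gen Ga ^ m * (gen Gc * ?x))))"
      by (intro eqv_add eqv_scal 1 2)
    finally show ?case by (simp add: pm.scale_left_distrib)
  qed
  from this[of "n - i"] show ?thesis by (simp add: zeta_def mult.assoc)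
qed

text \<open>Equal to (-1)^(s+i+1) (t^i - t^-i)/(t - t^-1). The first term of the recursion carries
  the weight of c^i sigma^s under k^-1, which the rule for f(xy) inserts.\<close>

fun f_coef :: "nat \<Rightarrow> nat \<Rightarrow> complex" where
  "f_coef s 0 = 0"
| "f_coef s (Suc i) = (-1) ^ s * (- t) ^ i - f_coef s i / t"

lemma f_coef_closed: "f_coef s i * (t\<^sup>2 - 1) * t ^ i = (-1) ^ s * (-1) ^ Suc i * t *
    ((t\<^sup>2) ^ i - 1)"
proof (induction i)
  case (Suc i)
  have "f_coef s (Suc i) * (t\<^sup>2 - 1) * t ^ Suc i =
      (-1) ^ s * (-1) ^ i * t * (t\<^sup>2) ^ i * (t\<^sup>2 - 1) - f_coef s i * (t\<^sup>2 - 1) * t ^ i"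
    using t0 by (simp add: algebra_simps power_minus[of t] power2_eq_square power_mult_distrib
        diff_divide_distrib)
  then show ?case unfolding Suc.IH by (simp add: algebra_simps)
qed simp

lemma f_coef_nz:
  assumes "i > 0"
  shows "f_coef s i \<noteq> 0"
proof
  assume "f_coef s i = 0"
  then have "(-1) ^ s * (-1) ^ Suc i * t * ((t\<^sup>2) ^ i - 1) = 0" using f_coef_closed[of s i] by simp
  then show False using t0 t2_root[OF assms] by simp
qed

lemma R_f_zeta: "eqv t (R_gen q t Gf (zeta n i s)) (scal (f_coef s i) (gen Ga ^ (n - i) *
    (gen Ga * (gen Gc ^ (i - 1) * gen Gs ^ s))))"
proof -
  have s: "R_gen q t Gf (gen Gs ^ s) = 0" by (induction s) simp_all
  have a: "R_gen q t Gf (gen Ga ^ m * x) = gen Ga ^ m * R_gen q t Gf x" for m x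
    by (induction m) (simp_all add: mult.assoc)
  have c: "eqv t (R_gen q t Gf (gen Gc ^ i * gen Gs ^ s)) (scal (f_coef s i) (gen Ga *
      (gen Gc ^ (i - 1) * gen Gs ^ s)))"
  proof (induction i)
    case 0
    show ?case by (simp add: s)
  next
    case (Suc i)
    let ?x = "gen Gc ^ i * gen Gs ^ s"
    have ki: "R_gen q t Gki ?x = scal ((-1) ^ s * (- t) ^ i) ?x"
      by (simp add: R_ki_power R_ki_sigma)
    have 1: "eqv t (gen Gc * R_gen q t Gf ?x) (scal (f_coef s i / t) (gen Ga * ?x))"
    proof (cases i)
      case 0
      then show ?thesis by (simp add: s)
    next
      case (Suc i')
      have "eqv t (gen Gc * R_gen q t Gf ?x) (scal (f_coef s i) (gen Gc * (gen Ga * (gen Gc ^ i' *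
          gen Gs ^ s))))"
        using eqv_left[OF Suc.IH, of "gen Gc"] Suc by simp
      also have "eqv t \<dots> (scal (f_coef s i) (scal (1 / t) (gen Ga * (gen Gc * (gen Gc ^ i' *
          gen Gs ^ s)))))"
        using eqv_scal[OF eqv_subst(2)[OF eqv_ca[OF t0], of "gen Gc ^ i' * gen Gs ^ s"]] by (simp
            only: mult.assoc)
      finally show ?thesis using Suc by (simp add: mult.assoc)
    qed
    have "R_gen q t Gf (gen Gc ^ Suc i * gen Gs ^ s) = scal ((-1) ^ s * (- t) ^ i) (gen Ga * ?x) +
        scal (-1) (gen Gc * R_gen q t Gf ?x)"
      by (simp add: mult.assoc ki)
    also have "eqv t \<dots> (scal ((-1) ^ s * (- t) ^ i) (gen Ga * ?x) +
        scal (-1) (scal (f_coef s i / t) (gen Ga * ?x)))"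
      by (intro eqv_add eqv_scal 1 eqv_refl)
    finally show ?case by (simp add: pm.scale_left_diff_distrib)
  qed
  show ?thesis unfolding zeta_def a using eqv_left[OF c, of "gen Ga ^ (n - i)"] by simp
qed

text \<open>Since R reverses products, fk acts by f first and then by k, hence the weight of k at
  the lowered index.\<close>

definition fk_coef :: "nat \<Rightarrow> nat \<Rightarrow> nat \<Rightarrow> complex" where
  "fk_coef n s i = f_coef s i * k_coef n s (i - 1)"

lemma R_fk_zeta:
  assumes "i \<le> n"
  shows "eqv t (R_gen q t Gk (R_gen q t Gf (zeta n i s))) (scal (fk_coef n s i) (zeta n (i - 1) s))"
proof -
  have eq: "eqv t (R_gen q t Gk x) (R_gen q t Gk y)" if "eqv t x y" for x y
    using R_gen_A_ideal[OF t0, of "x - y" q Gk] that by (simp add: eqv_def)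
  show ?thesis
  proof (cases i)
    case 0
    then show ?thesis using eq[OF R_f_zeta[of n i s]] by (simp add: fk_coef_def)
  next
    case (Suc i')
    have "gen Ga ^ (n - i) * (gen Ga * (gen Gc ^ (i - 1) * gen Gs ^ s)) = zeta n i' s"
      using assms Suc Suc_diff_Suc[of i' n] power_Suc2[of "gen Ga" "n - i"]
      by (simp add: zeta_def mult.assoc[symmetric])
    then show ?thesis
      using eq[OF R_f_zeta[of n i s]] Suc by (simp add: R_k_zeta fk_coef_def)
  qed
qed

lemma k_coef_nz: "k_coef n s i \<noteq> 0"
  using t0 by (simp add: k_coef_def)

lemma fk_coef_nz: "i > 0 \<Longrightarrow> fk_coef n s i \<noteq> 0"
  by (simp add: fk_coef_def f_coef_nz k_coef_nz)

end

lemma sum_nested: "(\<Sum>(n, s, i, j)\<in>(SIGMA n:A. B \<times> C n \<times> D n). f n s i j) =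
    (\<Sum>n\<in>A. \<Sum>s\<in>B. \<Sum>i\<in>C n. \<Sum>j\<in>D n. f n s i j)"
  if "finite A" "finite B" "\<And>n. finite (C n)" "\<And>n. finite (D n)"
  using that by (simp add: sum.cartesian_product sum.Sigma split_def)

context osp
begin

subsection \<open>The matrix elements form a basis\<close>

fun mel_vec :: "nat \<times> nat \<times> nat \<times> nat \<Rightarrow> (idx \<Rightarrow>\<^sub>0 complex)" where
  "mel_vec (n, s, i, j) = act t (mel t n s i j) vac"

definition mel_index :: "nat \<Rightarrow> (nat \<times> nat \<times> nat \<times> nat) set" where
  "mel_index N = (SIGMA n:{..N}. {..<2} \<times> {..n} \<times> {..n})"

lemma finite_mel_index: "finite (mel_index N)"
  by (simp add: mel_index_def)

lemma eqv_R_e: "eqv t x y \<Longrightarrow> eqv t (R_gen q t Ge x) (R_gen q t Ge y)"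
  using R_gen_A_ideal[OF t0, of "x - y" q Ge] by (simp add: eqv_def)

lemma R_e_mel:
  assumes "i \<le> n"
  shows "eqv t (R_gen q t Ge (mel t n s i j)) (if i < n then scal (e_coef (n - i)) (mel t n s (Suc i) j) else 0)"
proof -
  have *: "(\<Sum>k\<le>n. scal (if k = Suc i then e_coef (n - i) else 0) (f k)) =
      (if i < n then scal (e_coef (n - i)) (f (Suc i)) else 0)" for f :: "nat \<Rightarrow> agen free"
  proof -
    have "(\<Sum>k\<le>n. scal (if k = Suc i then e_coef (n - i) else 0) (f k)) =
        (\<Sum>k\<le>n. if k = Suc i then scal (e_coef (n - i)) (f k) else 0)"
      by (intro sum.cong) auto
    then show ?thesis by simp
  qed
  have "eqv t (R_free q t (gen Ge) (zeta n i s)) (\<Sum>k\<le>n. scal (if k =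
      Suc i then e_coef (n - i) else 0) (zeta n k s))"
    using R_e_zeta[OF assms, of s] assms unfolding * by (cases "i = n") simp_all
  from R_free_mel[OF this, of j] show ?thesis unfolding * by simp
qed

lemma R_e_mel_power:
  assumes "i \<le> n"
  shows "N \<le> n - i \<Longrightarrow> \<exists>C. C \<noteq> 0 \<and> eqv t ((R_gen q t Ge ^^ N) (mel t n s i j)) (scal C (mel t n s (i + N) j))"
    and "N > n - i \<Longrightarrow> eqv t ((R_gen q t Ge ^^ N) (mel t n s i j)) 0"
proof -
  show 1: "\<exists>C. C \<noteq> 0 \<and> eqv t ((R_gen q t Ge ^^ N) (mel t n s i j)) (scal C (mel t n s (i + N) j))"
      if "N \<le> n - i" for N
    using that
  proof (induction N)
    case 0
    show ?case by (rule exI[of _ 1]) simp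
  next
    case (Suc N)
    then obtain C where C: "C \<noteq> 0" "eqv t ((R_gen q t Ge ^^ N) (mel t n s i j)) (scal C (mel t n s (i + N) j))" by auto
    have "eqv t ((R_gen q t Ge ^^ Suc N) (mel t n s i j)) (scal C (R_gen q t Ge (mel t n s (i +
        N) j)))"
      using eqv_R_e[OF C(2)] by simp
    also have "eqv t \<dots> (scal C (scal (e_coef (n - (i + N))) (mel t n s (Suc (i + N)) j)))"
    proof (rule eqv_scal)
      have "i + N < n" using Suc.prems by simp
      then show "eqv t (R_gen q t Ge (mel t n s (i + N) j)) (scal (e_coef (n - (i +
          N))) (mel t n s (Suc (i + N)) j))"
        using R_e_mel[of "i + N" n s j] by simp
    qed
    finally have "eqv t ((R_gen q t Ge ^^ Suc N) (mel t n s i j)) (scal (C * e_coef (n - (i +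
        N))) (mel t n s (i + Suc N) j))"
      by simp
    then show ?case using C(1) e_coef_nz[of "n - (i + N)"] Suc.prems
      by (intro exI[of _ "C * e_coef (n - (i + N))"]) simp
  qed
  have 2: "eqv t ((R_gen q t Ge ^^ Suc (n - i + m)) (mel t n s i j)) 0" for m
  proof (induction m)
    case 0
    obtain C where C: "eqv t ((R_gen q t Ge ^^ (n - i)) (mel t n s i j)) (scal C (mel t n s n j))"
      using 1[of "n - i"] assms by auto
    have "eqv t ((R_gen q t Ge ^^ Suc (n - i)) (mel t n s i j)) (scal C (R_gen q t Ge (mel t n s n j)))"
      using eqv_R_e[OF C] by simp
    also have "eqv t \<dots> (scal C 0)"
      by (rule eqv_scal) (use R_e_mel[of n n s j] in simp)
    finally show ?case by simp
  next
    case (Suc m)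
    then show ?case using eqv_R_e[OF Suc] by simp
  qed
  show "eqv t ((R_gen q t Ge ^^ N) (mel t n s i j)) 0" if "N > n - i"
    using 2[of "N - Suc (n - i)"] that by simp
qed

lemma gauss_binom_nz:
  assumes "r \<le> n"
  shows "gauss_binom (1 / t\<^sup>2) n r \<noteq> 0"
proof -
  have "qpoch (1 / t\<^sup>2) (1 / t\<^sup>2) m \<noteq> 0" for m
    using t2_root by (auto simp: qpoch_def power_one_over simp flip: power_Suc)
  then show ?thesis using gauss_binom_qpoch[OF assms, of "1 / t\<^sup>2"] by auto
qed

lemma act_top_mel:
  assumes "j \<le> n"
  shows "\<exists>C. C \<noteq> 0 \<and> act t (mel t n s n j) vac = single (- int j, 0, n - j, odd s) C"
proof -
  have "eqvT t (free_comult (zeta n n s)) (\<Sum>r\<le>n. tns (scal (gauss_binom (1 / t\<^sup>2) n r) (gen Gc ^ (n - r) * gen Gd ^ r) * gen Gs ^ s) (zeta n r s))"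
    using eqvT_mult_right[OF comult_c_power[OF t0, of n], of "free_comult (gen Gs ^ s)"]
    by (simp add: free_comult_mult[symmetric] tens_mult_sum_left tns_sigma_power zeta_def
        mult.assoc)
  from contrR_expansion[OF this assms]
  have "eqv t (mel t n s n j) (scal (gauss_binom (1 / t\<^sup>2) n j) (gen Gc ^ (n - j) * (gen Gd ^ j *
      gen Gs ^ s)))"
    by (simp add: mel_def mult.assoc)
  moreover have s: "act t (gen Gs ^ s) vac = single (0, 0, 0, odd s) 1"
    by (induction s) simp_all
  moreover have "act t (gen Gd ^ j) (single (0, 0, 0, b) 1) = single (- int j, 0, 0, b) 1" for b
  proof (induction j)
    case (Suc j)
    have e: "- int j - 1 = - 1 - int j" by simp
    show ?case using Suc by (simp add: e)
  qed simp
  moreover have "act t (gen Gc ^ m) (single (- int j, 0, 0, b) 1) = single (- int j, 0, m,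
      b) (comm_factor t (- int j) ^ m)" for b m
    by (induction m) (simp_all add: mult.commute)
  ultimately have "act t (mel t n s n j) vac = single (- int j, 0, n - j, odd s)
      (gauss_binom (1 / t\<^sup>2) n j * comm_factor t (- int j) ^ (n - j))"
    by (simp add: eqv_iff[OF t0])
  then show ?thesis using gauss_binom_nz[OF assms] t0
    by (intro exI[of _ "gauss_binom (1 / t\<^sup>2) n j * comm_factor t (- int j) ^ (n - j)"])
      (simp add: comm_factor_def)
qed

lemma mel_vec_indep:
  assumes T: "T \<subseteq> mel_index B" and sum: "(\<Sum>\<kappa>\<in>T. scal (w \<kappa>) (mel_vec \<kappa>)) = 0" and "\<kappa>\<^sub>1 \<in> T"
  shows "w \<kappa>\<^sub>1 = 0"
proof (rule ccontr)
  assume nz: "w \<kappa>\<^sub>1 \<noteq> 0"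
  define T' where "T' = {\<kappa> \<in> T. w \<kappa> \<noteq> 0}"
  have fin: "finite T" using T finite_mel_index finite_subset by blast
  then have fin': "finite T'" by (simp add: T'_def)
  define h :: "nat \<times> nat \<times> nat \<times> nat \<Rightarrow> nat" where "h = (\<lambda>(n, s, i, j). n - i)"
  define ix :: "nat \<times> nat \<times> nat \<times> nat \<Rightarrow> idx" where
      "ix = (\<lambda>(n, s, i, j). (- int j, 0, n - j, odd s))"
  define m :: "nat \<times> nat \<times> nat \<times> nat \<Rightarrow> agen free" where "m = (\<lambda>(n, s, i, j). mel t n s i j)"
  define N where "N = Max (h ` T')"
  have "T' \<noteq> {}" using nz assms(3) unfolding T'_def by blast
  then have "N \<in> h ` T'" unfolding N_def using fin' by (intro Max_in) auto
  then obtain \<kappa>\<^sub>0 where k0: "\<kappa>\<^sub>0 \<in> T'" "h \<kappa>\<^sub>0 = N" by blast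
  have hN: "h \<kappa> \<le> N" if "\<kappa> \<in> T'" for \<kappa> using that fin' by (simp add: N_def)
  have lP: "lin (R_gen q t Ge ^^ N)"
    by (induction N) (auto simp: id_def lin_id o_def intro: lin_comp lin_R_gen)
  have im: "\<exists>C. C \<noteq> 0 \<and> act t ((R_gen q t Ge ^^ N) (m \<kappa>)) vac = (if h \<kappa> =
      N then single (ix \<kappa>) C else 0)"
    if "\<kappa> \<in> T'" for \<kappa>
  proof -
    obtain n s i j where k: "\<kappa> = (n, s, i, j)" by (cases \<kappa>)
    have b: "i \<le> n" "j \<le> n" using that T by (auto simp: T'_def mel_index_def k)
    show ?thesis
    proof (cases "h \<kappa> = N")
      case True
      then have N: "N = n - i" by (simp add: h_def k)
      obtain C where C: "C \<noteq> 0" "eqv t ((R_gen q t Ge ^^ N) (mel t n s i j)) (scal C (mel t n s n j))"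
        using R_e_mel_power(1)[OF b(1), of N] b(1) by (auto simp: N)
      obtain D where D: "D \<noteq> 0" "act t (mel t n s n j) vac = single (- int j, 0, n - j, odd s) D"
        using act_top_mel[OF b(2)] by blast
      show ?thesis using C D True by (intro exI[of _ "C * D"]) (simp add: eqv_iff[OF t0] m_def
          ix_def k)
    next
      case False
      then have "N > n - i" using hN[OF that] by (simp add: h_def k)
      then show ?thesis using R_e_mel_power(2)[OF b(1)] False
        by (intro exI[of _ 1]) (simp add: eqv_iff[OF t0] m_def k)
    qed
  qed
  then obtain C where C: "\<And>\<kappa>. \<kappa> \<in> T' \<Longrightarrow> C \<kappa> \<noteq> 0"
    "\<And>\<kappa>. \<kappa> \<in> T' \<Longrightarrow> act t ((R_gen q t Ge ^^ N) (m \<kappa>)) vac = (if h \<kappa> =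
        N then single (ix \<kappa>) (C \<kappa>) else 0)"
    by metis
  have "(\<Sum>\<kappa>\<in>T'. scal (w \<kappa>) (mel_vec \<kappa>)) = 0"
    using sum fin by (subst sum.mono_neutral_left[of T]) (auto simp: T'_def)
  then have "(\<Sum>\<kappa>\<in>T'. scal (w \<kappa>) (m \<kappa>)) \<in> A_ideal t"
    by (simp add: A_ideal_iff[OF t0] module_hom.sum[OF lin_act_left] m_def split_def)
       (metis (no_types, lifting) mel_vec.simps prod.collapse sum.cong)
  then have "(R_gen q t Ge ^^ N) (\<Sum>\<kappa>\<in>T'. scal (w \<kappa>) (m \<kappa>)) \<in> A_ideal t"
    by (induction N) (auto intro: R_gen_A_ideal[OF t0])
  then have "(\<Sum>\<kappa>\<in>T'. scal (w \<kappa>) (act t ((R_gen q t Ge ^^ N) (m \<kappa>)) vac)) = 0"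
    by (simp add: A_ideal_iff[OF t0] module_hom.sum[OF lP] module_hom.scale[OF lP]
        module_hom.sum[OF lin_act_left])
  then have "(\<Sum>\<kappa>\<in>T'. scal (w \<kappa>) (if h \<kappa> = N then single (ix \<kappa>) (C \<kappa>) else 0)) = 0"
    by (simp add: C(2))
  then have "(\<Sum>\<kappa>\<in>T'. lookup (scal (w \<kappa>) (if h \<kappa> = N then single (ix \<kappa>) (C \<kappa>) else 0)) (ix \<kappa>\<^sub>0)) = 0"
    by (simp only: lookup_sum[symmetric] lookup_zero)
  moreover have "lookup (scal (w \<kappa>) (if h \<kappa> = N then single (ix \<kappa>) (C \<kappa>) else 0)) (ix \<kappa>\<^sub>0) =
      (if \<kappa> = \<kappa>\<^sub>0 then w \<kappa>\<^sub>0 * C \<kappa>\<^sub>0 else 0)" if "\<kappa> \<in> T'" for \<kappa>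
  proof -
    obtain n s i j where k: "\<kappa> = (n, s, i, j)" by (cases \<kappa>)
    obtain n' s' i' j' where k': "\<kappa>\<^sub>0 = (n', s', i', j')" by (cases \<kappa>\<^sub>0)
    have "i \<le> n" "j \<le> n" "s < 2" "i' \<le> n'" "j' \<le> n'" "s' < 2"
      using that k0 T by (auto simp: T'_def mel_index_def k k')
    \<comment> \<open>The monomial determines j and n, and s by its parity because s < 2; the height
      N = n - i then determines i. So only one term survives.\<close>
    then have "h \<kappa> = N \<and> ix \<kappa> = ix \<kappa>\<^sub>0 \<longleftrightarrow> \<kappa> = \<kappa>\<^sub>0"
      using k0(2) by (auto simp: h_def ix_def k k' less_2_cases_iff)
    then show ?thesis by (auto simp: lookup_single when_def)
  qed
  ultimately have "w \<kappa>\<^sub>0 * C \<kappa>\<^sub>0 = 0"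
    using k0(1) fin' by (simp cong: sum.cong)
  then show False using k0(1) C(1) by (auto simp: T'_def)
qed

lemma mel_vec_deg: "s < 2 \<Longrightarrow> i \<le> n \<Longrightarrow> j \<le> n \<Longrightarrow> mel_vec (n, s, i, j) \<in> deg_upto n"
proof -
  assume i: "i \<le> n" and j: "j \<le> n"
  obtain M where M: "\<And>r. M r \<in> words_upto n"
    "\<And>s. eqvT t (free_comult (zeta n i s)) (\<Sum>r\<le>n. tns (M r * gen Gs ^ s) (zeta n r s))"
    using comult_expand[OF t0 i] by blast
  have "act t (mel t n s i j) vac = act t (M j * gen Gs ^ s) vac"
    using contrR_expansion[OF M(2)[of s] j] by (simp only: eqv_iff[OF t0] mel_def)
  also have "\<dots> \<in> deg_upto n" by (intro words_upto_act words_upto_sigma M)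
  finally show ?thesis by simp
qed

text \<open>A monomial of degree n is encoded by two numbers p = i + max(-z, 0) and r = i + max(z,
  0), both at most n. They return z = r - p, i = min p r and j = n - max p r. This gives (n+1)^2
  monomials for each n and s, as many as matrix elements.\<close>

lemma card_deg: "finite {k. idx_deg k \<le> N}" "card {k. idx_deg k \<le> N} \<le> card (mel_index N)"
proof -
  define f :: "idx \<Rightarrow> nat \<times> nat \<times> nat \<times> nat" where
    "f = (\<lambda>(z, i, j, s). (nat \<bar>z\<bar> + i + j, if s then 1 else 0, i + nat (- z), i + nat z))"
  have inj: "inj_on f {k. idx_deg k \<le> N}"
  proof (rule inj_on_inverseI)
    fix k :: idx
    obtain z i j s where "k = (z, i, j, s)" by (cases k)
    then show "(\<lambda>(n, s, p, r). (int r - int p, min p r, n - max p r, s = 1)) (f k) = k"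
      by (cases "z \<ge> 0") (auto simp: f_def)
  qed
  have im: "f ` {k. idx_deg k \<le> N} \<subseteq> mel_index N"
    by (auto simp: f_def mel_index_def)
  show "finite {k. idx_deg k \<le> N}" by (rule inj_on_finite[OF inj im finite_mel_index])
  show "card {k. idx_deg k \<le> N} \<le> card (mel_index N)" by (rule card_inj_on_le[OF inj im
      finite_mel_index])
qed

lemma inj_mel_vec: "inj_on mel_vec (mel_index N)"
proof (rule inj_onI, rule ccontr)
  fix x y assume xy: "x \<in> mel_index N" "y \<in> mel_index N" "mel_vec x = mel_vec y" "x \<noteq> y"
  then have "(\<Sum>\<kappa>\<in>{x, y}. scal (if \<kappa> = x then 1 else -1) (mel_vec \<kappa>)) = 0" by simp
  from mel_vec_indep[OF _ this, of N x] xy show False by simp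
qed

text \<open>The matrix elements up to N are independent and lie in the span of the monomials up to
  degree N, which are no more numerous. A monomial outside their span could be adjoined to give too
  large an independent set.\<close>

lemma deg_upto_span: "deg_upto N \<subseteq> pm.span (mel_vec ` mel_index N)"
proof -
  let ?B = "mel_vec ` mel_index N" and ?C = "(\<lambda>k. single k (1 :: complex)) ` {k. idx_deg k \<le> N}"
  note inj = inj_mel_vec[of N]
  have ind: "pm.independent ?B"
  proof (rule pm.independent_if_scalars_zero)
    show "finite ?B" using finite_mel_index by simp
    fix f x assume 0: "(\<Sum>x\<in>?B. scal (f x) x) = 0" and "x \<in> ?B"
    then obtain \<kappa> where \<kappa>: "\<kappa> \<in> mel_index N" "x = mel_vec \<kappa>" by blast
    from 0 have "(\<Sum>\<kappa>\<in>mel_index N. scal (f (mel_vec \<kappa>)) (mel_vec \<kappa>)) = 0"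
      by (simp only: sum.reindex[OF inj] o_def)
    from mel_vec_indep[OF subset_refl this \<kappa>(1)] show "f x = 0" by (simp only: \<kappa>(2))
  qed
  have C: "deg_upto N = pm.span ?C" unfolding deg_upto_def by (simp only: setcompr_eq_image)
  have mono: "deg_upto n \<subseteq> deg_upto N" if "n \<le> N" for n
    unfolding deg_upto_def by (rule pm.span_mono) (use that order_trans in blast)
  have B: "?B \<subseteq> pm.span ?C"
    unfolding C[symmetric]
  proof (rule image_subsetI)
    fix \<kappa> assume k: "\<kappa> \<in> mel_index N"
    obtain n s i j where e: "\<kappa> = (n, s, i, j)" by (cases \<kappa>)
    with k have "mel_vec \<kappa> \<in> deg_upto n" "n \<le> N" using mel_vec_deg by (auto simp: mel_index_def
        simp del: mel_vec.simps)
    then show "mel_vec \<kappa> \<in> deg_upto N" using mono by blast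
  qed
  have fC: "finite ?C" "card ?C \<le> card ?B"
  proof -
    show "finite ?C" using card_deg(1) by simp
    have "card ?C \<le> card {k. idx_deg k \<le> N}" by (rule card_image_le[OF card_deg(1)])
    then show "card ?C \<le> card ?B" using card_deg(2)[of N] by (simp only: card_image[OF inj])
  qed
  have "?C \<subseteq> pm.span ?B"
  proof (rule ccontr)
    assume "\<not> ?C \<subseteq> pm.span ?B"
    then obtain c where c: "c \<in> ?C" "c \<notin> pm.span ?B" by blast
    have i: "pm.independent (insert c ?B)" by (rule pm.independent_insertI[OF c(2) ind])
    have "insert c ?B \<subseteq> pm.span ?C"
      using pm.span_base[OF c(1)] B by (simp only: insert_subset)
    then have "card (insert c ?B) \<le> card ?C"
      using pm.independent_span_bound[OF fC(1) i] by simp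
    moreover have "c \<notin> ?B" using c(2) pm.span_base[of c ?B] by (rule contrapos_nn)
    ultimately show False using fC(2) finite_mel_index by simp
  qed
  then show ?thesis unfolding C by (rule pm.span_minimal) (rule pm.subspace_span)
qed

lemma mel_vec_expand:
  obtains N w where "act t u vac = (\<Sum>\<kappa>\<in>mel_index N. scal (w \<kappa>) (mel_vec \<kappa>))"
proof -
  define p where "p = act t u vac"
  define N where "N = Max (insert 0 (idx_deg ` keys p))"
  have "p \<in> deg_upto N"
    by (subst pm_expand[of p], intro pm.subspace_sum[OF subspace_deg_upto] deg_upto_single) (simp
        add: N_def)
  then have "p \<in> pm.span (mel_vec ` mel_index N)" using deg_upto_span by blast
  then obtain f where "p = (\<Sum>x\<in>mel_vec ` mel_index N. scal (f x) x)"
    using finite_mel_index by (auto simp: pm.span_finite)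
  then show ?thesis using that[of "\<lambda>\<kappa>. f (mel_vec \<kappa>)" N]
    by (simp add: sum.reindex[OF inj_mel_vec] p_def)
qed

subsection \<open>Kernels of operators that preserve the comodules\<close>

definition mel_comb :: "nat \<Rightarrow> nat \<Rightarrow> (nat \<Rightarrow> complex) \<Rightarrow> nat \<Rightarrow> agen free" where
  "mel_comb n s y j = (\<Sum>i\<le>n. scal (y i) (mel t n s i j))"

lemma mel_comb_scal: "mel_comb n s (\<lambda>i. c * y i) j = scal c (mel_comb n s y j)"
  by (simp add: mel_comb_def pm.scale_sum_right)

lemma mel_comb_cong: "(\<And>i. i \<le> n \<Longrightarrow> y i = y' i) \<Longrightarrow> mel_comb n s y j = mel_comb n s y' j"
  unfolding mel_comb_def by (rule sum.cong) auto

lemma R_free_eqv: "eqv t u u' \<Longrightarrow> eqv t (R_free q t x u) (R_free q t x u')"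
  using R_free_A_ideal[OF t0, of "u - u'" q x] by (simp add: eqv_def)

lemma R_free_mel_comb:
  assumes "\<And>i. i \<le> n \<Longrightarrow> eqv t (R_free q t x (zeta n i s)) (\<Sum>k\<le>n. scal (\<rho> i k) (zeta n k s))"
  shows "eqv t (R_free q t x (mel_comb n s y j)) (\<Sum>k\<le>n. scal (\<Sum>i\<le>n. y i * \<rho> i k) (mel t n s k j))"
proof -
  have "eqv t (R_free q t x (mel_comb n s y j)) (\<Sum>i\<le>n. scal (y i) (\<Sum>k\<le>n. scal (\<rho> i k) (mel t n s k j)))"
    unfolding mel_comb_def module_hom.sum[OF lin_R_free] module_hom.scale[OF lin_R_free]
    by (intro eqv_sum eqv_scal R_free_mel assms) simp
  also have "\<dots> = (\<Sum>k\<le>n. scal (\<Sum>i\<le>n. y i * \<rho> i k) (mel t n s k j))"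
    unfolding pm.scale_sum_right pm.scale_sum_left pm.scale_scale by (rule sum.swap)
  finally show ?thesis .
qed

text \<open>A left null vector of the matrix: a combination over the row index i of m_ij is
  transformed by rho from the left, and the column j is untouched.\<close>

definition kernel_vec :: "(nat \<Rightarrow> nat \<Rightarrow> complex) \<Rightarrow> nat \<Rightarrow> (nat \<Rightarrow> complex) \<Rightarrow> bool" where
  "kernel_vec \<rho> n y \<longleftrightarrow> (\<forall>k\<le>n. (\<Sum>i\<le>n. y i * \<rho> i k) = 0)"

text \<open>The action preserves n, s and the column j. By independence of the matrix elements,
  R_x(u) = 0 therefore splits into one finite linear system for each triple (n, s, j), and G only
  has to account for its solutions.\<close>

lemma right_inv_span:
  assumes \<rho>: "\<And>n s i. s < 2 \<Longrightarrow> i \<le> n \<Longrightarrow>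
      eqv t (R_free q t x (zeta n i s)) (\<Sum>k\<le>n. scal (\<rho> n s i k) (zeta n k s))"
    and G1: "\<And>g. g \<in> G \<Longrightarrow> \<exists>n s y j. s < 2 \<and> j \<le> n \<and> kernel_vec (\<rho> n s) n y \<and> g = mel_comb n s y j"
    and G2: "\<And>n s y j. s < 2 \<Longrightarrow> j \<le> n \<Longrightarrow> kernel_vec (\<rho> n s) n y \<Longrightarrow> mel_comb n s y j \<in> pm.span G"
  shows "right_inv_subalg q t (U_proj q x) = lin_span (Aq t) (A_proj t ` G)"
proof -
  have 1: "A_proj t u = A_proj t 0 \<longleftrightarrow> u \<in> A_ideal t" for u
    by (simp add: A_proj_eq eqv_def)
  have 2: "{V \<in> range A. P V} = A ` {u. P (A u)}" for A :: "agen free \<Rightarrow> agen free set" and P by auto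
  have "right_inv_subalg q t (U_proj q x) = A_proj t ` {u. R_free q t x u \<in> A_ideal t}"
    unfolding right_inv_subalg_def carrier_Aq zero_Aq 2 R_act_proj[OF t0 t2] 1 ..
  moreover have "A_proj t ` {u. R_free q t x u \<in> A_ideal t} \<subseteq> A_proj t ` pm.span G"
  proof (rule image_subsetI)
    fix u assume "u \<in> {u. R_free q t x u \<in> A_ideal t}"
    then have u: "eqv t (R_free q t x u) 0" by (simp add: eqv_def)
    obtain N w where w: "act t u vac = (\<Sum>\<kappa>\<in>mel_index N. scal (w \<kappa>) (mel_vec \<kappa>))"
      by (rule mel_vec_expand)
    define y where "y n s j i = w (n, s, i, j)" for n s j i
    have nested: "(\<Sum>\<kappa>\<in>mel_index N. scal (f \<kappa>) (mel_vec \<kappa>)) =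
        act t (\<Sum>n\<le>N. \<Sum>s<2. \<Sum>j\<le>n. \<Sum>i\<le>n. scal (f (n, s, i, j)) (mel t n s i j)) vac" for f
    proof -
      have "(\<Sum>\<kappa>\<in>mel_index N. scal (f \<kappa>) (mel_vec \<kappa>)) =
          (\<Sum>(n, s, i, j)\<in>mel_index N. act t (scal (f (n, s, i, j)) (mel t n s i j)) vac)"
        by (intro sum.cong) auto
      also have "\<dots> = (\<Sum>n\<le>N. \<Sum>s<2. \<Sum>i\<le>n. \<Sum>j\<le>n. act t (scal (f (n, s, i, j)) (mel t n s i j)) vac)"
        unfolding mel_index_def by (rule sum_nested) auto
      also have "\<dots> = (\<Sum>n\<le>N. \<Sum>s<2. \<Sum>j\<le>n. \<Sum>i\<le>n. act t (scal (f (n, s, i, j)) (mel t n s i j)) vac)"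
        by (intro sum.cong refl sum.swap)
      finally show ?thesis by (simp only: module_hom.sum[OF lin_act_left])
    qed
    \<comment> \<open>The expansion of u regrouped by (n, s, j), so that x acts inside each
      group.\<close>
    define u' where "u' = (\<Sum>n\<le>N. \<Sum>s<2. \<Sum>j\<le>n. mel_comb n s (y n s j) j)"
    have uu': "eqv t u u'"
      unfolding eqv_iff[OF t0] w nested u'_def y_def mel_comb_def ..
    have "eqv t (R_free q t x u') (\<Sum>n\<le>N. \<Sum>s<2. \<Sum>j\<le>n. \<Sum>k\<le>n. scal (\<Sum>i\<le>n. y n s j i *
        \<rho> n s i k) (mel t n s k j))"
      unfolding u'_def module_hom.sum[OF lin_R_free]
      by (intro eqv_sum R_free_mel_comb \<rho>) auto
    from eqv_trans[OF eqv_sym[OF this] eqv_trans[OF eqv_sym[OF R_free_eqv[OF uu']] u]]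
    have "act t (\<Sum>n\<le>N. \<Sum>s<2. \<Sum>j\<le>n. \<Sum>k\<le>n. scal (\<Sum>i\<le>n. y n s j i * \<rho> n s i k) (mel t n s k j)) vac =
        0"
      by (simp only: eqv_iff[OF t0] act_simps)
    then have 0: "(\<Sum>\<kappa>\<in>mel_index N. scal (case \<kappa> of (n, s, k, j) \<Rightarrow> \<Sum>i\<le>n. y n s j i *
        \<rho> n s i k) (mel_vec \<kappa>)) = 0"
      by (simp only: nested prod.case)
    have ker: "kernel_vec (\<rho> n s) n (y n s j)" if "n \<le> N" "s < 2" "j \<le> n" for n s j
      unfolding kernel_vec_def
    proof (intro allI impI)
      fix k assume "k \<le> n"
      then have "(n, s, k, j) \<in> mel_index N" using that by (simp add: mel_index_def)
      from mel_vec_indep[OF subset_refl 0 this] show "(\<Sum>i\<le>n. y n s j i * \<rho> n s i k) = 0" by simp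
    qed
    have "u' \<in> pm.span G"
      unfolding u'_def by (intro pm.span_sum G2 ker) auto
    then show "A_proj t u \<in> A_proj t ` pm.span G"
      using uu' A_proj_eq by blast
  qed
  moreover have "pm.span G \<subseteq> {u. R_free q t x u \<in> A_ideal t}"
  proof (rule pm.span_minimal[OF _ subspace_vimage[OF lin_R_free subspace_A]], rule subsetI, rule
      CollectI)
    fix g assume "g \<in> G"
    then obtain n s y j where g: "s < 2" "j \<le> n" "kernel_vec (\<rho> n s) n y" "g = mel_comb n s y j"
      using G1 by blast
    have "(\<Sum>k\<le>n. scal (\<Sum>i\<le>n. y i * \<rho> n s i k) (mel t n s k j)) = 0"
      using g(3) by (simp add: kernel_vec_def)
    then show "R_free q t x g \<in> A_ideal t"
      using R_free_mel_comb[OF \<rho>[OF g(1)], of n y j] by (simp add: g(4) eqv_def)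
  qed
  ultimately show ?thesis unfolding lin_span_Aq by blast
qed

section \<open>Tridiagonal systems for the three elements\<close>

definition tri :: "(nat \<Rightarrow> complex) \<Rightarrow> (nat \<Rightarrow> complex) \<Rightarrow> (nat \<Rightarrow> complex) \<Rightarrow> nat \<Rightarrow> nat \<Rightarrow> complex" where
  "tri A B C i k = (if k = i then A i else 0) + (if k = Suc i then B i else 0) + (if i =
      Suc k then C i else 0)"

lemma kernel_vec_tri: "kernel_vec (tri A B C) n y \<longleftrightarrow>
    (\<forall>k\<le>n. y k * A k + (if k = 0 then 0 else y (k - 1) * B (k - 1)) + (if k < n then y (Suc k) * C
        (Suc k) else 0) = 0)"
proof -
  have "(\<Sum>i\<le>n. y i * tri A B C i k) =
      y k * A k + (if k = 0 then 0 else y (k - 1) * B (k - 1)) + (if k < n then y (Suc k) * C (Suc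
          k) else 0)"
    if "k \<le> n" for k
  proof -
    have "(\<Sum>i\<le>n. y i * tri A B C i k) = (\<Sum>i\<le>n. if i = k then y i * A i else 0) +
        (\<Sum>i\<le>n. if k = Suc i then y i * B i else 0) + (\<Sum>i\<le>n. if i = Suc k then y i * C i else 0)"
      unfolding sum.distrib[symmetric] by (intro sum.cong) (auto simp: tri_def distrib_left)
    moreover have "(\<Sum>i\<le>n. if k = Suc i then y i * B i else 0) = (if k = 0 then 0 else y (k - 1) *
        B (k - 1))"
    proof (cases k)
      case (Suc k')
      have "(\<Sum>i\<le>n. if k = Suc i then y i * B i else 0) = (\<Sum>i\<le>n. if i = k' then y i * B i else 0)"
        by (intro sum.cong) (auto simp: Suc)
      then show ?thesis using Suc that by simp
    qed simp
    ultimately show ?thesis using that by simp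
  qed
  then show ?thesis by (simp add: kernel_vec_def)
qed

text \<open>All three elements arise by setting one coefficient to 0, so the matrix of the action is
  computed once.\<close>

definition x_general :: "complex \<Rightarrow> complex \<Rightarrow> complex \<Rightarrow> ugen free" where
  "x_general \<alpha> \<beta> \<gamma> = scal \<alpha> (gen Ge) + scal \<beta> (gen Gf * gen Gk) + scal \<gamma> (gen Gk - 1)"

abbreviation rho :: "complex \<Rightarrow> complex \<Rightarrow> complex \<Rightarrow> nat \<Rightarrow> nat \<Rightarrow> nat \<Rightarrow> nat \<Rightarrow> complex" where
  "rho \<alpha> \<beta> \<gamma> n s \<equiv> tri (\<lambda>i. \<gamma> * (k_coef n s i - 1)) (\<lambda>i. \<alpha> * e_coef (n - i)) (\<lambda>i. \<beta> *
      fk_coef n s i)"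

lemma R_x_general_zeta:
  assumes "i \<le> n"
  shows "eqv t (R_free q t (x_general \<alpha> \<beta> \<gamma>) (zeta n i s)) (\<Sum>k\<le>n. scal (rho \<alpha> \<beta> \<gamma> n s i k) (zeta n k s))"
proof -
  let ?A = "\<gamma> * (k_coef n s i - 1)" and ?B = "\<alpha> * e_coef (n - i)" and ?C = "\<beta> * fk_coef n s i"
  have "(\<Sum>k\<le>n. scal (rho \<alpha> \<beta> \<gamma> n s i k) (zeta n k s)) =
      (\<Sum>k\<le>n. if k = i then scal ?A (zeta n k s) else 0) +
      (\<Sum>k\<le>n. if k = Suc i then scal ?B (zeta n k s) else 0) + (\<Sum>k\<le>n. if i = Suc k then scal ?C
          (zeta n k s) else 0)"
    unfolding sum.distrib[symmetric] by (intro sum.cong) (auto simp: tri_def pm.scale_left_distrib)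
  \<comment> \<open>At i = n the left sum is empty, and the right side vanishes with
    \<open>e_coef 0\<close>. In the same way \<open>fk_coef\<close> at 0 takes care of i = 0
    below.\<close>
  also have "(\<Sum>k\<le>n. if k = Suc i then scal ?B (zeta n k s) else 0) = scal ?B (zeta n (Suc i) s)"
    using assms by (cases "i = n") auto
  also have "(\<Sum>k\<le>n. if i = Suc k then scal ?C (zeta n k s) else 0) = scal ?C (zeta n (i - 1) s)"
  proof (cases i)
    case (Suc i')
    have "(\<Sum>k\<le>n. if i = Suc k then scal ?C (zeta n k s) else 0) = (\<Sum>k\<le>n. if k =
        i' then scal ?C (zeta n k s) else 0)"
      by (intro sum.cong) (auto simp: Suc)
    then show ?thesis using Suc assms by simp
  qed (simp add: fk_coef_def)
  finally have *: "(\<Sum>k\<le>n. scal (rho \<alpha> \<beta> \<gamma> n s i k) (zeta n k s)) =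
      scal ?A (zeta n i s) + scal ?B (zeta n (Suc i) s) + scal ?C (zeta n (i - 1) s)"
    using assms by simp
  have "R_free q t (x_general \<alpha> \<beta> \<gamma>) (zeta n i s) = scal ?A (zeta n i s) +
      scal \<alpha> (R_gen q t Ge (zeta n i s)) +
      scal \<beta> (R_gen q t Gk (R_gen q t Gf (zeta n i s)))"
    by (simp add: x_general_def R_k_zeta pm.scale_left_diff_distrib pm.scale_right_diff_distrib
        right_diff_distrib)
  also have "eqv t \<dots> (scal ?A (zeta n i s) + scal \<alpha> (scal (e_coef (n - i)) (zeta n (Suc i) s)) +
      scal \<beta> (scal (fk_coef n s i) (zeta n (i - 1) s)))"
    by (intro eqv_add eqv_refl eqv_scal R_e_zeta R_fk_zeta assms)
  finally show ?thesis unfolding * by simp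
qed

lemma t2_inj:
  assumes "(t\<^sup>2) ^ m = (t\<^sup>2) ^ n"
  shows "m = n"
proof -
  have *: False if "(t\<^sup>2) ^ m = (t\<^sup>2) ^ n" "m < n" for m n
  proof -
    have "(t\<^sup>2) ^ m * ((t\<^sup>2) ^ (n - m) - 1) = 0"
      using that power_add[of "t\<^sup>2" m "n - m"] by (simp add: right_diff_distrib)
    then show False using t0 t2_root[of "n - m"] that by simp
  qed
  then show ?thesis using *[OF assms] *[OF assms[symmetric]] by (meson linorder_neqE_nat)
qed

text \<open>The weight is (-1)^(i+s) t^(n-2i). If it is 1, squaring gives equal powers of t^2 and
  forces n = 2i, after which only the sign remains.\<close>

lemma k_coef_eq_1:
  assumes "i \<le> n"
  shows "k_coef n s i = 1 \<longleftrightarrow> n = 2 * i \<and> even (i + s)"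
proof -
  have *: "k_coef n s i * t ^ i = (-1) ^ (i + s) * t ^ (n - i)"
    using t0 by (simp add: k_coef_def power_minus[of "1 / t"] power_add power_one_over)
  show ?thesis
  proof
    assume k: "k_coef n s i = 1"
    then have e: "t ^ i = (-1) ^ (i + s) * t ^ (n - i)" using * by simp
    then have "(t ^ i)\<^sup>2 = (t ^ (n - i))\<^sup>2" by (simp add: power_mult_distrib flip: power_mult)
    then have "(t\<^sup>2) ^ i = (t\<^sup>2) ^ (n - i)" by (simp add: power_mult[symmetric] mult.commute)
    then have n: "n = 2 * i" using t2_inj assms by fastforce
    then have "(-1) ^ (i + s) = (1 :: complex)" using e t0 by simp
    then show "n = 2 * i \<and> even (i + s)" using n by (cases "even (i + s)") auto
  next
    assume "n = 2 * i \<and> even (i + s)"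
    then show "k_coef n s i = 1" using * t0 by simp
  qed
qed

subsection \<open>The coefficients and the matrix elements of the comodules of integral spin\<close>

end

locale osp_sqrt = osp +
  fixes sb :: "nat \<Rightarrow> nat \<Rightarrow> complex"
  assumes sb_sqrt: "\<And>m n. n \<le> m \<Longrightarrow> (sb m n) ^ 2 = qbinom (1 / t ^ 2) m n"
begin

text \<open>The scalar in xi at weight i - l. It is nonzero because a Gaussian binomial in t^-2 does
  not vanish.\<close>

definition nrm :: "nat \<Rightarrow> nat \<Rightarrow> complex" where
  "nrm l i = \<i> ^ (i div 2) * sb (2 * l) i"

text \<open>Passes from the natural index i in 0, ..., 2l to the element i - l of I_l.\<close>

definition wt :: "nat \<Rightarrow> nat \<Rightarrow> rat" where
  "wt l i = of_nat i - of_nat l"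

lemma nrm_nz: "i \<le> 2 * l \<Longrightarrow> nrm l i \<noteq> 0"
proof -
  assume i: "i \<le> 2 * l"
  have "qpoch (1 / t\<^sup>2) (1 / t\<^sup>2) m \<noteq> 0" for m
    using t2_root by (auto simp: qpoch_def power_one_over simp flip: power_Suc)
  then have "qbinom (1 / t\<^sup>2) (2 * l) i \<noteq> 0" by (simp add: qbinom_def)
  then have "(sb (2 * l) i)\<^sup>2 \<noteq> 0" using sb_sqrt[OF i] by simp
  then show ?thesis by (simp add: nrm_def)
qed

lemma I_set_wt: "I_set (of_nat l) = wt l ` {..2 * l}"
proof (intro equalityI subsetI)
  fix x assume "x \<in> I_set (of_nat l)"
  then obtain r where r: "x = - of_nat l + of_nat r" "- of_nat l + of_nat r \<le> (of_nat l :: rat)"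
    by (auto simp: I_set_def)
  then have "(of_nat r :: rat) \<le> of_nat (2 * l)" by simp
  then have "r \<le> 2 * l" by (simp only: of_nat_le_iff)
  then show "x \<in> wt l ` {..2 * l}" using r by (auto simp: wt_def)
next
  fix x assume "x \<in> wt l ` {..2 * l}"
  then obtain r where r: "r \<le> 2 * l" "x = wt l r" by auto
  then have "(of_nat r :: rat) \<le> of_nat (2 * l)" by (simp only: of_nat_le_iff)
  then show "x \<in> I_set (of_nat l)" using r by (auto simp: I_set_def wt_def intro!: exI[of _ r])
qed

lemma inj_wt: "inj_on (wt l) S"
  by (rule inj_onI) (simp add: wt_def)

lemma wt_in: "i \<le> 2 * l \<Longrightarrow> wt l i \<in> I_set (of_nat l)"
  by (simp add: I_set_wt)

lemma finite_I_set: "finite (I_set (of_nat l))"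
  by (simp add: I_set_wt)

lemma times_sigma_proj: "s < 2 \<Longrightarrow> times_sigma t (A_proj t x) s = A_proj t (x * gen Gs ^ s)"
  by (auto simp: less_2_cases_iff times_sigma_def nat_pow_def one_Aq mult_Aq)

lemma xi_wt:
  assumes "i \<le> 2 * l" "s < 2"
  shows "times_sigma t (xi t sb (of_nat l) (wt l i)) s = A_proj t (scal (nrm l i) (zeta (2 *
      l) i s))"
proof -
  have 1: "of_nat l + wt l i = of_nat i" by (simp add: wt_def)
  have 2: "of_nat l - wt l i = of_int (int (2 * l - i))" using assms(1) by (simp add: wt_def
      of_nat_diff)
  have 3: "\<lfloor>(of_nat i :: rat) / 2\<rfloor> = int (i div 2)"
    using floor_divide_of_nat_eq[of i 2, where 'a = rat] by simp
  have 4: "\<lfloor>2 * (of_nat l :: rat)\<rfloor> = int (2 * l)"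
    by (metis floor_of_nat of_nat_mult of_nat_numeral)
  have "xi t sb (of_nat l) (wt l i) = A_proj t (scal (nrm l i) (gen Ga ^ (2 * l - i) * gen Gc ^ i))"
    unfolding xi_def 1 2 3 4 floor_of_int floor_of_nat nat_int using wt_in[OF assms(1)] by (simp
        add: nrm_def)
  then show ?thesis by (simp add: times_sigma_proj assms(2) zeta_def mult.assoc)
qed

text \<open>The description by \<open>THE\<close> is meaningful since the target vector is nonzero
  in A. The factor \<open>nrm l i / nrm l k\<close> is the change from \<open>zeta\<close> to the
  normalised basis.\<close>

lemma coef_unique:
  assumes "i \<le> 2 * l" "k \<le> 2 * l" "s < 2"
    and R: "eqv t (R_free q t x (zeta (2 * l) i s)) (scal w (zeta (2 * l) k s))"
  shows "(THE z. R_act q t (U_proj q x) (times_sigma t (xi t sb (of_nat l) (wt l i)) s) =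
     z \<odot>\<^bsub>Aq t\<^esub> times_sigma t (xi t sb (of_nat l) (wt l k)) s) = nrm l i * w / nrm l k"
proof -
  have "R_act q t (U_proj q x) (times_sigma t (xi t sb (of_nat l) (wt l i)) s) =
     z \<odot>\<^bsub>Aq t\<^esub> times_sigma t (xi t sb (of_nat l) (wt l k)) s \<longleftrightarrow> z = nrm l i * w / nrm l k" for z
  proof -
    have "A_proj t (R_free q t x (scal (nrm l i) (zeta (2 * l) i s))) =
        A_proj t (scal (nrm l i) (scal w (zeta (2 * l) k s)))"
      unfolding A_proj_eq module_hom.scale[OF lin_R_free] by (rule eqv_scal[OF R])
    then have "R_act q t (U_proj q x) (times_sigma t (xi t sb (of_nat l) (wt l i)) s) =
        z \<odot>\<^bsub>Aq t\<^esub> times_sigma t (xi t sb (of_nat l) (wt l k)) s \<longleftrightarrow>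
      A_proj t (scal (nrm l i * w) (zeta (2 * l) k s)) = A_proj t (scal (z * nrm l k) (zeta (2 *
          l) k s))"
      by (simp only: xi_wt assms R_act_proj[OF t0 t2] smult_Aq pm.scale_scale)
    also have "\<dots> \<longleftrightarrow> nrm l i * w = z * nrm l k"
    proof -
      have "single (j :: idx) u = single j v \<longleftrightarrow> u = v" for j and u v :: complex
        by (metis lookup_single_eq)
      then show ?thesis by (simp add: A_proj_eq eqv_iff[OF t0] act_zeta)
    qed
    finally show ?thesis using nrm_nz[OF assms(2)] by (auto simp: field_simps)
  qed
  then show ?thesis by simp
qed

lemma coef_a_wt: "i \<le> 2 * l \<Longrightarrow> s < 2 \<Longrightarrow> coef_a q t sb (of_nat l) s (wt l i) = k_coef (2 * l) s i - 1"
  unfolding coef_a_def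
  by (subst coef_unique) (simp_all add: R_k_zeta nrm_nz pm.scale_left_diff_distrib)

lemma coef_b_wt:
  assumes "i < 2 * l" "s < 2"
  shows "coef_b q t sb (of_nat l) s (wt l i) = nrm l i * e_coef (2 * l - i) / nrm l (Suc i)"
proof -
  have "wt l i + 1 = wt l (Suc i)" by (simp add: wt_def)
  then show ?thesis unfolding coef_b_def
    by (simp only:) (rule coef_unique, use assms R_e_zeta[of i "2 * l" s] in auto)
qed

lemma coef_c_wt:
  assumes "i < 2 * l" "s < 2"
  shows "coef_c q t sb (of_nat l) s (wt l (Suc i)) = nrm l (Suc i) * fk_coef (2 *
      l) s (Suc i) / nrm l i"
proof -
  have "wt l (Suc i) - 1 = wt l i" by (simp add: wt_def)
  then show ?thesis unfolding coef_c_def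
    by (simp only:) (rule coef_unique, use assms R_fk_zeta[of "Suc i" "2 * l" s] in auto)
qed

lemma is_mat_elems_iff:
  assumes "\<And>i j. i \<le> 2 * l \<Longrightarrow> j \<le> 2 * l \<Longrightarrow> m (wt l i) (wt l j) = A_proj t (\<mu> i j)"
  shows "is_mat_elems t sb (of_nat l) m \<longleftrightarrow>
    (\<forall>s<2. \<forall>i\<le>2 * l. eqvT t (free_comult (scal (nrm l i) (zeta (2 * l) i s)))
       (\<Sum>j\<le>2 * l. tns (scal (nrm l j) (\<mu> i j * gen Gs ^ s)) (zeta (2 * l) j s)))"
proof -
  have L: "comult t (times_sigma t (xi t sb (of_nat l) (wt l i)) s) =
      AA_proj t (free_comult (scal (nrm l i) (zeta (2 * l) i s)))" if "i \<le> 2 * l" "s < 2" for i s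
    by (simp only: xi_wt that comult_A_proj[OF t0])
  have R: "(\<Oplus>\<^bsub>AAq t\<^esub>j\<in>I_set (of_nat l). A_tens t (times_sigma t (m (wt l i) j) s) (times_sigma t (xi t sb (of_nat l) j) s)) =
      AA_proj t (\<Sum>j\<le>2 * l. tns (scal (nrm l j) (\<mu> i j * gen Gs ^ s)) (zeta (2 * l) j s))" if "i \<le>
          2 * l" "s < 2" for i s
  proof -
    \<comment> \<open>The sum over rational weights is moved to natural indices through the inverse
      of \<open>wt l\<close>.\<close>
    define f where "f j = tns (scal (nrm l (inv_into {..2 * l} (wt l) j)) (\<mu> i (inv_into {..2 *
        l} (wt l) j) * gen Gs ^ s))
      (zeta (2 * l) (inv_into {..2 * l} (wt l) j) s)" for j
    have f: "f (wt l j) = tns (scal (nrm l j) (\<mu> i j * gen Gs ^ s)) (zeta (2 * l) j s)" if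
        "j \<le> 2 * l" for j
      using that by (simp add: f_def inv_into_f_f[OF inj_wt])
    have "(\<Oplus>\<^bsub>AAq t\<^esub>j\<in>I_set (of_nat l). A_tens t (times_sigma t (m (wt l i) j) s) (times_sigma t (xi t sb (of_nat l) j) s)) =
        AA_proj t (sum f (I_set (of_nat l)))"
    proof (rule AA_proj_finsum_cong[OF finite_I_set])
      fix j' assume "j' \<in> I_set (of_nat l)"
      then obtain j where j: "j \<le> 2 * l" "j' = wt l j" by (auto simp: I_set_wt)
      show "A_tens t (times_sigma t (m (wt l i) j') s) (times_sigma t (xi t sb (of_nat l) j') s) =
          AA_proj t (f j')"
        by (simp only: j f assms that xi_wt times_sigma_proj A_tens_A_proj tns_simps)
    qed
    also have "sum f (I_set (of_nat l)) = (\<Sum>j\<le>2 * l. tns (scal (nrm l j) (\<mu> i j *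
        gen Gs ^ s)) (zeta (2 * l) j s))"
      unfolding I_set_wt sum.reindex[OF inj_wt] by (intro sum.cong) (auto simp: f)
    finally show ?thesis .
  qed
  have c: "m i j \<in> carrier (Aq t)" if "i \<in> I_set (of_nat l)" "j \<in> I_set (of_nat l)" for i j
    using that assms by (auto simp: I_set_wt carrier_Aq)
  define E where "E i s \<longleftrightarrow> comult t (times_sigma t (xi t sb (of_nat l) i) s) =
      (\<Oplus>\<^bsub>AAq t\<^esub>j\<in>I_set (of_nat l). A_tens t (times_sigma t (m i j) s) (times_sigma t (xi t sb
          (of_nat l) j) s))" for i s
  have E: "E (wt l i) s \<longleftrightarrow> eqvT t (free_comult (scal (nrm l i) (zeta (2 * l) i s)))
       (\<Sum>j\<le>2 * l. tns (scal (nrm l j) (\<mu> i j * gen Gs ^ s)) (zeta (2 * l) j s))" if "i \<le> 2 * l" "s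
           < 2" for i s
    unfolding E_def L[OF that] R[OF that] AA_proj_eq eqvT_def ..
  have "is_mat_elems t sb (of_nat l) m \<longleftrightarrow> (\<forall>s\<in>{0, 1}. \<forall>i\<in>I_set (of_nat l). E i s)"
    unfolding is_mat_elems_def E_def using c by blast
  also have "\<dots> \<longleftrightarrow> (\<forall>s<2. \<forall>i\<le>2 * l. E (wt l i) s)"
    by (auto simp: I_set_wt less_2_cases_iff)
  finally show ?thesis using E by blast
qed

text \<open>Some family satisfies \<open>is_mat_elems\<close>, namely the coefficients from
  \<open>comult_expand\<close> rescaled by \<open>nrm\<close>. Hence the chosen family satisfies it
  too, and contracting the second leg with \<open>coord\<close> determines each entry, whichever
  family was chosen.\<close>

lemma mat_elem_wt:
  assumes "i \<le> 2 * l" "j \<le> 2 * l" "s < 2"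
  shows "times_sigma t (mat_elem t sb (of_nat l) (wt l i) (wt l j)) s =
    A_proj t (scal (nrm l i / nrm l j) (mel t (2 * l) s i j))"
proof -
  let ?P = "\<lambda>i M. \<forall>s. eqvT t (free_comult (zeta (2 * l) i s)) (\<Sum>r\<le>2 * l. tns (M r *
      gen Gs ^ s) (zeta (2 * l) r s))"
  have "\<forall>i\<in>{..2 * l}. \<exists>M. ?P i M"
  proof
    fix i assume "i \<in> {..2 * l}"
    then have "i \<le> 2 * l" by simp
    then show "\<exists>M. ?P i M"
    proof (rule comult_expand[OF t0])
      fix M assume M: "\<And>s. eqvT t (free_comult (zeta (2 * l) i s)) (\<Sum>r\<le>2 * l. tns (M r *
          gen Gs ^ s) (zeta (2 * l) r s))"
      show "\<exists>M. ?P i M" by (intro exI[of _ M] allI M)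
    qed
  qed
  from bchoice[OF this] obtain M where *: "\<forall>i\<in>{..2 * l}. ?P i (M i)" ..
  have M: "eqvT t (free_comult (zeta (2 * l) i s)) (\<Sum>r\<le>2 * l. tns (M i r * gen Gs ^ s) (zeta (2 *
      l) r s))"
    if "i \<le> 2 * l" for i s
    using *[THEN bspec, of i] that by (simp only: atMost_iff)
  define \<mu> where "\<mu> i j = scal (nrm l i / nrm l j) (M i j)" for i j
  define m where "m i' j' = A_proj t (\<mu> (inv_into {..2 * l} (wt l) i') (inv_into {..2 *
      l} (wt l) j'))" for i' j'
  have m: "m (wt l i) (wt l j) = A_proj t (\<mu> i j)" if "i \<le> 2 * l" "j \<le> 2 * l" for i j
    using that by (simp add: m_def inv_into_f_f[OF inj_wt])
  have "is_mat_elems t sb (of_nat l) m"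
  proof (rule is_mat_elems_iff[where l = l and m = m and \<mu> = \<mu>, THEN iffD2], erule (1) m, intro
      allI impI)
    fix s i assume s: "s < (2::nat)" and i: "i \<le> 2 * l"
    have "(\<Sum>j\<le>2 * l. tns (scal (nrm l j) (\<mu> i j * gen Gs ^ s)) (zeta (2 * l) j s)) =
        scal (nrm l i) (\<Sum>j\<le>2 * l. tns (M i j * gen Gs ^ s) (zeta (2 * l) j s))"
      unfolding pm.scale_sum_right by (intro sum.cong) (auto simp: \<mu>_def tns_simps nrm_nz)
    then show "eqvT t (free_comult (scal (nrm l i) (zeta (2 * l) i s)))
       (\<Sum>j\<le>2 * l. tns (scal (nrm l j) (\<mu> i j * gen Gs ^ s)) (zeta (2 * l) j s))"
      using pm.subspace_scale[OF subspace_AA M[OF i, of s, unfolded eqvT_def], of "nrm l i"]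
      by (simp only: eqvT_def free_comult_simps pm.scale_right_diff_distrib)
  qed
  then have me: "is_mat_elems t sb (of_nat l) (mat_elem t sb (of_nat l))"
    unfolding mat_elem_def by (rule someI[where P = "is_mat_elems t sb (of_nat l)"])
  define \<nu> where "\<nu> i j = (SOME x. mat_elem t sb (of_nat l) (wt l i) (wt l j) = A_proj t x)" for i j
  have \<nu>: "mat_elem t sb (of_nat l) (wt l i) (wt l j) = A_proj t (\<nu> i j)" if "i \<le> 2 * l"
      "j \<le> 2 * l" for i j
  proof -
    have "mat_elem t sb (of_nat l) (wt l i) (wt l j) \<in> range (A_proj t)"
      using me wt_in[OF that(1)] wt_in[OF that(2)] by (simp only: is_mat_elems_def carrier_Aq)
    then obtain x where "mat_elem t sb (of_nat l) (wt l i) (wt l j) = A_proj t x" by (rule imageE)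
    then show ?thesis unfolding \<nu>_def by (rule someI)
  qed
  have "eqvT t (free_comult (scal (nrm l i) (zeta (2 * l) i s)))
       (\<Sum>j\<le>2 * l. tns (scal (nrm l j) (\<nu> i j * gen Gs ^ s)) (zeta (2 * l) j s))"
    by (rule is_mat_elems_iff[where l = l and m = "mat_elem t sb (of_nat l)" and \<mu> = \<nu>, THEN
        iffD1, rule_format])
      (simp_all only: \<nu> me assms)
  from contrR_expansion[OF this assms(2)]
  have "eqv t (scal (nrm l i) (mel t (2 * l) s i j)) (scal (nrm l j) (\<nu> i j * gen Gs ^ s))"
    by (simp add: mel_def contrR_simps)
  from eqv_scal[OF eqv_sym[OF this], of "1 / nrm l j"]
  show ?thesis using nrm_nz[OF assms(2)] by (simp add: \<nu> assms times_sigma_proj A_proj_eq)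
qed

text \<open>The factor \<open>1 / nrm l j\<close> depends only on the column and does not affect the
  span. The factor \<open>nrm l i\<close> is why the recurrences are solved by x_i times
  \<open>nrm l i\<close>.\<close>

lemma mat_comb_wt:
  assumes "j \<le> 2 * l" "s < 2"
  shows "mat_comb t sb (of_nat l) s x (wt l j) =
    A_proj t (mel_comb (2 * l) s (\<lambda>i. 1 / nrm l j * (x (wt l i) * nrm l i)) j)"
proof -
  define f where "f i' = scal (1 / nrm l j * (x i' * nrm l (inv_into {..2 * l} (wt l) i')))
      (mel t (2 * l) s (inv_into {..2 * l} (wt l) i') j)" for i'
  have f: "f (wt l i) = scal (1 / nrm l j * (x (wt l i) * nrm l i)) (mel t (2 * l) s i j)" if
      "i \<le> 2 * l" for i
    using that by (simp add: f_def inv_into_f_f[OF inj_wt])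
  have "mat_comb t sb (of_nat l) s x (wt l j) = A_proj t (sum f (I_set (of_nat l)))"
    unfolding mat_comb_def
  proof (rule A_proj_finsum_cong[OF finite_I_set])
    fix i' assume "i' \<in> I_set (of_nat l)"
    then obtain i where i: "i \<le> 2 * l" "i' = wt l i" by (auto simp: I_set_wt)
    show "x i' \<odot>\<^bsub>Aq t\<^esub> times_sigma t (mat_elem t sb (of_nat l) i' (wt l j)) s = A_proj t (f i')"
      unfolding i(2) f[OF i(1)] mat_elem_wt[OF i(1) assms] smult_Aq by simp
  qed
  also have "sum f (I_set (of_nat l)) = mel_comb (2 * l) s (\<lambda>i. 1 / nrm l j * (x (wt l i) *
      nrm l i)) j"
    unfolding I_set_wt sum.reindex[OF inj_wt] mel_comb_def by (intro sum.cong) (auto simp: f)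
  finally show ?thesis .
qed

subsection \<open>Solving the recurrences\<close>

lemma kernel_vec_diff:
  assumes "kernel_vec \<rho> n y" "kernel_vec \<rho> n y'"
  shows "kernel_vec \<rho> n (\<lambda>i. y i - c * y' i)"
  using assms by (simp add: kernel_vec_def left_diff_distrib sum_subtractf mult.assoc flip:
      sum_distrib_left)

lemma kernel_vec_scale: "kernel_vec \<rho> n y \<Longrightarrow> kernel_vec \<rho> n (\<lambda>i. c * y i)"
  by (simp add: kernel_vec_def mult.assoc flip: sum_distrib_left)

text \<open>P singles out the pairs (l, s) with a nonzero solution and p is a pivot index. A
  solution vanishing at the pivot is zero, so subtracting a multiple of the given one shows that the
  solution space is a line. All remaining n and s, half-integral spins included, contribute
  nothing.\<close>

lemma right_inv_mat_comb:
  assumes sol: "\<And>l s. s < 2 \<Longrightarrow> P l s \<Longrightarrow> kernel_vec (rho \<alpha> \<beta> \<gamma> (2 * l) s) (2 *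
      l) (\<lambda>i. x l s (wt l i) * nrm l i)"
    and p: "\<And>l s. s < 2 \<Longrightarrow> P l s \<Longrightarrow> p l \<le> 2 * l \<and> x l s (wt l (p l)) \<noteq> 0"
    and uniq: "\<And>l s y i. s < 2 \<Longrightarrow> P l s \<Longrightarrow> kernel_vec (rho \<alpha> \<beta> \<gamma> (2 * l) s) (2 * l) y \<Longrightarrow> y (p l) = 0 \<Longrightarrow>
        i \<le> 2 * l \<Longrightarrow> y i = 0"
    and no: "\<And>n s y i. s < 2 \<Longrightarrow> \<nexists>l. n = 2 * l \<and> P l s \<Longrightarrow> kernel_vec (rho \<alpha> \<beta> \<gamma> n s) n y \<Longrightarrow> i \<le> n \<Longrightarrow>
        y i = 0"
  shows "right_inv_subalg q t (U_proj q (x_general \<alpha> \<beta> \<gamma>)) =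
    lin_span (Aq t) {mat_comb t sb (of_nat l) s (x l s) j | l s j. s \<in> {0, 1} \<and> P l s \<and> j \<in> I_set
        (of_nat l)}"
proof -
  define y0 where "y0 l s j i = 1 / nrm l j * (x l s (wt l i) * nrm l i)" for l s j i
  let ?G = "{mel_comb (2 * l) s (y0 l s j) j | l s j. s < 2 \<and> P l s \<and> j \<le> 2 * l}"
  have y0: "kernel_vec (rho \<alpha> \<beta> \<gamma> (2 * l) s) (2 * l) (y0 l s j)" if "s < 2" "P l s" for l s j
    unfolding y0_def[abs_def] by (rule kernel_vec_scale[OF sol[OF that]])
  have "{mat_comb t sb (of_nat l) s (x l s) j | l s j. s \<in> {0, 1} \<and> P l s \<and> j \<in>
      I_set (of_nat l)} = A_proj t ` ?G"
    (is "?L = ?R")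
  proof (intro equalityI subsetI)
    fix V assume "V \<in> ?L"
    then obtain l s j' where "V = mat_comb t sb (of_nat l) s (x l s) j'" "s < 2" "P l s"
        "j' \<in> I_set (of_nat l)"
      by fastforce
    then obtain j where j: "V = mat_comb t sb (of_nat l) s (x l s) (wt l j)" "s < 2" "P l s"
        "j \<le> 2 * l"
      by (auto simp: I_set_wt)
    then have "V = A_proj t (mel_comb (2 * l) s (y0 l s j) j)" by (simp only: mat_comb_wt
        y0_def[abs_def])
    then show "V \<in> ?R" using j(2-4) by blast
  next
    fix V assume "V \<in> ?R"
    then obtain l s j where j: "V = A_proj t (mel_comb (2 * l) s (y0 l s j) j)" "s < 2" "P l s"
        "j \<le> 2 * l" by blast
    then have "V = mat_comb t sb (of_nat l) s (x l s) (wt l j)" by (simp only: mat_comb_wt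
        y0_def[abs_def])
    moreover have "s \<in> {0, 1}" using j(2) by auto
    ultimately show "V \<in> ?L" using j(3) wt_in[OF j(4)] by blast
  qed
  moreover have "right_inv_subalg q t (U_proj q (x_general \<alpha> \<beta> \<gamma>)) =
      lin_span (Aq t) (A_proj t ` ?G)"
  proof (rule right_inv_span[where \<rho> = "rho \<alpha> \<beta> \<gamma>"])
    fix n s i :: nat assume "i \<le> n"
    then show "eqv t (R_free q t (x_general \<alpha> \<beta> \<gamma>) (zeta n i s)) (\<Sum>k\<le>n. scal (rho \<alpha> \<beta> \<gamma> n s i k) (zeta n k s))"
      by (rule R_x_general_zeta)
  next
    fix g assume "g \<in> ?G"
    then show "\<exists>n s y j. s < 2 \<and> j \<le> n \<and> kernel_vec (rho \<alpha> \<beta> \<gamma> n s) n y \<and> g = mel_comb n s y j"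
      using y0 by blast
  next
    fix n s j :: nat and y assume s: "s < 2" and j: "j \<le> n" and y: "kernel_vec (rho \<alpha> \<beta> \<gamma> n s) n y"
    show "mel_comb n s y j \<in> pm.span ?G"
    proof (cases "\<exists>l. n = 2 * l \<and> P l s")
      case False
      then have "mel_comb n s y j = 0"
        using no[OF s False y] by (simp add: mel_comb_def)
      then show ?thesis by (simp add: pm.span_zero)
    next
      case True
      then obtain l where l: "n = 2 * l" "P l s" by blast
      define c where "c = y (p l) / y0 l s j (p l)"
      have nz: "y0 l s j (p l) \<noteq> 0"
        using p[OF s l(2)] nrm_nz j l(1) by (simp add: y0_def)
      have "kernel_vec (rho \<alpha> \<beta> \<gamma> (2 * l) s) (2 * l) (\<lambda>i. y i - c * y0 l s j i)"
        using kernel_vec_diff[OF _ y0[OF s l(2)]] y l(1) by blast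
      from uniq[OF s l(2) this] have "y i = c * y0 l s j i" if "i \<le> n" for i
        using nz that l(1) by (simp add: c_def)
      then have "mel_comb n s y j = scal c (mel_comb n s (y0 l s j) j)"
        unfolding mel_comb_scal[symmetric] by (rule mel_comb_cong)
      moreover have "mel_comb n s (y0 l s j) j \<in> ?G" using l s j by blast
      ultimately show ?thesis by (simp only: pm.span_scale[OF pm.span_base])
    qed
  qed
  ultimately show ?thesis by simp
qed

text \<open>With zero diagonal, column k links only the entries k - 1 and k + 1. Going up, the entry
  0 determines the even entries, while column 0 kills entry 1 and with it all odd ones.\<close>

lemma kernel_e_fk:
  assumes "\<alpha> \<noteq> 0" "\<beta> \<noteq> 0" and y: "kernel_vec (rho \<alpha> \<beta> 0 n s) n y"
  shows "y 0 = 0 \<Longrightarrow> i \<le> n \<Longrightarrow> y i = 0" and "odd n \<Longrightarrow> y 0 = 0"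
proof -
  have eq: "(if k = 0 then 0 else y (k - 1) * (\<alpha> * e_coef (n - (k - 1)))) +
      (if k < n then y (Suc k) * (\<beta> * fk_coef n s (Suc k)) else 0) = 0" if "k \<le> n" for k
    using y that by (simp add: kernel_vec_tri)
  show "y i = 0" if "y 0 = 0" "i \<le> n"
    using that(2)
  proof (induction i rule: less_induct)
    case (less i)
    show ?case
    proof (cases i)
      case 0
      then show ?thesis using that(1) by simp
    next
      case (Suc k)
      have "k \<noteq> 0 \<Longrightarrow> y (k - 1) = 0" using less Suc by simp
      then have "y (Suc k) * (\<beta> * fk_coef n s (Suc k)) = 0"
        using eq[of k] less.prems Suc by (cases "k = 0") simp_all
      then show ?thesis using assms(2) fk_coef_nz[of "Suc k" n s] Suc by simp
    qed
  qed
  show "y 0 = 0" if "odd n"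
  proof -
    \<comment> \<open>Column n kills the entry n - 1, and going down in steps of two kills n - 3, n
      - 5 and so on. For odd n this chain ends at the entry 0.\<close>
    have "2 * r < n \<Longrightarrow> y (n - 1 - 2 * r) = 0" for r
    proof (induction r)
      case 0
      then show ?case using eq[of n] assms(1) e_coef_nz[of "n - (n - 1)"] by simp
    next
      case (Suc r)
      let ?k = "n - 2 - 2 * r"
      have k: "?k \<noteq> 0" "?k - 1 = n - 1 - 2 * Suc r" "Suc ?k = n - 1 - 2 * r" "?k \<le> n"
          "n - (?k - 1) > 0"
        using Suc.prems \<open>odd n\<close> by (auto elim!: oddE)
      have "y (?k - 1) * (\<alpha> * e_coef (n - (?k - 1))) = 0"
        using eq[OF k(4)] Suc.IH Suc.prems k(1,3) by auto
      then show ?case using assms(1) e_coef_nz[OF k(5)] k(2) by simp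
    qed
    from this[of "n div 2"] \<open>odd n\<close> show ?thesis by (auto elim!: oddE)
  qed
qed

text \<open>Column k expresses y k times its diagonal entry by y (k - 1). So y is determined going
  up from 0, except where the diagonal vanishes, and there it is 0 by assumption.\<close>

lemma kernel_e_k:
  assumes y: "kernel_vec (rho \<alpha> 0 \<gamma> n s) n y" and 0: "\<And>k. k \<le> n \<Longrightarrow> k_coef n s k = 1 \<Longrightarrow> y k = 0" and
      "\<gamma> \<noteq> 0" "i \<le> n"
  shows "y i = 0"
proof -
  have eq: "y k * (\<gamma> * (k_coef n s k - 1)) + (if k = 0 then 0 else y (k - 1) * (\<alpha> *
      e_coef (n - (k - 1)))) = 0"
    if "k \<le> n" for k
    using y[unfolded kernel_vec_tri, rule_format, OF that] by (simp split: if_splits)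
  have step: "y k = 0" if "k \<le> n" "y k * (\<gamma> * (k_coef n s k - 1)) = 0" for k
    using that 0[of k] \<open>\<gamma> \<noteq> 0\<close> by (cases "k_coef n s k = 1") simp_all
  show ?thesis
    using \<open>i \<le> n\<close>
  proof (induction i)
    case 0
    show ?case by (rule step) (use eq[of 0] in simp_all)
  next
    case (Suc i)
    show ?case by (rule step) (use Suc eq[of "Suc i"] in simp_all)
  qed
qed

text \<open>The mirror image of the preceding argument: R_fk lowers the index, so the recursion
  starts at n and goes down.\<close>

lemma kernel_fk_k:
  assumes y: "kernel_vec (rho 0 \<beta> \<gamma> n s) n y" and 0: "\<And>k. k \<le> n \<Longrightarrow> k_coef n s k = 1 \<Longrightarrow> y k = 0" and
      "\<gamma> \<noteq> 0" "i \<le> n"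
  shows "y i = 0"
proof -
  have eq: "y k * (\<gamma> * (k_coef n s k - 1)) + (if k < n then y (Suc k) * (\<beta> *
      fk_coef n s (Suc k)) else 0) = 0"
    if "k \<le> n" for k
    using y[unfolded kernel_vec_tri, rule_format, OF that] by (simp split: if_splits)
  have step: "y k = 0" if "k \<le> n" "y k * (\<gamma> * (k_coef n s k - 1)) = 0" for k
    using that 0[of k] \<open>\<gamma> \<noteq> 0\<close> by (cases "k_coef n s k = 1") simp_all
  have "y (n - m) = 0" for m
  proof (induction m)
    case 0
    show ?case by (rule step) (use eq[of n] in simp_all)
  next
    case (Suc m)
    show ?case
    proof (cases "m < n")
      case True
      then have "Suc (n - Suc m) = n - m" "n - Suc m < n" by auto
      then show ?thesis by (intro step) (use Suc eq[of "n - Suc m"] in simp_all)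
    next
      case False
      then show ?thesis using Suc by simp
    qed
  qed
  from this[of "n - i"] \<open>i \<le> n\<close> show ?thesis by simp
qed

text \<open>At even k both neighbours have odd index, where the solution is 0. At k = 2r + 1 the
  equation is the quotient of consecutive terms of the product formula.\<close>

lemma sol_ab_kernel:
  assumes s: "s < 2" and nz: "\<alpha> \<noteq> 0" "\<beta> \<noteq> 0"
  shows "kernel_vec (rho \<alpha> \<beta> 0 (2 * l) s) (2 * l)
    (\<lambda>i. sol_\<alpha>\<beta> \<alpha> \<beta> (coef_b q t sb (of_nat l) s) (coef_c q t sb (of_nat l) s) l (wt l i) * nrm l i)"
proof -
  let ?b = "coef_b q t sb (of_nat l) s" and ?c = "coef_c q t sb (of_nat l) s"
  define X where "X i = sol_\<alpha>\<beta> \<alpha> \<beta> ?b ?c l (wt l i)" for i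
  have w: "- of_nat l + 2 * of_nat j = wt l (2 * j)" for j by (simp add: wt_def)
  have X: "X i = (if odd i then 0 else (- (\<alpha> / \<beta>)) ^ (i div 2) *
      ((\<Prod>j<i div 2. ?b (wt l (2 * j))) / (\<Prod>j=1..i div 2. ?c (wt l (2 * j)))))" for i
  proof -
    have "nat \<lfloor>of_nat l + wt l i\<rfloor> = i" by (simp add: wt_def)
    then show ?thesis by (simp only: X_def sol_\<alpha>\<beta>_def Let_def w)
  qed
  have rec: "X (2 * r) * nrm l (2 * r) * (\<alpha> * e_coef (2 * l - 2 * r)) +
      X (2 * Suc r) * nrm l (2 * Suc r) * (\<beta> * fk_coef (2 * l) s (2 * Suc r)) = 0" if r: "Suc r \<le>
          l" for r
  proof -
    let ?m = "Suc (2 * r)"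
    \<comment> \<open>Both b and c lead to the common neighbour 2r + 1, so multiplying by its
      \<open>nrm\<close> clears the square roots from the two coefficients simultaneously.\<close>
    have b: "?b (wt l (2 * r)) * nrm l ?m = nrm l (2 * r) * e_coef (2 * l - 2 * r)"
      using r nrm_nz[of ?m l] by (simp add: coef_b_wt s)
    have c: "?c (wt l (2 * Suc r)) * nrm l ?m = nrm l (2 * Suc r) * fk_coef (2 * l) s (2 * Suc r)"
      using r nrm_nz[of ?m l] coef_c_wt[of ?m l s] s by simp
    have "?c (wt l (2 * Suc r)) \<noteq> 0"
      using c r nrm_nz[of "2 * Suc r" l] fk_coef_nz[of "2 * Suc r" "2 * l" s] by force
    then have "X (2 * Suc r) * ?c (wt l (2 * Suc r)) = - (\<alpha> / \<beta>) * ?b (wt l (2 * r)) * X (2 * r)"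
      by (simp add: X)
    then have "X (2 * Suc r) * ?c (wt l (2 * Suc r)) * \<beta> = - \<alpha> * ?b (wt l (2 * r)) * X (2 * r)"
      using nz(2) by simp
    then have "X (2 * Suc r) * \<beta> * (?c (wt l (2 * Suc r)) * nrm l ?m) = - \<alpha> * X (2 * r) *
        (?b (wt l (2 * r)) * nrm l ?m)"
      by (simp add: mult_ac)
    then show ?thesis unfolding b c by (simp add: mult_ac)
  qed
  show ?thesis
    unfolding kernel_vec_tri X_def[symmetric]
  proof (intro allI impI)
    fix k assume k: "k \<le> 2 * l"
    show "X k * nrm l k * (0 * (k_coef (2 * l) s k - 1)) +
      (if k = 0 then 0 else X (k - 1) * nrm l (k - 1) * (\<alpha> * e_coef (2 * l - (k - 1)))) +
      (if k < 2 * l then X (Suc k) * nrm l (Suc k) * (\<beta> * fk_coef (2 * l) s (Suc k)) else 0) = 0"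
    proof (cases "odd k")
      case True
      then obtain r where r: "k = 2 * r + 1" by (elim oddE)
      then have "Suc r \<le> l" using k by simp
      from rec[OF this] show ?thesis using r \<open>Suc r \<le> l\<close> by simp
    next
      case False
      then show ?thesis by (simp add: X)
    qed
  qed
qed

text \<open>For l + s even the diagonal entry vanishes at the middle index l, so the value 1 there
  satisfies its equation with zeros below. Above l the diagonal entries are nonzero and the product
  formula is the forward recursion.\<close>

lemma sol_ag_kernel:
  assumes s: "s < 2" and ls: "even (l + s)" and nz: "\<gamma> \<noteq> 0"
  shows "kernel_vec (rho \<alpha> 0 \<gamma> (2 * l) s) (2 * l)
    (\<lambda>i. sol_\<alpha>\<gamma> \<alpha> \<gamma> (coef_a q t sb (of_nat l) s) (coef_b q t sb (of_nat l) s) (wt l i) * nrm l i)"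
proof -
  let ?a = "coef_a q t sb (of_nat l) s" and ?b = "coef_b q t sb (of_nat l) s"
  define X where "X i = sol_\<alpha>\<gamma> \<alpha> \<gamma> ?a ?b (wt l i)" for i
  have X0: "X i = 0" if "i < l" for i using that by (simp add: X_def sol_\<alpha>\<gamma>_def wt_def)
  have w: "wt l (l + m) = of_int (int m)" for m by (simp add: wt_def)
  have X: "X (l + m) = (- (\<alpha> / \<gamma>)) ^ m *
      ((\<Prod>j=0..int m - 1. ?b (of_int j)) / (\<Prod>j=1..int m. ?a (of_int j)))" for m
    unfolding X_def w sol_\<alpha>\<gamma>_def floor_of_int by simp
  have rec: "X (l + Suc m) * ?a (wt l (l + Suc m)) * \<gamma> = - \<alpha> * ?b (wt l (l + m)) * X (l + m)" if
      "Suc m \<le> l" for m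
  proof -
    have "{0..int (Suc m) - 1} = insert (int m) {0..int m - 1}"
        "{1..int (Suc m)} = insert (int (Suc m)) {1..int m}" by auto
    then have "X (l + Suc m) = (- (\<alpha> / \<gamma>)) ^ Suc m * ((?b (wt l (l + m)) *
        (\<Prod>j=0..int m - 1. ?b (of_int j))) /
        (?a (wt l (l + Suc m)) * (\<Prod>j=1..int m. ?a (of_int j))))"
      unfolding X w by simp
    also have "\<dots> = - (\<alpha> / \<gamma>) * ?b (wt l (l + m)) / ?a (wt l (l + Suc m)) * X (l + m)"
      unfolding X by (simp add: mult_ac)
    finally have "X (l + Suc m) = - (\<alpha> / \<gamma>) * ?b (wt l (l + m)) / ?a (wt l (l + Suc m)) * X (l +
        m)" .
    moreover have "?a (wt l (l + Suc m)) \<noteq> 0"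
      using that s k_coef_eq_1[of "l + Suc m" "2 * l" s] by (simp add: coef_a_wt)
    ultimately show ?thesis using nz by simp
  qed
  show ?thesis
    unfolding kernel_vec_tri X_def[symmetric]
  proof (intro allI impI)
    fix k assume k: "k \<le> 2 * l"
    have "X k * nrm l k * (\<gamma> * (k_coef (2 * l) s k - 1)) +
      (if k = 0 then 0 else X (k - 1) * nrm l (k - 1) * (\<alpha> * e_coef (2 * l - (k - 1)))) = 0"
    proof (cases "k \<le> l")
      case True
      have "k_coef (2 * l) s l = 1" using k_coef_eq_1[of l "2 * l" s] ls by simp
      then show ?thesis using True X0 by (cases "k = l") auto
    next
      case False
      then obtain m where m: "k = l + Suc m" by (metis add_Suc_right less_imp_Suc_add not_le)
      then have "Suc m \<le> l" using k by simp
      have b: "?b (wt l (l + m)) * nrm l (l + Suc m) = nrm l (l + m) * e_coef (2 * l - (l + m))"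
        using k m nrm_nz[of "l + Suc m" l] coef_b_wt[of "l + m" l s] s by simp
      have a: "?a (wt l (l + Suc m)) = k_coef (2 * l) s (l + Suc m) - 1" using k m by (simp add:
          coef_a_wt s)
      have "X (l + Suc m) * \<gamma> * (k_coef (2 * l) s (l + Suc m) - 1) * nrm l (l + Suc m) = - \<alpha> *
          X (l + m) * (?b (wt l (l + m)) * nrm l (l + Suc m))"
        using arg_cong[OF rec[OF \<open>Suc m \<le> l\<close>], of "\<lambda>x. x * nrm l (l + Suc m)"] unfolding a by
            (simp add: mult_ac)
      then show ?thesis unfolding b m by (simp add: mult_ac)
    qed
    then show "X k * nrm l k * (\<gamma> * (k_coef (2 * l) s k - 1)) +
      (if k = 0 then 0 else X (k - 1) * nrm l (k - 1) * (\<alpha> * e_coef (2 * l - (k - 1)))) +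
      (if k < 2 * l then X (Suc k) * nrm l (Suc k) * (0 * fk_coef (2 * l) s (Suc k)) else 0) = 0"
      by (simp only: mult_zero_left mult_zero_right if_cancel add_0_right)
  qed
qed

text \<open>The same with directions exchanged: zeros above the middle index, and the product
  formula as the recursion going down from it.\<close>

lemma sol_bg_kernel:
  assumes s: "s < 2" and ls: "even (l + s)" and nz: "\<gamma> \<noteq> 0"
  shows "kernel_vec (rho 0 \<beta> \<gamma> (2 * l) s) (2 * l)
    (\<lambda>i. sol_\<beta>\<gamma> \<beta> \<gamma> (coef_a q t sb (of_nat l) s) (coef_c q t sb (of_nat l) s) (wt l i) * nrm l i)"
proof -
  let ?a = "coef_a q t sb (of_nat l) s" and ?c = "coef_c q t sb (of_nat l) s"
  define X where "X i = sol_\<beta>\<gamma> \<beta> \<gamma> ?a ?c (wt l i)" for i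
  have X0: "X i = 0" if "i > l" for i using that by (simp add: X_def sol_\<beta>\<gamma>_def wt_def)
  have w: "wt l (l - m) = of_int (- int m)" if "m \<le> l" for m using that by (simp add: wt_def
      of_nat_diff)
  have X: "X (l - m) = (- (\<beta> / \<gamma>)) ^ m * ((\<Prod>j=- int m +
      1..0. ?c (of_int j)) / (\<Prod>j=- int m..-1. ?a (of_int j)))" if "m \<le> l" for m
    unfolding X_def w[OF that] sol_\<beta>\<gamma>_def floor_of_int by simp
  have rec: "X (l - Suc m) * ?a (wt l (l - Suc m)) * \<gamma> = - \<beta> * ?c (wt l (l - m)) * X (l - m)" if
      m: "Suc m \<le> l" for m
  proof -
    have m': "m \<le> l" using m by simp
    have "{- int (Suc m) + 1..0} = insert (- int m) {- int m + 1..0}"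
        "{- int (Suc m)..-1} = insert (- int (Suc m)) {- int m..-1}" by auto
    then have "X (l - Suc m) = (- (\<beta> / \<gamma>)) ^ Suc m * ((?c (wt l (l - m)) * (\<Prod>j=- int m +
        1..0. ?c (of_int j))) /
        (?a (wt l (l - Suc m)) * (\<Prod>j=- int m..-1. ?a (of_int j))))"
      unfolding X[OF m] w[OF m] w[OF m'] by simp
    also have "\<dots> = - (\<beta> / \<gamma>) * ?c (wt l (l - m)) / ?a (wt l (l - Suc m)) * X (l - m)"
      unfolding X[OF m'] by (simp add: mult_ac)
    finally have "X (l - Suc m) = - (\<beta> / \<gamma>) * ?c (wt l (l - m)) / ?a (wt l (l - Suc m)) *
        X (l - m)" .
    moreover have "?a (wt l (l - Suc m)) \<noteq> 0"
    proof -
      have "2 * l \<noteq> 2 * (l - Suc m)" "l - Suc m \<le> 2 * l" using m by linarith+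
      then have "k_coef (2 * l) s (l - Suc m) \<noteq> 1" by (simp only: k_coef_eq_1) blast
      then show ?thesis using m s by (simp add: coef_a_wt)
    qed
    ultimately show ?thesis using nz by simp
  qed
  show ?thesis
    unfolding kernel_vec_tri X_def[symmetric]
  proof (intro allI impI)
    fix k assume k: "k \<le> 2 * l"
    have "X k * nrm l k * (\<gamma> * (k_coef (2 * l) s k - 1)) +
      (if k < 2 * l then X (Suc k) * nrm l (Suc k) * (\<beta> * fk_coef (2 * l) s (Suc k)) else 0) = 0"
    proof (cases "k \<ge> l")
      case True
      have "k_coef (2 * l) s l = 1" using k_coef_eq_1[of l "2 * l" s] ls by simp
      then show ?thesis using True X0 by (cases "k = l") auto
    next
      case False
      define m where "m = l - Suc k"
      have m: "Suc m \<le> l" "k = l - Suc m" "Suc k = l - m" using False by (auto simp: m_def)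
      have c: "?c (wt l (Suc k)) * nrm l k = nrm l (Suc k) * fk_coef (2 * l) s (Suc k)"
        using False nrm_nz[of k l] coef_c_wt[of k l s] s by simp
      have a: "?a (wt l k) = k_coef (2 * l) s k - 1" using k by (simp add: coef_a_wt s)
      have "X k * \<gamma> * (k_coef (2 * l) s k - 1) * nrm l k = - \<beta> * X (Suc k) * (?c (wt l (Suc k)) *
          nrm l k)"
        using arg_cong[OF rec[OF m(1)], of "\<lambda>x. x * nrm l k"] unfolding m(2)[symmetric]
            m(3)[symmetric] a by (simp add: mult_ac)
      then show ?thesis using False unfolding c by (simp add: mult_ac)
    qed
    then show "X k * nrm l k * (\<gamma> * (k_coef (2 * l) s k - 1)) +
      (if k = 0 then 0 else X (k - 1) * nrm l (k - 1) * (0 * e_coef (2 * l - (k - 1)))) +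
      (if k < 2 * l then X (Suc k) * nrm l (Suc k) * (\<beta> * fk_coef (2 * l) s (Suc k)) else 0) = 0"
      by (simp only: mult_zero_left mult_zero_right if_cancel add_0_right)
  qed
qed

end

theorem theorem3p5:
  fixes q r t \<alpha> \<beta> \<gamma> :: complex
    and sb :: "nat \<Rightarrow> nat \<Rightarrow> complex"
  assumes q_nonzero: "q \<noteq> 0"
    and q_not_root_of_1: "\<And>n::nat. n > 0 \<Longrightarrow> q ^ n \<noteq> 1"
    and r_sqrt: "r ^ 2 = q"
    and t_def: "t = \<i> * r"
    and sb_sqrt: "\<And>m n. n \<le> m \<Longrightarrow> (sb m n) ^ 2 = qbinom (1 / t ^ 2) m n"
    and nonzero: "\<alpha> \<noteq> 0" "\<beta> \<noteq> 0" "\<gamma> \<noteq> 0"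
  shows
    "right_inv_subalg q t (x_\<alpha>\<beta> q \<alpha> \<beta>) =
       lin_span (Aq t)
         {mat_comb t sb (of_nat l) s
            (sol_\<alpha>\<beta> \<alpha> \<beta> (coef_b q t sb (of_nat l) s) (coef_c q t sb (of_nat l) s) l) j
          | (l::nat) s j. s \<in> {0, 1} \<and> j \<in> I_set (of_nat l)} \<and>
     right_inv_subalg q t (x_\<alpha>\<gamma> q \<alpha> \<gamma>) =
       lin_span (Aq t)
         {mat_comb t sb (of_nat l) s
            (sol_\<alpha>\<gamma> \<alpha> \<gamma> (coef_a q t sb (of_nat l) s) (coef_b q t sb (of_nat l) s)) j
          | (l::nat) s j. s \<in> {0, 1} \<and> even (l + s) \<and> j \<in> I_set (of_nat l)} \<and>
     right_inv_subalg q t (x_\<beta>\<gamma> q \<beta> \<gamma>) =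
       lin_span (Aq t)
         {mat_comb t sb (of_nat l) s
            (sol_\<beta>\<gamma> \<beta> \<gamma> (coef_a q t sb (of_nat l) s) (coef_c q t sb (of_nat l) s)) j
          | (l::nat) s j. s \<in> {0, 1} \<and> even (l + s) \<and> j \<in> I_set (of_nat l)}"
proof -
  interpret osp_sqrt q t sb
  proof
    show "t \<noteq> 0" using q_nonzero r_sqrt t_def by auto
    show "t\<^sup>2 = - q" using r_sqrt t_def by (simp add: power_mult_distrib)
  qed (use q_not_root_of_1 sb_sqrt in auto)
  have x: "x_\<alpha>\<beta> q \<alpha> \<beta> = U_proj q (x_general \<alpha> \<beta> 0)" "x_\<alpha>\<gamma> q \<alpha> \<gamma> = U_proj q (x_general \<alpha> 0 \<gamma>)"
    "x_\<beta>\<gamma> q \<beta> \<gamma> = U_proj q (x_general 0 \<beta> \<gamma>)"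
    by (simp_all add: x_\<alpha>\<beta>_def x_\<alpha>\<gamma>_def x_\<beta>\<gamma>_def x_general_def)
  have w: "wt l l = 0" "wt l 0 = - of_nat l" for l by (simp_all add: wt_def)
  have middle: "k = l" if "k \<le> 2 * l" "k_coef (2 * l) s k = 1" for k l s
    using that k_coef_eq_1 by auto
  have no: "\<exists>l. n = 2 * l \<and> even (l + s)" if "k \<le> n" "k_coef n s k = 1" for k n s
    using that k_coef_eq_1 by blast
  show ?thesis
    unfolding x
  proof (intro conjI, goal_cases)
    case 1
    show ?case
    \<comment> \<open>No condition on l and s here. The pivot 0 is the weight -l, where the solution
      has the value 1; odd n are excluded by the descending chain.\<close>
    proof (rule right_inv_mat_comb[where p = "\<lambda>l. 0" and P = "\<lambda>l s. True", unfolded simp_thms])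
      fix n s i :: nat and y assume "\<nexists>l. n = 2 * l" and y: "kernel_vec (rho \<alpha> \<beta> 0 n s) n y" and i:
          "i \<le> n"
      then have "odd n" by (auto elim: evenE)
      then show "y i = 0" using kernel_e_fk[OF nonzero(1,2) y] i by blast
    qed (use sol_ab_kernel nonzero kernel_e_fk(1) in \<open>auto simp: w sol_\<alpha>\<beta>_def\<close>)
  next
    case 2
    show ?case
    \<comment> \<open>The pivot l is the weight 0, the only index at which a diagonal entry can
      vanish; it does so exactly if l + s is even.\<close>
    proof (rule right_inv_mat_comb[where p = "\<lambda>l. l"])
      fix l s i :: nat and y assume y: "kernel_vec (rho \<alpha> 0 \<gamma> (2 * l) s) (2 * l) y" "y l = 0"
          "i \<le> 2 * l"
      show "y i = 0" by (rule kernel_e_k[OF y(1) _ nonzero(3) y(3)]) (use middle y(2) in blast)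
    next
      fix n s i :: nat and y assume "\<nexists>l. n = 2 * l \<and> even (l + s)" and y:
          "kernel_vec (rho \<alpha> 0 \<gamma> n s) n y" "i \<le> n"
      then show "y i = 0" by (intro kernel_e_k[OF y(1) _ nonzero(3) y(2)]) (use no in blast)
    qed (use sol_ag_kernel nonzero in \<open>auto simp: w sol_\<alpha>\<gamma>_def\<close>)
  next
    case 3
    show ?case
    proof (rule right_inv_mat_comb[where p = "\<lambda>l. l"])
      fix l s i :: nat and y assume y: "kernel_vec (rho 0 \<beta> \<gamma> (2 * l) s) (2 * l) y" "y l = 0"
          "i \<le> 2 * l"
      show "y i = 0" by (rule kernel_fk_k[OF y(1) _ nonzero(3) y(3)]) (use middle y(2) in blast)
    next
      fix n s i :: nat and y assume "\<nexists>l. n = 2 * l \<and> even (l + s)" and y: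
          "kernel_vec (rho 0 \<beta> \<gamma> n s) n y" "i \<le> n"
      then show "y i = 0" by (intro kernel_fk_k[OF y(1) _ nonzero(3) y(2)]) (use no in blast)
    qed (use sol_bg_kernel nonzero in \<open>auto simp: w sol_\<beta>\<gamma>_def\<close>)
  qed
qed

end
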